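(* Let $N$ agents be given by $$\dot x_i=A_ix_i+B_iu_i+E_i\omega_i,\qquad y_i=C_ix_i,\qquad \dot\omega_i=S_i\omega_i,\qquad i=1,\dots,N,$$ with $x_i(t)\in\mathbb{R}^{n_i}$, $u_i(t)\in\mathbb{R}$, $y_i(t)\in\mathbb{R}$, $\omega_i(t)\in\mathbb{R}^{q_i}$ and constant real matrices $A_i,B_i,C_i,E_i,S_i$ of compatible dimensions, where $(C_i,A_i,B_i)$ is minimal (i.e. $(A_i,B_i)$ is controllable and $(C_i,A_i)$ is observable) and $(E_i,S_i)$ is observable. Let $d_i\in\mathbb{R}$ and let $f_i:\mathbb{R}\to\mathbb{R}$ be twice continuously differentiable functions for which there are constants $0<\underline h_i\le\bar h_i<\infty$ with $\underline h_i\le\nabla^2f_i(s)\le\bar h_i$ for all $s\in\mathbb{R}$. Let $\mathcal G$ be a connected undirected weighted graph on $\{1,\dots,N\}$ with adjacency weights $a_{ij}=a_{ji}\ge0$, $a_{ii}=0$. Suppose that for each $i$ there exist constant matrices $X_{i1},X_{i2},U_{i1},U_{i2}$ such that $$X_{i1}S_i=A_iX_{i1}+B_iU_{i1}+E_i,\quad 0=C_iX_{i1},\qquad 0=A_iX_{i2}+B_iU_{i2},\quad 1=C_iX_{i2}.$$ For each $i$ choose $K_{i1}$ such that $A_i+B_iK_{i1}$ is Hurwitz, set $K_{i2}=U_{i1}-K_{i1}X_{i1}$ and $K_{i3}=U_{i2}-K_{i1}X_{i2}$, and choose $\bar L_i$ such that $S_i-\bar L_iE_i$ is Hurwitz. Consider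 the controller $$\begin{aligned} u_i&=K_{i1}x_i+K_{i2}\eta_i+K_{i3}z_i,\qquad \eta_i=\bar\eta_i+\bar L_ix_i,\\ \dot{\bar\eta}_i&=(S_i-\bar L_iE_i)\bar\eta_i+(S_i\bar L_i-\bar L_iE_i\bar L_i-\bar L_iA_i)x_i-\bar L_iB_iu_i,\\ \dot z_i&=-\nabla f_i(z_i)+\lambda_i,\\ \dot\lambda_i&=-\lambda_i^0-v_i^0+d_i-z_i,\\ \dot v_i&=\lambda_i^0, \end{aligned}$$ where $\lambda_i^0=\sum_{j=1}^Na_{ij}(\lambda_i-\lambda_j)$ and $v_i^0=\sum_{j=1}^Na_{ij}(v_i-v_j)$. Then this controller exponentially solves the distributed optimal steady-state regulation problem: for every initial condition of the closed-loop system and of the disturbances $\omega_i$, and for each $i=1,\dots,N$, the output $y_i(t)$ converges exponentially fast to $y_i^*$ as $t\to\infty$, where $y^*=(y_1^*,\dots,y_N^* )$ is the optimal solution of $$\text{minimize }\ \sum_{i=1}^Nf_i(y_i)\quad\text{subject to}\quad \sum_{i=1}^Ny_i=\sum_{i=1}^Nd_i .$$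
   Context: A square real matrix is Hurwitz if all its eigenvalues have negative real part. The pair $(E_i,S_i)$ is observable if the linear system $\dot\omega=S_i\omega$ with output $E_i\omega$ is observable. Under the stated assumptions on $f_i$, the constrained optimization problem has a unique optimal solution $y^*$. In $\mathcal G$, $a_{ij}>0$ if and only if there is an edge between nodes $i$ and $j$. Convergence of $y_i(t)$ to $y_i^*$ exponentially fast means that there are constants $\mu_1,\mu_2>0$ (where $\mu_1$ may depend on the initial conditions) with $|y_i(t)-y_i^*|\le\mu_1e^{-\mu_2t}$ for all $t\ge0$. For the scalar function $f_i$, $\nabla f_i$ and $\nabla^2f_i$ are its first and second derivatives. *)

theory Defs
  imports
    "HOL-Analysis.Analysis"
    "Jordan_Normal_Form.Char_Poly"
    "Graph_Theory.Digraph_Component"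
begin

no_notation Finite_Cartesian_Product.vec_nth (infixl \<open>$\<close> 90)
hide_type (open) Finite_Cartesian_Product.vec
hide_const (open) Finite_Cartesian_Product.vec

(* The agents have different state dimensions, so vectors and matrices are the dimension-indexed
   ones of Jordan_Normal_Form. Vectors do not form a normed space there, and derivatives are taken
   componentwise. The first conjunct keeps the dimension constant on T. *)
definition has_vec_derivative ::
    "(real \<Rightarrow> real Matrix.vec) \<Rightarrow> real Matrix.vec \<Rightarrow> real \<Rightarrow> real set \<Rightarrow> bool" where
  "has_vec_derivative x D t T \<longleftrightarrow>
     (\<forall>s\<in>T. dim_vec (x s) = dim_vec D) \<and>
     (\<forall>k<dim_vec D. ((\<lambda>s. x s $ k) has_real_derivative D $ k) (at t within T))"

definition hurwitz :: "real mat \<Rightarrow> bool" where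
  "hurwitz M \<longleftrightarrow> square_mat M \<and>
     (\<forall>k. eigenvalue (map_mat complex_of_real M) k \<longrightarrow> Re k < 0)"

(* Every state can be steered to every other state in finite time by a continuous input. *)
definition controllable :: "real mat \<Rightarrow> real mat \<Rightarrow> bool" where
  "controllable A B \<longleftrightarrow>
     (\<forall>x0\<in>carrier_vec (dim_row A). \<forall>x1\<in>carrier_vec (dim_row A).
        \<exists>T>0. \<exists>u x.
          (\<forall>t\<in>{0..T}. u t \<in> carrier_vec (dim_col B)) \<and>
          (\<forall>k<dim_col B. continuous_on {0..T} (\<lambda>t. u t $ k)) \<and>
          (\<forall>t\<in>{0..T}. has_vec_derivative x (A *\<^sub>v x t + B *\<^sub>v u t) t {0..T}) \<and>
          x 0 = x0 \<and> x T = x1)"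

(* The output C x of x' = A x determines the initial state. *)
definition observable :: "real mat \<Rightarrow> real mat \<Rightarrow> bool" where
  "observable C A \<longleftrightarrow>
     (\<forall>x x'.
        (\<forall>t\<ge>0. has_vec_derivative x (A *\<^sub>v x t) t {0..}) \<and>
        (\<forall>t\<ge>0. has_vec_derivative x' (A *\<^sub>v x' t) t {0..}) \<and>
        (\<forall>t\<ge>0. C *\<^sub>v x t = C *\<^sub>v x' t)
        \<longrightarrow> x 0 = x' 0)"

definition minimal_realization :: "real mat \<Rightarrow> real mat \<Rightarrow> real mat \<Rightarrow> bool" where
  "minimal_realization C A B \<longleftrightarrow> controllable A B \<and> observable C A"

definition twice_cont_differentiable :: "(real \<Rightarrow> real) \<Rightarrow> bool" where
  "twice_cont_differentiable f \<longleftrightarrow>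
     f differentiable_on UNIV \<and> deriv f differentiable_on UNIV \<and>
     continuous_on UNIV (deriv (deriv f))"

definition weight_graph :: "nat \<Rightarrow> (nat \<Rightarrow> nat \<Rightarrow> real) \<Rightarrow> nat pair_pre_digraph" where
  "weight_graph N a =
     \<lparr>pverts = {1..N}, parcs = {(i, j). i \<in> {1..N} \<and> j \<in> {1..N} \<and> 0 < a i j}\<rparr>"

definition connected_weighted_graph :: "nat \<Rightarrow> (nat \<Rightarrow> nat \<Rightarrow> real) \<Rightarrow> bool" where
  "connected_weighted_graph N a \<longleftrightarrow>
     (\<forall>i\<in>{1..N}. \<forall>j\<in>{1..N}. a i j = a j i \<and> 0 \<le> a i j) \<and>
     (\<forall>i\<in>{1..N}. a i i = 0) \<and>
     Digraph_Component.connected (with_proj (weight_graph N a))"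

definition network_diff :: "nat \<Rightarrow> (nat \<Rightarrow> nat \<Rightarrow> real) \<Rightarrow> (nat \<Rightarrow> real) \<Rightarrow> nat \<Rightarrow> real" where
  "network_diff N a p i = (\<Sum>j=1..N. a i j * (p i - p j))"

(* Membership in extensional fixes the irrelevant values outside {1..N}, so that an optimal
   solution can be unique as a function. *)
definition optimal_solution ::
    "nat \<Rightarrow> (nat \<Rightarrow> real \<Rightarrow> real) \<Rightarrow> (nat \<Rightarrow> real) \<Rightarrow> (nat \<Rightarrow> real) \<Rightarrow> bool" where
  "optimal_solution N f d y \<longleftrightarrow>
     is_arg_min (\<lambda>y. \<Sum>i=1..N. f i (y i))
       (\<lambda>y. y \<in> extensional {1..N} \<and> (\<Sum>i=1..N. y i) = (\<Sum>i=1..N. d i)) y"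

(* The fields hold x, omega, eta-bar, z, lambda and v of one agent. *)
record agent_state =
  plant_state :: "real Matrix.vec"
  disturbance :: "real Matrix.vec"
  observer_state :: "real Matrix.vec"
  decision :: real
  multiplier :: real
  integrator :: real

definition state_space :: "nat \<Rightarrow> (nat \<Rightarrow> nat) \<Rightarrow> (nat \<Rightarrow> nat) \<Rightarrow> (nat \<Rightarrow> agent_state) set" where
  "state_space N n q =
     {\<sigma>. \<forall>i\<in>{1..N}. plant_state (\<sigma> i) \<in> carrier_vec (n i) \<and>
        disturbance (\<sigma> i) \<in> carrier_vec (q i) \<and> observer_state (\<sigma> i) \<in> carrier_vec (q i)}"

(* The scalar input is a vector of dimension 1. *)
definition control_input ::
    "real mat \<Rightarrow> real mat \<Rightarrow> real mat \<Rightarrow> real mat \<Rightarrow> agent_state \<Rightarrow> real Matrix.vec" where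
  "control_input K1 K2 K3 L s =
     K1 *\<^sub>v plant_state s
     + K2 *\<^sub>v (observer_state s + L *\<^sub>v plant_state s)
     + K3 *\<^sub>v Matrix.vec 1 (\<lambda>_. decision s)"

definition agent_output :: "real mat \<Rightarrow> agent_state \<Rightarrow> real" where
  "agent_output C s = (C *\<^sub>v plant_state s) $ 0"

definition closed_loop_solution ::
    "nat \<Rightarrow> (nat \<Rightarrow> real mat) \<Rightarrow> (nat \<Rightarrow> real mat) \<Rightarrow> (nat \<Rightarrow> real mat) \<Rightarrow> (nat \<Rightarrow> real mat) \<Rightarrow>
     (nat \<Rightarrow> real mat) \<Rightarrow> (nat \<Rightarrow> real mat) \<Rightarrow> (nat \<Rightarrow> real mat) \<Rightarrow> (nat \<Rightarrow> real mat) \<Rightarrow>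
     (nat \<Rightarrow> real \<Rightarrow> real) \<Rightarrow> (nat \<Rightarrow> real) \<Rightarrow> (nat \<Rightarrow> nat \<Rightarrow> real) \<Rightarrow>
     (real \<Rightarrow> nat \<Rightarrow> agent_state) \<Rightarrow> bool" where
  "closed_loop_solution N A B E S K1 K2 K3 L f d a \<phi> \<longleftrightarrow>
     (\<forall>i\<in>{1..N}. \<forall>t\<ge>0.
        let x = plant_state (\<phi> t i);
            w = disturbance (\<phi> t i);
            e = observer_state (\<phi> t i);
            z = decision (\<phi> t i);
            lam = multiplier (\<phi> t i);
            u = control_input (K1 i) (K2 i) (K3 i) (L i) (\<phi> t i);
            lam0 = network_diff N a (\<lambda>j. multiplier (\<phi> t j)) i;
            v0 = network_diff N a (\<lambda>j. integrator (\<phi> t j)) i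
        in has_vec_derivative (\<lambda>s. plant_state (\<phi> s i))
             (A i *\<^sub>v x + B i *\<^sub>v u + E i *\<^sub>v w) t {0..} \<and>
           has_vec_derivative (\<lambda>s. disturbance (\<phi> s i)) (S i *\<^sub>v w) t {0..} \<and>
           has_vec_derivative (\<lambda>s. observer_state (\<phi> s i))
             ((S i - L i * E i) *\<^sub>v e + (S i * L i - L i * E i * L i - L i * A i) *\<^sub>v x
              - (L i * B i) *\<^sub>v u) t {0..} \<and>
           ((\<lambda>s. decision (\<phi> s i)) has_real_derivative - deriv (f i) z + lam)
             (at t within {0..}) \<and>
           ((\<lambda>s. multiplier (\<phi> s i)) has_real_derivative - lam0 - v0 + d i - z)
             (at t within {0..}) \<and>
           ((\<lambda>s. integrator (\<phi> s i)) has_real_derivative lam0) (at t within {0..}))"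

definition starts_at ::
    "nat \<Rightarrow> (nat \<Rightarrow> agent_state) \<Rightarrow> (real \<Rightarrow> nat \<Rightarrow> agent_state) \<Rightarrow> bool" where
  "starts_at N \<sigma> \<phi> \<longleftrightarrow> (\<forall>i\<in>{1..N}. \<phi> 0 i = \<sigma> i)"

end

theory Submission
  imports Defs "Jordan_Normal_Form.Schur_Decomposition"
begin

text \<open>The KKT conditions for the resource constraint say that all gradients agree at the optimum,
  so the optimum is found by inverting the gradients and choosing the common multiplier by the
  intermediate value theorem. The decision, multiplier and integrator variables evolve
  independently of the plants. A quadratic Lyapunov function, the distance to the saddle point
  plus two small cross terms, decreases exponentially along them, because the Laplacian of a
  connected graph is invertible on vectors of mean zero. Each plant is then a cascade of two linear
  systems: the error of the observer for \<open>\<omega>\<close> obeys \<open>\<epsilon>' = (S - L E) \<epsilon>\<close>, and by the regulator equations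
  \<open>\<xi> = x - X1 \<omega> - X2 z\<close> obeys \<open>\<xi>' = (A + B K1) \<xi> + B K2 \<epsilon> - X2 z'\<close> while \<open>y = C \<xi> + z\<close>. Hurwitz
  matrices carry exponentially decaying inputs to exponentially decaying states, which is read off
  a Schur triangularisation. The closed loop is globally Lipschitz, so Picard iteration yields
  solutions on the whole half-line.\<close>

subsection \<open>Differential inequalities and Picard iteration\<close>

text \<open>The order of quantifiers shapes every decay lemma. The theorem fixes the rate before the
  initial state and the amplitude before the trajectory, so bounding each solution separately would
  not do. The lemmas therefore have the form \<open>\<exists>c. \<forall>x g\<close>: their
  constants depend on the system and on bounds for the initial data, and serve all solutions at
  once. Decay along all trajectories would hold vacuously if there were none, so existence is part
  of the conclusion. There the upper Hessian bound matters, since it makes the gradients globally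
  Lipschitz. The energy of the saddle-point system has only a semidefinite derivative. An invariance
  argument would give convergence without a rate; the cross terms make the derivative definite and
  supply one. In the linear stages each system is asked only for a rate strictly below its spectral
  margin. The gap excludes resonance and hence polynomial factors, so one rate passes through the
  cascade. A triangular form suffices for this: its components are scalar equations, and no matrix
  exponential or Jordan block is involved.\<close>

lemma at_within_atLeast_eq_Icc:
  fixes t :: real
  assumes "0 \<le> t" "t < b"
  shows "at t within {0..} = at t within {0..b}"
proof (rule at_within_nhd[of t "{..<b}"])
  show "{0..} \<inter> {..<b} - {t} = {0..b} \<inter> {..<b} - {t}" using assms by auto
qed (use assms in auto)

text \<open>Serves twice: it estimates the Picard increments in an exponentially weighted norm, and
  it bounds the accumulated forcing of a scalar equation once an integrating factor has removed the
  homogeneous part.\<close>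

lemma norm_diff_le_exp:
  fixes f :: "real \<Rightarrow> 'a::real_normed_vector"
  assumes d: "\<And>t. 0 \<le> t \<Longrightarrow> (f has_vector_derivative f' t) (at t within {0..})"
    and b: "\<And>t. 0 \<le> t \<Longrightarrow> norm (f' t) \<le> G * exp (\<gamma> * t)"
    and "0 < \<gamma>" "0 \<le> t"
  shows "norm (f t - f 0) \<le> G / \<gamma> * (exp (\<gamma> * t) - 1)"
proof (cases "t = 0")
  case False
  have "norm (f t - f 0) \<le> (\<lambda>s. G / \<gamma> * exp (\<gamma> * s)) t - (\<lambda>s. G / \<gamma> * exp (\<gamma> * s)) 0"
  proof (rule differentiable_bound_general[where f' = f' and \<phi>' = "\<lambda>s. G * exp (\<gamma> * s)"])
    show "0 < t" using assms False by simp
    have "continuous_on {0..} f"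
      unfolding continuous_on_eq_continuous_within
      using d has_vector_derivative_continuous by (metis atLeast_iff)
    then show "continuous_on {0..t} f" by (rule continuous_on_subset) auto
    show "continuous_on {0..t} (\<lambda>s. G / \<gamma> * exp (\<gamma> * s))"
      by (intro continuous_intros)
    fix s :: real assume s: "0 < s" "s < t"
    have "at s within {0..} = at s" using s by (intro at_within_interior) auto
    then show "(f has_vector_derivative f' s) (at s)" using d[of s] s by simp
    show "((\<lambda>s. G / \<gamma> * exp (\<gamma> * s)) has_vector_derivative G * exp (\<gamma> * s)) (at s)"
      unfolding has_real_derivative_iff_has_vector_derivative[symmetric]
      using \<open>0 < \<gamma>\<close> by (auto intro!: derivative_eq_intros)
    show "norm (f' s) \<le> G * exp (\<gamma> * s)" using b s by simp
  qed
  then show ?thesis by (simp add: algebra_simps)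
qed simp

text \<open>Gronwall's argument: the assumption makes \<open>W t * exp (c * t)\<close>
  nonincreasing.\<close>

lemma exp_decay_of_differential_inequality:
  fixes W :: "real \<Rightarrow> real"
  assumes d: "\<And>t. 0 \<le> t \<Longrightarrow> (W has_real_derivative W' t) (at t within {0..})"
    and b: "\<And>t. 0 \<le> t \<Longrightarrow> W' t \<le> - c * W t"
    and "0 \<le> t"
  shows "W t \<le> W 0 * exp (- c * t)"
proof -
  have "(\<lambda>t. W t * exp (c * t)) t \<le> (\<lambda>t. W t * exp (c * t)) 0"
  proof (rule DERIV_nonpos_imp_decreasing_open[OF \<open>0 \<le> t\<close>])
    fix s assume s: "0 < s" "s < t"
    have "at s within {0..} = at s" using s by (intro at_within_interior) auto
    then have "(W has_real_derivative W' s) (at s)" using d[of s] s by simp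
    then have "((\<lambda>t. W t * exp (c * t)) has_real_derivative (W' s + c * W s) * exp (c * s)) (at s)"
      by (auto intro!: derivative_eq_intros simp: algebra_simps)
    moreover have "(W' s + c * W s) * exp (c * s) \<le> 0"
      using b[of s] s by (intro mult_nonpos_nonneg) auto
    ultimately show "\<exists>y. ((\<lambda>t. W t * exp (c * t)) has_real_derivative y) (at s) \<and> y \<le> 0"
      by blast
  next
    have "continuous_on {0..} W"
      unfolding continuous_on_eq_continuous_within
      using d DERIV_continuous by (metis atLeast_iff)
    then have "continuous_on {0..t} W" by (rule continuous_on_subset) auto
    then show "continuous_on {0..t} (\<lambda>t. W t * exp (c * t))" by (intro continuous_intros)
  qed
  then have "W t * exp (c * t) * exp (- c * t) \<le> W 0 * exp (- c * t)"
    by (intro mult_right_mono) auto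
  then show ?thesis by (simp add: mult.assoc flip: exp_add)
qed

text \<open>A global Lipschitz constant excludes blow-up, so the iterates converge on the whole
  half-line at once and no continuation of local solutions is needed. The Lipschitz condition also
  forces \<open>F\<close>, on \<open>I\<close>, to depend only on the coordinates in
  \<open>I\<close>.\<close>

lemma picard_global_solution:
  fixes F :: "('i \<Rightarrow> real) \<Rightarrow> 'i \<Rightarrow> real"
  assumes fin: "finite I" and K0: "0 \<le> K"
    and lip: "\<And>i X Y. i \<in> I \<Longrightarrow> \<bar>F X i - F Y i\<bar> \<le> K * (\<Sum>j\<in>I. \<bar>X j - Y j\<bar>)"
  obtains x :: "real \<Rightarrow> 'i \<Rightarrow> real" where
    "\<And>i. i \<in> I \<Longrightarrow> x 0 i = x0 i"
    "\<And>i t. i \<in> I \<Longrightarrow> 0 \<le> t \<Longrightarrow> ((\<lambda>s. x s i) has_real_derivative F (x t) i) (at t within {0..})"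
proof -
  have Fcont: "continuous_on T (\<lambda>s. F (w s) i)"
    if "i \<in> I" and w: "\<And>j. j \<in> I \<Longrightarrow> continuous_on T (\<lambda>s. w s j)" for w i and T :: "real set"
    unfolding continuous_on_def
  proof
    fix t assume t: "t \<in> T"
    have "((\<lambda>s. K * (\<Sum>j\<in>I. \<bar>w s j - w t j\<bar>)) \<longlongrightarrow> K * (\<Sum>j\<in>I. \<bar>w t j - w t j\<bar>)) (at t within T)"
      using w t by (intro tendsto_intros) (auto simp: continuous_on_def)
    then have "((\<lambda>s. K * (\<Sum>j\<in>I. \<bar>w s j - w t j\<bar>)) \<longlongrightarrow> 0) (at t within T)" by simp
    then have "((\<lambda>s. F (w s) i - F (w t) i) \<longlongrightarrow> 0) (at t within T)"
      by (rule Lim_null_comparison[rotated]) (use lip[OF \<open>i \<in> I\<close>] in auto)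
    then show "((\<lambda>s. F (w s) i) \<longlongrightarrow> F (w t) i) (at t within T)" by (rule LIM_zero_cancel)
  qed
  \<comment> \<open>Used for the iterates and, once the fixed-point equation is known, for the
    limit.\<close>
  have step: "((\<lambda>t. x0 i + integral {0..t} (\<lambda>s. F (w s) i)) has_real_derivative F (w t) i) (at t within {0..})"
    if "i \<in> I" "0 \<le> t" and w: "\<And>j. j \<in> I \<Longrightarrow> continuous_on {0..} (\<lambda>s. w s j)" for w i t
  proof -
    have "continuous_on {0..t+1} (\<lambda>s. F (w s) i)"
      using Fcont[OF \<open>i \<in> I\<close> w] by (rule continuous_on_subset) auto
    from integral_has_real_derivative[OF this, of t] that(2)
    show ?thesis
      by (subst at_within_atLeast_eq_Icc[of t "t+1"]) (auto intro!: derivative_eq_intros)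
  qed
  define u :: "nat \<Rightarrow> real \<Rightarrow> 'i \<Rightarrow> real" where
    "u = rec_nat (\<lambda>t. x0) (\<lambda>_ w t i. x0 i + integral {0..t} (\<lambda>s. F (w s) i))"
  have u0: "u 0 t = x0" for t by (simp add: u_def)
  have uS: "u (Suc k) = (\<lambda>t i. x0 i + integral {0..t} (\<lambda>s. F (u k s) i))" for k
    by (simp add: u_def)
  have uinit: "u k 0 i = x0 i" for k i by (cases k) (simp_all add: u0 uS)
  have ucont: "i \<in> I \<Longrightarrow> continuous_on {0..} (\<lambda>s. u k s i)" for k i
  proof (induction k arbitrary: i)
    case (Suc k)
    show ?case unfolding uS continuous_on_eq_continuous_within
      using DERIV_continuous[OF step[OF Suc.prems _ Suc.IH]] by auto
  qed (simp add: u0)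
  have uder: "((\<lambda>s. u (Suc k) s i) has_real_derivative F (u k t) i) (at t within {0..})"
    if "i \<in> I" "0 \<le> t" for k i t
    unfolding uS using step[OF that ucont] .
  \<comment> \<open>\<open>K * card I\<close> is the Lipschitz constant of \<open>F\<close> in the
    sum norm over \<open>I\<close>; adding 1 keeps \<open>M\<close> positive when that product is
    0.\<close>
  define M where "M = K * card I + 1"
  have M: "0 < M" unfolding M_def using K0 by (intro add_nonneg_pos mult_nonneg_nonneg) auto
  define D where "D k t = (\<Sum>j\<in>I. \<bar>u (Suc k) t j - u k t j\<bar>)" for k t
  \<comment> \<open>The first increment has the constant derivative \<open>F x0 j\<close>;
    integrating its bound \<open>\<bar>F x0 j\<bar> * exp (2 * M * t)\<close> gives the
    denominator.\<close>
  define C where "C = (\<Sum>j\<in>I. \<bar>F x0 j\<bar> / (2 * M))"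
  have C0: "0 \<le> C" unfolding C_def using M by (intro sum_nonneg) auto
  \<comment> \<open>The weight \<^term>\<open>exp (2 * M * t)\<close> turns the Picard map into a contraction by the factor 1/2,
    uniformly on the whole half-line.\<close>
  have Dbound: "D k t \<le> C * (1/2) ^ k * exp (2 * M * t)" if "0 \<le> t" for k t
    using that
  proof (induction k arbitrary: t)
    case 0
    have "\<bar>u (Suc 0) t j - u 0 t j\<bar> \<le> \<bar>F x0 j\<bar> / (2 * M) * exp (2 * M * t)" if "j \<in> I" for j
    proof -
      have "norm (u (Suc 0) t j - u (Suc 0) 0 j) \<le> \<bar>F x0 j\<bar> / (2 * M) * (exp (2 * M * t) - 1)"
      proof (rule norm_diff_le_exp)
        fix s :: real assume "0 \<le> s"
        show "((\<lambda>t. u (Suc 0) t j) has_vector_derivative F x0 j) (at s within {0..})"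
          using uder[OF that \<open>0 \<le> s\<close>, of 0]
          by (simp add: u0 has_real_derivative_iff_has_vector_derivative)
        show "norm (F x0 j) \<le> \<bar>F x0 j\<bar> * exp (2 * M * s)"
          using M \<open>0 \<le> s\<close> by (simp add: mult_left_le_one_le mult_le_cancel_left1)
      qed (use M 0 in auto)
      also have "\<dots> \<le> \<bar>F x0 j\<bar> / (2 * M) * exp (2 * M * t)"
        using M by (intro mult_left_mono) auto
      finally show ?thesis by (simp add: uinit u0)
    qed
    then show ?case unfolding D_def C_def
      by (simp add: sum_distrib_right sum_mono)
  next
    case (Suc k)
    have "\<bar>u (Suc (Suc k)) t j - u (Suc k) t j\<bar> \<le> K * (C * (1/2) ^ k) / (2 * M) * exp (2 * M * t)"
      if "j \<in> I" for j
    proof -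
      have "norm ((\<lambda>t. u (Suc (Suc k)) t j - u (Suc k) t j) t - (\<lambda>t. u (Suc (Suc k)) t j - u (Suc k) t j) 0)
        \<le> K * (C * (1/2) ^ k) / (2 * M) * (exp (2 * M * t) - 1)"
      proof (rule norm_diff_le_exp)
        fix s :: real assume s: "0 \<le> s"
        show "((\<lambda>t. u (Suc (Suc k)) t j - u (Suc k) t j) has_vector_derivative
            F (u (Suc k) s) j - F (u k s) j) (at s within {0..})"
          using uder[OF that s] unfolding has_real_derivative_iff_has_vector_derivative
          by (intro has_vector_derivative_diff) auto
        have "norm (F (u (Suc k) s) j - F (u k s) j) \<le> K * D k s"
          using lip[OF that] by (simp add: D_def)
        also have "\<dots> \<le> K * (C * (1/2) ^ k * exp (2 * M * s))"
          using Suc.IH[OF s] K0 by (intro mult_left_mono) auto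
        finally show "norm (F (u (Suc k) s) j - F (u k s) j) \<le> K * (C * (1/2) ^ k) * exp (2 * M * s)"
          by (simp add: mult.assoc)
      qed (use M Suc.prems in auto)
      also have "\<dots> \<le> K * (C * (1/2) ^ k) / (2 * M) * exp (2 * M * t)"
        using M K0 C0 by (intro mult_left_mono) auto
      finally show ?thesis by (simp add: uinit)
    qed
    then have "D (Suc k) t \<le> (\<Sum>j\<in>I. K * (C * (1/2) ^ k) / (2 * M) * exp (2 * M * t))"
      unfolding D_def by (intro sum_mono)
    also have "\<dots> = (K * card I / M) * (C * (1/2) ^ Suc k * exp (2 * M * t))"
      by (simp add: mult_ac)
    also have "\<dots> \<le> 1 * (C * (1/2) ^ Suc k * exp (2 * M * t))"
      using C0 M by (intro mult_right_mono) (auto simp: M_def)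
    finally show ?case by simp
  qed
  \<comment> \<open>Written as a telescoping series, so that the geometric bound on \<open>D\<close>
    gives uniform convergence on bounded intervals by the M-test.\<close>
  define x where "x t i = x0 i + (\<Sum>k. u (Suc k) t i - u k t i)" for t i
  have ulim: "uniform_limit {0..T} (\<lambda>k t. u k t i) (\<lambda>t. x t i) sequentially" if "i \<in> I" for i T
  proof -
    have "uniform_limit {0..T} (\<lambda>n t. \<Sum>k<n. u (Suc k) t i - u k t i)
      (\<lambda>t. \<Sum>k. u (Suc k) t i - u k t i) sequentially"
    proof (rule Weierstrass_m_test)
      fix k t assume t: "t \<in> {0..T}"
      have "norm (u (Suc k) t i - u k t i) \<le> D k t"
        unfolding D_def using fin that by (auto intro: member_le_sum)
      also have "\<dots> \<le> C * (1/2) ^ k * exp (2 * M * t)" using Dbound t by auto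
      also have "\<dots> \<le> C * (1/2) ^ k * exp (2 * M * T)"
        using C0 M t by (intro mult_left_mono) auto
      finally show "norm (u (Suc k) t i - u k t i) \<le> C * exp (2 * M * T) * (1/2) ^ k"
        by (simp add: mult_ac)
    next
      show "summable (\<lambda>k. C * exp (2 * M * T) * (1 / 2) ^ k)"
        by (intro summable_mult summable_geometric) simp
    qed
    then have "uniform_limit {0..T} (\<lambda>n t. x0 i + (\<Sum>k<n. u (Suc k) t i - u k t i))
      (\<lambda>t. x t i) sequentially"
      unfolding x_def by (intro uniform_limit_add uniform_limit_const)
    then show ?thesis by (simp add: sum_lessThan_telescope[of "\<lambda>k. u k _ i"] u0)
  qed
  have xlim: "(\<lambda>k. u k t i) \<longlonglongrightarrow> x t i" if "i \<in> I" "0 \<le> t" for i t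
    using tendsto_uniform_limitI[OF ulim[OF that(1), of t], of t] that by simp
  have xcont: "continuous_on {0..T} (\<lambda>t. x t i)" if "i \<in> I" for i T
    by (rule uniform_limit_theorem[OF _ ulim[OF that]])
      (auto intro!: always_eventually continuous_on_subset[OF ucont[OF that]])
  have xcont': "continuous_on {0..} (\<lambda>t. x t i)" if "i \<in> I" for i
    unfolding continuous_on_eq_continuous_within
  proof
    fix t :: real assume "t \<in> {0..}"
    then show "continuous (at t within {0..}) (\<lambda>t. x t i)"
      using xcont[OF that, of "t+1"] at_within_atLeast_eq_Icc[of t "t+1"]
      by (auto simp: continuous_on_eq_continuous_within)
  qed
  have fixpoint: "x t i = x0 i + integral {0..t} (\<lambda>s. F (x s) i)" if i: "i \<in> I" and t: "0 \<le> t" for i t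
  proof -
    have "uniform_limit {0..t} (\<lambda>k s. F (u k s) i) (\<lambda>s. F (x s) i) sequentially"
    proof (rule uniform_limitI)
      fix e :: real assume e: "0 < e"
      \<comment> \<open>An error \<open>e'\<close> in every coordinate costs at most
        \<open>K * card I * e'\<close> in \<open>F\<close>, which is strictly below
        \<open>M * e'\<close>.\<close>
      define e' where "e' = e / M"
      have e': "0 < e'" using e M by (simp add: e'_def)
      have "\<forall>\<^sub>F k in sequentially. \<forall>j\<in>I. \<forall>s\<in>{0..t}. dist (u k s j) (x s j) < e'"
        using ulim[of _ t] e' fin by (auto simp: uniform_limit_iff eventually_ball_finite_distrib)
      then show "\<forall>\<^sub>F k in sequentially. \<forall>s\<in>{0..t}. dist (F (u k s) i) (F (x s) i) < e"
      proof eventually_elim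
        case (elim k)
        show ?case
        proof
          fix s assume s: "s \<in> {0..t}"
          have "dist (F (u k s) i) (F (x s) i) \<le> K * (\<Sum>j\<in>I. \<bar>u k s j - x s j\<bar>)"
            using lip[OF i] by (simp add: dist_real_def)
          also have "\<dots> \<le> K * (\<Sum>j\<in>I. e')"
            using elim s K0 by (intro mult_left_mono sum_mono) (auto simp: dist_real_def less_imp_le)
          also have "\<dots> < M * e'" using e' by (simp add: M_def algebra_simps)
          also have "\<dots> = e" using M by (simp add: e'_def)
          finally show "dist (F (u k s) i) (F (x s) i) < e" .
        qed
      qed
    qed
    then obtain J1 J2 where J: "\<And>k. ((\<lambda>s. F (u k s) i) has_integral J1 k) {0..t}"
      "((\<lambda>s. F (x s) i) has_integral J2) {0..t}" "J1 \<longlonglongrightarrow> J2"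
    proof (rule uniform_limit_integral)
      show "continuous_on {0..t} (\<lambda>s. F (u k s) i)" for k
        by (rule continuous_on_subset[OF Fcont[OF i, of "{0..}" "u k"]]) (auto intro: ucont)
    qed auto
    have "(\<lambda>k. u (Suc k) t i) \<longlonglongrightarrow> x0 i + J2"
      unfolding uS integral_unique[OF J(1)] by (intro tendsto_intros J)
    moreover have "(\<lambda>k. u (Suc k) t i) \<longlonglongrightarrow> x t i"
      using xlim[OF i t] by (rule LIMSEQ_Suc)
    ultimately have "x t i = x0 i + J2" by (rule LIMSEQ_unique[rotated])
    then show ?thesis by (simp only: integral_unique[OF J(2)])
  qed
  show thesis
  proof
    show "x 0 i = x0 i" if "i \<in> I" for i by (subst fixpoint[OF that]) auto
    show "((\<lambda>s. x s i) has_real_derivative F (x t) i) (at t within {0..})" if "i \<in> I" "0 \<le> t" for i t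
    proof (rule has_field_derivative_transform_within[OF step[where w = x], where d = 1])
      show "x0 i + integral {0..s} (\<lambda>s. F (x s) i) = x s i" if "s \<in> {0..}" for s
        using fixpoint[OF \<open>i \<in> I\<close>, of s] that by simp
    qed (use that xcont' in auto)
  qed
qed

subsection \<open>Decay of perturbed Hurwitz systems\<close>

text \<open>Variation of constants: the factor \<open>exp (- c * s)\<close> leaves only the forcing,
  whose transformed norm grows like \<open>exp (\<gamma> * s)\<close> with
  \<open>\<gamma> = - Re c - \<beta>\<close>. Positivity of this gap keeps the rate of the forcing
  without a factor t.\<close>

lemma norm_scalar_ode_decay:
  fixes y :: "real \<Rightarrow> complex"
  assumes d: "\<And>t. 0 \<le> t \<Longrightarrow> (y has_vector_derivative c * y t + g t) (at t within {0..})"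
    and g: "\<And>t. 0 \<le> t \<Longrightarrow> norm (g t) \<le> R * exp (- \<beta> * t)"
    and c: "Re c < - \<beta>" and "0 \<le> t"
  shows "norm (y t) \<le> (norm (y 0) + R / (- Re c - \<beta>)) * exp (- \<beta> * t)"
proof -
  define \<gamma> where "\<gamma> = - Re c - \<beta>"
  have \<gamma>: "0 < \<gamma>" using c by (simp add: \<gamma>_def)
  have R: "0 \<le> R" using order.trans[OF norm_ge_zero g[of 0]] by simp
  define u where "u s = exp (- c * of_real s) * y s" for s
  have "norm (u t - u 0) \<le> R / \<gamma> * (exp (\<gamma> * t) - 1)"
  proof (rule norm_diff_le_exp[OF _ _ \<gamma> \<open>0 \<le> t\<close>])
    fix s :: real assume s: "0 \<le> s"
    have "((\<lambda>s. exp (- c * of_real s)) has_vector_derivative - c * exp (- c * of_real s)) (at s within {0..})"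
      by (rule has_vector_derivative_real_field[where f = "\<lambda>z. exp (- c * z)"])
        (auto intro!: derivative_eq_intros)
    from has_vector_derivative_mult[OF this d[OF s]]
    show "(u has_vector_derivative exp (- c * of_real s) * g s) (at s within {0..})"
      unfolding u_def by (simp add: algebra_simps)
    have "norm (exp (- c * of_real s) * g s) \<le> exp (- Re c * s) * (R * exp (- \<beta> * s))"
      using g[OF s] by (simp add: norm_mult)
    also have "\<dots> = R * exp (\<gamma> * s)" by (simp add: \<gamma>_def algebra_simps flip: exp_add)
    finally show "norm (exp (- c * of_real s) * g s) \<le> R * exp (\<gamma> * s)" .
  qed
  then have "norm (u t) \<le> norm (y 0) + R / \<gamma> * exp (\<gamma> * t)"
    using norm_triangle_ineq2[of "u t" "u 0"] R \<gamma> by (simp add: u_def algebra_simps) (smt (verit) divide_nonneg_pos)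
  then have "norm (u t) * exp (Re c * t) \<le> (norm (y 0) + R / \<gamma> * exp (\<gamma> * t)) * exp (Re c * t)"
    by (intro mult_right_mono) auto
  also have "norm (u t) * exp (Re c * t) = norm (y t)"
    by (simp add: u_def norm_mult mult_ac flip: exp_add)
  also have "(norm (y 0) + R / \<gamma> * exp (\<gamma> * t)) * exp (Re c * t)
      = norm (y 0) * exp (Re c * t) + R / \<gamma> * exp (- \<beta> * t)"
    by (simp add: \<gamma>_def algebra_simps flip: exp_add)
  also have "\<dots> \<le> norm (y 0) * exp (- \<beta> * t) + R / \<gamma> * exp (- \<beta> * t)"
    using mult_right_mono[of "Re c" "- \<beta>" t] c \<open>0 \<le> t\<close>
    by (intro add_right_mono mult_left_mono) auto
  finally show ?thesis by (simp add: \<gamma>_def algebra_simps)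
qed

text \<open>Triangularity is encoded by starting the sum at \<open>i\<close>: a component is driven
  only by itself and later ones. One \<open>R\<close> bounds both the forcing and the initial
  values, so a decay constant can be chosen from \<open>R\<close> before the solution.\<close>

definition triangular_solution ::
    "nat \<Rightarrow> (nat \<Rightarrow> nat \<Rightarrow> complex) \<Rightarrow> real \<Rightarrow> real \<Rightarrow> (real \<Rightarrow> nat \<Rightarrow> complex) \<Rightarrow> (real \<Rightarrow> nat \<Rightarrow> complex) \<Rightarrow> bool"
  where "triangular_solution n T \<beta> R y g \<longleftrightarrow>
    (\<forall>i<n. \<forall>t\<ge>0. ((\<lambda>s. y s i) has_vector_derivative (\<Sum>j\<in>{i..<n}. T i j * y t j) + g t i)
        (at t within {0..}) \<and> norm (g t i) \<le> R * exp (- \<beta> * t)) \<and> (\<forall>i<n. norm (y 0 i) \<le> R)"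

text \<open>Back substitution: once the later components decay at rate \<open>\<beta>\<close>, they
  act on the next one as additional forcing of the same rate. The strict gap on the diagonal
  preserves the rate at every step; only the constant grows. The induction counts the components
  already controlled, from the last one upwards.\<close>

lemma triangular_solution_decay:
  fixes \<beta> R :: real
  assumes diag: "\<And>i. i < n \<Longrightarrow> Re (T i i) < - \<beta>" and R: "0 \<le> R"
  shows "\<exists>c\<ge>0. \<forall>y g. triangular_solution n T \<beta> R y g \<longrightarrow>
    (\<forall>i<n. \<forall>t\<ge>0. norm (y t i) \<le> c * exp (- \<beta> * t))"
proof -
  let ?H = "triangular_solution n T \<beta> R"
  have main: "\<exists>c\<ge>0. \<forall>y g. ?H y g \<longrightarrow> (\<forall>i<n. n - m \<le> i \<longrightarrow> (\<forall>t\<ge>0. norm (y t i) \<le> c * exp (- \<beta> * t)))" for m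
  proof (induction m)
    case 0
    show ?case by (intro exI[of _ 0]) auto
  next
    case (Suc m)
    then obtain c where c: "0 \<le> c" and cb: "\<And>y g i t. ?H y g
      \<Longrightarrow> i < n \<Longrightarrow> n - m \<le> i \<Longrightarrow> 0 \<le> t \<Longrightarrow> norm (y t i) \<le> c * exp (- \<beta> * t)"
      by blast
    show ?case
    proof (cases "m < n")
      case False
      then show ?thesis using c cb by (intro exI[of _ c]) auto
    next
      case True
      define p where "p = n - Suc m"
      have p: "p < n" "Suc p = n - m" using True by (auto simp: p_def)
      \<comment> \<open>Bounds the total forcing of component \<open>p\<close>: the already
        controlled components through row \<open>p\<close>, plus the external forcing.\<close>
      define R' where "R' = (\<Sum>j\<in>{Suc p..<n}. norm (T p j)) * c + R"
      have R': "0 \<le> R'" using R c by (auto simp: R'_def intro!: add_nonneg_nonneg mult_nonneg_nonneg sum_nonneg)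
      \<comment> \<open>The second entry is the scalar estimate with initial value at most
        \<open>R\<close>; the maximum keeps the bound for the later components.\<close>
      define c' where "c' = max c (R + R' / (- Re (T p p) - \<beta>))"
      show ?thesis
      proof (intro exI[of _ c'] conjI allI impI)
        show "0 \<le> c'" using c by (simp add: c'_def)
        fix y g i and t :: real
        assume HH: "?H y g"
          and i: "i < n" "n - Suc m \<le> i" and t: "0 \<le> t"
        note H = HH[unfolded triangular_solution_def]
        have IH: "norm (y s j) \<le> c * exp (- \<beta> * s)" if "j < n" "Suc p \<le> j" "0 \<le> s" for s j
          using cb[OF HH] that p by auto
        show "norm (y t i) \<le> c' * exp (- \<beta> * t)"
        proof (cases "i = p")
          case False
          then have "norm (y t i) \<le> c * exp (- \<beta> * t)" using IH i t p by (auto simp: p_def)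
          also have "\<dots> \<le> c' * exp (- \<beta> * t)" by (intro mult_right_mono) (auto simp: c'_def)
          finally show ?thesis .
        next
          case True
          have "norm (y t p) \<le> (norm (y 0 p) + R' / (- Re (T p p) - \<beta>)) * exp (- \<beta> * t)"
          proof (rule norm_scalar_ode_decay[where g = "\<lambda>t. (\<Sum>j\<in>{Suc p..<n}. T p j * y t j) + g t p"])
            fix s :: real assume s: "0 \<le> s"
            have "{p..<n} = insert p {Suc p..<n}" using p by auto
            then have "(\<Sum>j\<in>{p..<n}. T p j * y s j) = T p p * y s p + (\<Sum>j\<in>{Suc p..<n}. T p j * y s j)"
              by simp
            moreover have "((\<lambda>s. y s p) has_vector_derivative (\<Sum>j\<in>{p..<n}. T p j * y s j) + g s p) (at s within {0..})"
              using H p s by auto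
            ultimately show "((\<lambda>s. y s p) has_vector_derivative
                T p p * y s p + ((\<Sum>j\<in>{Suc p..<n}. T p j * y s j) + g s p)) (at s within {0..})"
              by (simp add: add.assoc)
            have "norm ((\<Sum>j\<in>{Suc p..<n}. T p j * y s j) + g s p)
              \<le> (\<Sum>j\<in>{Suc p..<n}. norm (T p j) * (c * exp (- \<beta> * s))) + R * exp (- \<beta> * s)"
              using H p s IH
              by (intro order.trans[OF norm_triangle_ineq] add_mono order.trans[OF norm_sum] sum_mono)
                (auto simp: norm_mult intro!: mult_left_mono)
            then show "norm ((\<Sum>j\<in>{Suc p..<n}. T p j * y s j) + g s p) \<le> R' * exp (- \<beta> * s)"
              by (simp only: R'_def distrib_right sum_distrib_right mult.assoc)
          qed (use diag p t in auto)
          also have "\<dots> \<le> c' * exp (- \<beta> * t)"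
            using H p by (intro mult_right_mono) (auto simp: c'_def intro!: max.coboundedI2)
          finally show ?thesis using True by simp
        qed
      qed
    qed
  qed

  show ?thesis using main[of n] by simp
qed

text \<open>As in \<open>triangular_solution\<close>, a single \<open>R\<close> covers forcing and
  initial value, which keeps the decay constant independent of the individual solution.\<close>

definition perturbed_solution ::
    "nat \<Rightarrow> real mat \<Rightarrow> real \<Rightarrow> real \<Rightarrow> (real \<Rightarrow> real Matrix.vec) \<Rightarrow> (real \<Rightarrow> real Matrix.vec) \<Rightarrow> bool"
  where "perturbed_solution n M \<beta> R x g \<longleftrightarrow>
    (\<forall>t\<ge>0. has_vec_derivative x (M *\<^sub>v x t + g t) t {0..} \<and> g t \<in> carrier_vec n) \<and>
    (\<forall>t\<ge>0. \<forall>k<n. \<bar>g t $ k\<bar> \<le> R * exp (- \<beta> * t)) \<and> (\<forall>k<n. \<bar>x 0 $ k\<bar> \<le> R)"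

text \<open>A complex Schur form \<open>P * T * Q\<close> of \<open>M\<close> has the eigenvalues on
  the diagonal of \<open>T\<close>, so the coordinates \<open>Q x\<close> solve a triangular system
  with stable diagonal. The margin \<open>\<alpha>\<close> depends on \<open>M\<close> alone; every
  rate below it is allowed.\<close>

lemma hurwitz_decay:
  assumes M: "M \<in> carrier_mat n n" and hurw: "hurwitz M"
  shows "\<exists>\<alpha>>0. \<forall>\<beta> R. \<beta> < \<alpha> \<longrightarrow> (\<exists>c. \<forall>x g.
    perturbed_solution n M \<beta> R x g
    \<longrightarrow> (\<forall>t\<ge>0. \<forall>k<n. \<bar>x t $ k\<bar> \<le> c * exp (- \<beta> * t)))"
proof -
  define Mc where "Mc = map_mat complex_of_real M"
  have Mc: "Mc \<in> carrier_mat n n" using M by (simp add: Mc_def)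
  obtain es where es: "char_poly Mc = (\<Prod>e\<leftarrow>es. [:- e, 1:])"
    using char_poly_factorized[OF Mc] by blast
  obtain T P Q where TPQ: "schur_decomposition Mc es = (T, P, Q)" by (metis prod_cases3)
  from schur_decomposition[OF Mc es TPQ]
  have sim: "similar_mat_wit Mc T P Q" and ut: "upper_triangular T" and diag: "diag_mat T = es"
    by auto
  note wit = similar_mat_witD2[OF Mc sim]
  have re: "Re (T $$ (i, i)) < 0" if "i < n" for i
  proof -
    have "T $$ (i, i) \<in> set es"
      using that wit unfolding diag[symmetric] diag_mat_def by auto
    then have "poly (char_poly Mc) (T $$ (i, i)) = 0"
      unfolding es by (auto simp: poly_prod_list prod_list_zero_iff)
    then show ?thesis using hurw eigenvalue_root_char_poly[OF Mc] by (auto simp: hurwitz_def Mc_def)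
  qed
  \<comment> \<open>The 1 only keeps the set nonempty in dimension 0.\<close>
  define \<alpha> where "\<alpha> = Min (insert 1 ((\<lambda>i. - Re (T $$ (i, i))) ` {..<n}))"
  have \<alpha>: "0 < \<alpha>" unfolding \<alpha>_def using re by (subst Min_gr_iff) auto
  have \<alpha>_le: "\<alpha> \<le> - Re (T $$ (i, i))" if "i < n" for i
    unfolding \<alpha>_def using that by (intro Min_le) auto
  show ?thesis
  proof (rule exI[of _ \<alpha>], rule conjI[OF \<alpha>], rule allI, rule allI, rule impI)
    fix \<beta> R :: real assume \<beta>: "\<beta> < \<alpha>"
    \<comment> \<open>The sum of all entry norms bounds \<open>Q\<close> as an operator for the
      maximum norm; \<open>p\<close> below does the same for the way back through \<open>P\<close>.
      The absolute value in \<open>R'\<close> supplies the nonnegative bound that the triangular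
      lemma asks for.\<close>
    define q where "q = (\<Sum>i<n. \<Sum>j<n. norm (Q $$ (i, j)))"
    have q: "(\<Sum>j<n. norm (Q $$ (i, j))) \<le> q" if "i < n" for i
      unfolding q_def using that by (intro member_le_sum) (auto intro: sum_nonneg)
    define R' where "R' = q * \<bar>R\<bar>"
    have "0 \<le> q" unfolding q_def by (intro sum_nonneg) auto
    then have R': "0 \<le> R'" by (simp add: R'_def)
    have diag': "Re (T $$ (i, i)) < - \<beta>" if "i < n" for i using \<alpha>_le[OF that] \<beta> by simp
    define p where "p = (\<Sum>k<n. \<Sum>i<n. norm (P $$ (k, i)))"
    have "\<exists>c\<ge>0. \<forall>y g. triangular_solution n (\<lambda>i j. T $$ (i, j)) \<beta> R' y g \<longrightarrow>
        (\<forall>i<n. \<forall>t\<ge>0. norm (y t i) \<le> c * exp (- \<beta> * t))"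
      by (rule triangular_solution_decay) (use diag' R' in auto)
    then obtain c where c: "0 \<le> c" and cb: "\<forall>y g. triangular_solution n (\<lambda>i j. T $$ (i, j)) \<beta> R' y g \<longrightarrow>
        (\<forall>i<n. \<forall>t\<ge>0. norm (y t i) \<le> c * exp (- \<beta> * t))"
      by auto
    show "\<exists>c. \<forall>x g.
      perturbed_solution n M \<beta> R x g
      \<longrightarrow> (\<forall>t\<ge>0. \<forall>k<n. \<bar>x t $ k\<bar> \<le> c * exp (- \<beta> * t))"
    proof (rule exI[of _ "p * c"], intro allI impI)
      fix x g and t :: real and k
      assume pert: "perturbed_solution n M \<beta> R x g"
        and t: "0 \<le> t" and k: "k < n"
      note H = pert[unfolded perturbed_solution_def]
      note xd = H[THEN conjunct1] and gb = H[THEN conjunct2, THEN conjunct1]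
        and x0 = H[THEN conjunct2, THEN conjunct2]
      have gc: "g s \<in> carrier_vec n" if "0 \<le> s" for s using xd that by blast
      have xder: "has_vec_derivative x (M *\<^sub>v x s + g s) s {0..}" if "0 \<le> s" for s using xd that by blast
      have xc: "x s \<in> carrier_vec n" if "0 \<le> s" for s
      proof -
        have "dim_vec (x s) = dim_vec (M *\<^sub>v x s + g s)"
          using xder[OF that, unfolded has_vec_derivative_def, THEN conjunct1] that by (metis atLeast_iff)
        then show ?thesis using gc[OF that] by (intro carrier_vecI) simp
      qed
      define xx where "xx s = map_vec complex_of_real (x s)" for s
      define gg where "gg s = map_vec complex_of_real (g s)" for s
      have xx: "xx s \<in> carrier_vec n" if "0 \<le> s" for s using xc[OF that] by (simp add: xx_def)
      have gg: "gg s \<in> carrier_vec n" if "0 \<le> s" for s using gc[OF that] by (simp add: gg_def)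
      \<comment> \<open>Since \<open>Q * P\<close> is the identity, the transformed state satisfies
        y' = T y + Q g.\<close>
      define y where "y s i = (\<Sum>j<n. Q $$ (i, j) * complex_of_real (x s $ j))" for s i
      define h where "h s i = (\<Sum>j<n. Q $$ (i, j) * complex_of_real (g s $ j))" for s i
      have mv: "(Z *\<^sub>v v) $ i = (\<Sum>j<n. Z $$ (i, j) * v $ j)"
        if "Z \<in> carrier_mat n n" "v \<in> carrier_vec n" "i < n" for Z :: "complex mat" and v i
        using that by (auto simp: scalar_prod_def lessThan_atLeast0 intro!: sum.cong)
      have y_eq: "y s i = (Q *\<^sub>v xx s) $ i" if "0 \<le> s" "i < n" for s i
        using that wit xx[OF that(1)] xc[OF that(1)] by (subst mv) (auto simp: y_def xx_def intro!: sum.cong)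
      have h_eq: "h s i = (Q *\<^sub>v gg s) $ i" if "0 \<le> s" "i < n" for s i
        using that wit gg[OF that(1)] gc[OF that(1)] by (subst mv) (auto simp: h_def gg_def intro!: sum.cong)
      have yder: "((\<lambda>s. y s i) has_vector_derivative (\<Sum>j\<in>{i..<n}. T $$ (i, j) * y s j) + h s i) (at s within {0..})"
        if i: "i < n" and s: "0 \<le> s" for i s
      proof -
        have dim: "dim_vec (M *\<^sub>v x s + g s) = n" using gc[OF s] by simp
        have "((\<lambda>s. complex_of_real (x s $ j)) has_vector_derivative
            complex_of_real ((M *\<^sub>v x s + g s) $ j)) (at s within {0..})" if "j < n" for j
          using xder[OF s] s that dim unfolding has_vec_derivative_def
          by (intro has_vector_derivative_of_real) (simp add: has_real_derivative_iff_has_vector_derivative)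
        then have "((\<lambda>s. y s i) has_vector_derivative
            (\<Sum>j<n. Q $$ (i, j) * complex_of_real ((M *\<^sub>v x s + g s) $ j))) (at s within {0..})"
          unfolding y_def by (intro has_vector_derivative_sum has_vector_derivative_mult_right) auto
        moreover have "(\<Sum>j<n. Q $$ (i, j) * complex_of_real ((M *\<^sub>v x s + g s) $ j))
            = (Q *\<^sub>v (Mc *\<^sub>v xx s + gg s)) $ i"
        proof -
          have "complex_of_real ((M *\<^sub>v x s) $ j) = (Mc *\<^sub>v xx s) $ j" if "j < n" for j
            using that M xc[OF s] by (auto simp: Mc_def xx_def scalar_prod_def)
          then have "complex_of_real ((M *\<^sub>v x s + g s) $ j) = (Mc *\<^sub>v xx s + gg s) $ j" if "j < n" for j
            using that M gc[OF s] s Mc gg[OF s] by (auto simp: gg_def)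
          moreover have "Mc *\<^sub>v xx s + gg s \<in> carrier_vec n"
            by (intro add_carrier_vec mult_mat_vec_carrier[OF Mc] xx[OF s] gg[OF s])
          ultimately show ?thesis using i wit by (subst mv) auto
        qed
        also have "Q *\<^sub>v (Mc *\<^sub>v xx s + gg s) = T *\<^sub>v (Q *\<^sub>v xx s) + Q *\<^sub>v gg s"
        proof -
          have "Q * Mc = Q * (P * (T * Q))"
            unfolding wit(3) using wit by (simp add: assoc_mult_mat[of _ n n _ n _ n])
          also have "\<dots> = (Q * P) * (T * Q)"
            using wit by (intro assoc_mult_mat[symmetric, of _ n n _ n _ n]) auto
          also have "\<dots> = T * Q" using wit by simp
          finally have "Q *\<^sub>v (Mc *\<^sub>v xx s) = T *\<^sub>v (Q *\<^sub>v xx s)"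
            using wit Mc xx[OF s] by (metis assoc_mult_mat_vec)
          moreover have "Q \<in> carrier_mat n n" using wit by auto
          ultimately show ?thesis
            using mult_add_distrib_mat_vec[OF _ mult_mat_vec_carrier[OF Mc xx[OF s]] gg[OF s]] by metis
        qed
        also have "\<dots> $ i = (T *\<^sub>v (Q *\<^sub>v xx s)) $ i + (Q *\<^sub>v gg s) $ i"
          using i wit by simp
        also have "(Q *\<^sub>v gg s) $ i = h s i" using h_eq[OF s i] by simp
        also have "(T *\<^sub>v (Q *\<^sub>v xx s)) $ i = (\<Sum>j<n. T $$ (i, j) * (Q *\<^sub>v xx s) $ j)"
          by (rule mv) (use i wit xx[OF s] in auto)
        also have "\<dots> = (\<Sum>j<n. T $$ (i, j) * y s j)"
          using y_eq[OF s] by (intro sum.cong) auto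
        also have "(\<Sum>j<n. T $$ (i, j) * y s j) = (\<Sum>j\<in>{i..<n}. T $$ (i, j) * y s j)"
          using i wit upper_triangularD[OF ut] by (intro sum.mono_neutral_right) auto
        finally show ?thesis .
      qed
      have hb: "norm (\<Sum>j<n. Q $$ (i, j) * complex_of_real (v j)) \<le> q * K"
        if "i < n" "\<And>j. j < n \<Longrightarrow> \<bar>v j\<bar> \<le> K" "0 \<le> K" for i v and K :: real
      proof -
        have "norm (\<Sum>j<n. Q $$ (i, j) * complex_of_real (v j)) \<le> (\<Sum>j<n. norm (Q $$ (i, j)) * K)"
          using that by (intro order.trans[OF norm_sum] sum_mono) (auto simp: norm_mult intro!: mult_left_mono)
        also have "\<dots> \<le> q * K" using q[OF that(1)] that(3) by (simp flip: sum_distrib_right add: mult_right_mono)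
        finally show ?thesis .
      qed
      have "norm (h s i) \<le> R' * exp (- \<beta> * s)" if "i < n" "0 \<le> s" for i s
      proof -
        have "\<bar>g s $ j\<bar> \<le> \<bar>R\<bar> * exp (- \<beta> * s)" if "j < n" for j
          by (rule order.trans[OF gb[rule_format, OF \<open>0 \<le> s\<close> that]]) (auto intro: mult_right_mono)
        then show ?thesis
          using hb[OF \<open>i < n\<close>, of "\<lambda>j. g s $ j" "\<bar>R\<bar> * exp (- \<beta> * s)"]
          by (simp add: h_def R'_def mult.assoc)
      qed
      moreover have "norm (y 0 i) \<le> R'" if "i < n" for i
      proof -
        have "\<bar>x 0 $ j\<bar> \<le> \<bar>R\<bar>" if "j < n" for j using x0 that abs_ge_self order.trans by blast
        then show ?thesis
          using hb[OF \<open>i < n\<close>, of "\<lambda>j. x 0 $ j" "\<bar>R\<bar>"] by (simp add: y_def R'_def)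
      qed
      ultimately have "triangular_solution n (\<lambda>i j. T $$ (i, j)) \<beta> R' y h"
        using yder by (auto simp: triangular_solution_def)
      with cb have yb: "norm (y t i) \<le> c * exp (- \<beta> * t)" if "i < n" for i
        using that t by blast
      have "complex_of_real (x t $ k) = (P *\<^sub>v (Q *\<^sub>v xx t)) $ k"
        using wit xx[OF t] xc[OF t] k by (simp flip: assoc_mult_mat_vec add: xx_def)
      also have "\<dots> = (\<Sum>i<n. P $$ (k, i) * y t i)"
        using wit xx[OF t] k t by (subst mv) (auto simp: y_eq)
      finally have "\<bar>x t $ k\<bar> = norm (\<Sum>i<n. P $$ (k, i) * y t i)" by (metis norm_of_real real_norm_def)
      also have "\<dots> \<le> (\<Sum>i<n. norm (P $$ (k, i)) * (c * exp (- \<beta> * t)))"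
        using yb by (intro order.trans[OF norm_sum] sum_mono) (auto simp: norm_mult intro!: mult_left_mono)
      also have "\<dots> \<le> p * (c * exp (- \<beta> * t))"
        unfolding sum_distrib_right[symmetric] p_def using k c
        by (intro mult_right_mono member_le_sum[of k "{..<n}" "\<lambda>k. \<Sum>i<n. norm (P $$ (k, i))"])
          (auto intro: sum_nonneg)
      finally show "\<bar>x t $ k\<bar> \<le> p * c * exp (- \<beta> * t)" by (simp add: mult.assoc)
    qed
  qed
qed

subsection \<open>Strongly convex resource allocation\<close>

text \<open>Growth at least linear with slope \<open>m\<close> brings \<open>F\<close> below
  \<open>c\<close> at \<open>- r\<close> and above it at \<open>r\<close> for
  \<open>r = \<bar>c - F 0\<bar> / m\<close>; the intermediate value theorem does the rest.\<close>

lemma surj_of_strongly_increasing: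
  fixes F :: "real \<Rightarrow> real"
  assumes cont: "continuous_on UNIV F" and m: "0 < m"
    and incr: "\<And>x y. x \<le> y \<Longrightarrow> m * (y - x) \<le> F y - F x"
  obtains x where "F x = c"
proof -
  define r where "r = \<bar>c - F 0\<bar> / m"
  have r: "0 \<le> r" "m * r = \<bar>c - F 0\<bar>" using m by (auto simp: r_def)
  have "F (- r) \<le> c" "c \<le> F r" using incr[of "- r" 0] incr[of 0 r] r by auto
  then obtain x where "F x = c"
    using IVT'[of F "- r" c r] r continuous_on_subset[OF cont] by auto
  then show thesis by (rule that)
qed

locale regular_convex =
  fixes f :: "real \<Rightarrow> real" and hl hu :: real
  assumes C2: "twice_cont_differentiable f"
    and hl: "0 < hl" and hess: "\<And>s. hl \<le> deriv (deriv f) s" "\<And>s. deriv (deriv f) s \<le> hu"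
begin

lemma DERIV_f: "(f has_real_derivative deriv f x) (at x)"
  and DERIV_grad: "(deriv f has_real_derivative deriv (deriv f) x) (at x)"
  using C2 by (auto simp: twice_cont_differentiable_def differentiable_on_def DERIV_deriv_iff_real_differentiable)

lemma grad_mvt:
  assumes "x \<le> y"
  shows "hl * (y - x) \<le> deriv f y - deriv f x" "deriv f y - deriv f x \<le> hu * (y - x)"
proof -
  have "hl * (y - x) \<le> deriv f y - deriv f x \<and> deriv f y - deriv f x \<le> hu * (y - x)"
  proof (cases "x = y")
    case False
    then obtain s where "deriv f y - deriv f x = (y - x) * deriv (deriv f) s"
      using MVT2[of x y "deriv f" "deriv (deriv f)"] DERIV_grad assms by auto
    then show ?thesis
      using mult_right_mono[OF hess(1)[of s], of "y - x"] mult_right_mono[OF hess(2)[of s], of "y - x"] assms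
      by (simp add: mult.commute)
  qed simp
  then show "hl * (y - x) \<le> deriv f y - deriv f x" "deriv f y - deriv f x \<le> hu * (y - x)" by auto
qed

lemma grad_lipschitz: "\<bar>deriv f y - deriv f x\<bar> \<le> hu * \<bar>y - x\<bar>"
  using grad_mvt[of x y] grad_mvt[of y x] hl
  by (cases "x \<le> y") (simp_all add: abs_if, (smt (verit) mult_nonneg_nonneg)+)

lemma grad_strongly_monotone: "hl * (y - x)\<^sup>2 \<le> (deriv f y - deriv f x) * (y - x)"
proof (cases "x \<le> y")
  case True
  then show ?thesis using mult_right_mono[OF grad_mvt(1)[OF True], of "y - x"]
    by (simp add: power2_eq_square mult.assoc)
next
  case False
  then show ?thesis using mult_right_mono[OF grad_mvt(1)[of y x], of "x - y"]
    by (simp add: power2_eq_square algebra_simps)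
qed

lemma grad_surj: obtains x where "deriv f x = c"
proof (rule surj_of_strongly_increasing[of "deriv f" hl])
  show "continuous_on UNIV (deriv f)"
    using DERIV_grad DERIV_isCont by (blast intro: continuous_at_imp_continuous_on)
qed (use hl grad_mvt that in auto)

text \<open>By the mean value theorem the secant slope is a gradient at an intermediate point, and
  the gradient is strictly increasing. The strictness is what makes the optimum unique.\<close>

lemma above_tangent:
  assumes "y \<noteq> x"
  shows "deriv f x * (y - x) < f y - f x"
proof (cases "x < y")
  case True
  then obtain s where s: "x < s" "f y - f x = (y - x) * deriv f s"
    using MVT2[of x y f "deriv f"] DERIV_f by auto
  have "deriv f x < deriv f s" using grad_mvt(1)[of x s] s hl
    by (smt (verit) mult_pos_pos)
  then show ?thesis using s True by (simp add: mult.commute)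
next
  case False
  with assms have "y < x" by simp
  then obtain s where s: "s < x" "f x - f y = (x - y) * deriv f s"
    using MVT2[of y x f "deriv f"] DERIV_f by auto
  have "deriv f s < deriv f x" using grad_mvt(1)[of s x] s hl
    by (smt (verit) mult_pos_pos)
  then have "(x - y) * deriv f s < (x - y) * deriv f x" using \<open>y < x\<close> by simp
  then show ?thesis using s by (simp add: algebra_simps)
qed

end

text \<open>Sum the tangent inequalities at \<open>ystar\<close>: all slopes equal the multiplier
  \<open>lamstar\<close>, so the linear terms add up to \<open>lamstar\<close> times the difference
  of two feasible sums, which is 0. One deviating coordinate makes the inequality strict.\<close>

lemma optimal_solution_iff_kkt:
  assumes convex: "\<And>i. i \<in> {1..N} \<Longrightarrow> regular_convex (f i) (hl i) (hu i)"
    and ext: "ystar \<in> extensional {1..N}"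
    and feas: "(\<Sum>i=1..N. ystar i) = (\<Sum>i=1..N. d i)"
    and kkt: "\<And>i. i \<in> {1..N} \<Longrightarrow> deriv (f i) (ystar i) = lamstar"
  shows "optimal_solution N f d y \<longleftrightarrow> y = ystar"
proof -
  let ?J = "\<lambda>y. \<Sum>i=1..N. f i (y i)"
  have less: "?J ystar < ?J y"
    if y: "y \<in> extensional {1..N}" "(\<Sum>i=1..N. y i) = (\<Sum>i=1..N. d i)" "y \<noteq> ystar" for y
  proof -
    obtain k where k: "k \<in> {1..N}" "y k \<noteq> ystar k"
      using y(1,3) ext by (meson extensionalityI)
    have strict: "lamstar * (y i - ystar i) < f i (y i) - f i (ystar i)"
      if "i \<in> {1..N}" "y i \<noteq> ystar i" for i
      using regular_convex.above_tangent[OF convex[OF that(1)] that(2)] kkt[OF that(1)] by simp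
    have "(\<Sum>i=1..N. lamstar * (y i - ystar i)) < (\<Sum>i=1..N. f i (y i) - f i (ystar i))"
    proof (rule sum_strict_mono_ex1)
      show "\<forall>i\<in>{1..N}. lamstar * (y i - ystar i) \<le> f i (y i) - f i (ystar i)"
        using strict by (metis diff_self less_imp_le mult_zero_right order_refl)
      show "\<exists>i\<in>{1..N}. lamstar * (y i - ystar i) < f i (y i) - f i (ystar i)"
        using strict k by blast
    qed simp
    moreover have "(\<Sum>i=1..N. lamstar * (y i - ystar i)) = 0"
      using y(2) feas by (simp add: sum_subtractf flip: sum_distrib_left)
    ultimately show ?thesis by (simp add: sum_subtractf)
  qed
  show ?thesis
  proof
    assume "optimal_solution N f d y"
    then show "y = ystar"
      using less[of y] ext feas unfolding optimal_solution_def is_arg_min_def by blast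
  next
    assume "y = ystar"
    then show "optimal_solution N f d y"
      using less ext feas unfolding optimal_solution_def is_arg_min_def by (metis order.asym order.irrefl)
  qed
qed

text \<open>The total allocation is viewed as a function of the multiplier. The lower Hessian bound
  makes the inverse gradients Lipschitz, hence continuous; the upper one makes them grow with slope
  at least \<open>1 / hu i\<close>. So the total takes every value.\<close>

lemma kkt_point_exists:
  fixes N :: nat
  assumes N: "1 \<le> N" and convex: "\<And>i. i \<in> {1..N} \<Longrightarrow> regular_convex (f i) (hl i) (hu i)"
  obtains ystar lamstar where "ystar \<in> extensional {1..N}" "(\<Sum>i=1..N. ystar i) = c"
    "\<And>i. i \<in> {1..N} \<Longrightarrow> deriv (f i) (ystar i) = lamstar"
proof -
  \<comment> \<open>The inverse of the gradient; the choice is well defined because the gradient is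
    surjective.\<close>
  define g where "g i l = (SOME x. deriv (f i) x = l)" for i l
  have g: "deriv (f i) (g i l) = l" if "i \<in> {1..N}" for i l
  proof -
    interpret regular_convex "f i" "hl i" "hu i" using that by (rule convex)
    obtain x where "deriv (f i) x = l" by (rule grad_surj)
    then show ?thesis unfolding g_def by (rule someI)
  qed
  have hu: "0 < hu i" if "i \<in> {1..N}" for i
    using regular_convex.hl[OF convex[OF that]] regular_convex.hess[OF convex[OF that], of 0] by linarith
  have hl: "0 < hl i" if "i \<in> {1..N}" for i
    using regular_convex.hl[OF convex[OF that]] .
  have g_mono: "g i l \<le> g i m" if "i \<in> {1..N}" "l \<le> m" for i l m
  proof (rule ccontr)
    assume less: "\<not> g i l \<le> g i m"
    then have "0 < hl i * (g i l - g i m)" using hl that by simp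
    then show False
      using regular_convex.grad_mvt(1)[OF convex[OF that(1)], of "g i m" "g i l"] g that less by auto
  qed
  have g_lower: "1 / hu i * (m - l) \<le> g i m - g i l" if "i \<in> {1..N}" "l \<le> m" for i l m
    using regular_convex.grad_mvt(2)[OF convex[OF that(1)] g_mono[OF that]] g[OF that(1)] hu[OF that(1)]
    by (simp add: field_simps)
  have g_upper: "\<bar>g i m - g i l\<bar> \<le> 1 / hl i * \<bar>m - l\<bar>" if "i \<in> {1..N}" for i l m
  proof -
    have "hl i * \<bar>g i m - g i l\<bar> \<le> \<bar>m - l\<bar>"
      using regular_convex.grad_mvt(1)[OF convex[OF that], of "g i l" "g i m"]
        regular_convex.grad_mvt(1)[OF convex[OF that], of "g i m" "g i l"] g[OF that]
      by (cases "g i l \<le> g i m") auto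
    then show ?thesis using hl[OF that] by (simp add: field_simps)
  qed
  have g_cont: "continuous_on UNIV (g i)" if "i \<in> {1..N}" for i
    unfolding continuous_on_iff
  proof (intro ballI allI impI)
    fix l e :: real assume e: "0 < e"
    have "dist (g i m) (g i l) < e" if "dist m l < hl i * e" for m
    proof -
      have "1 / hl i * \<bar>m - l\<bar> < e"
        using that hl[OF \<open>i \<in> {1..N}\<close>] by (simp add: dist_real_def field_simps)
      then show ?thesis using g_upper[OF \<open>i \<in> {1..N}\<close>, of m l] by (simp add: dist_real_def)
    qed
    then show "\<exists>\<delta>>0. \<forall>m\<in>UNIV. dist m l < \<delta> \<longrightarrow> dist (g i m) (g i l) < e"
      using hl[OF that] e by (intro exI[of _ "hl i * e"]) auto
  qed
  obtain lam where lam: "(\<Sum>i=1..N. g i lam) = c"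
  proof (rule surj_of_strongly_increasing[of "\<lambda>l. \<Sum>i=1..N. g i l" "\<Sum>i=1..N. 1 / hu i"])
    show "continuous_on UNIV (\<lambda>l. \<Sum>i=1..N. g i l)" using g_cont by (intro continuous_on_sum) auto
    \<comment> \<open>Here \<open>1 \<le> N\<close> matters: an empty sum would give slope
      0.\<close>
    show "0 < (\<Sum>i=1..N. 1 / hu i)" using hu N by (intro sum_pos) auto
    show "(\<Sum>i=1..N. 1 / hu i) * (y - x) \<le> (\<Sum>i=1..N. g i y) - (\<Sum>i=1..N. g i x)" if "x \<le> y" for x y
      unfolding sum_distrib_right sum_subtractf[symmetric] using g_lower[OF _ that] by (rule sum_mono)
  qed
  show thesis
  proof (rule that)
    show "restrict (\<lambda>i. g i lam) {1..N} \<in> extensional {1..N}" by simp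
    show "(\<Sum>i=1..N. restrict (\<lambda>i. g i lam) {1..N} i) = c" using lam by simp
    show "deriv (f i) (restrict (\<lambda>i. g i lam) {1..N} i) = lam" if "i \<in> {1..N}" for i
      using g[OF that] that by simp
  qed
qed

subsection \<open>The graph Laplacian\<close>

text \<open>A square matrix with trivial kernel has nonzero determinant; the indices are shifted to
  start at 0 for the matrix library. Both one-sided identities are kept: the left inverse yields
  coercivity of the Laplacian, the right one solvability.\<close>

lemma injective_system_inverse:
  fixes g :: "nat \<Rightarrow> nat \<Rightarrow> real"
  assumes inj: "\<And>x i. (\<And>i. i \<in> {1..N} \<Longrightarrow> (\<Sum>j=1..N. g i j * x j) = 0) \<Longrightarrow> i \<in> {1..N} \<Longrightarrow> x i = 0"
  shows "\<exists>m. \<forall>i\<in>{1..N}. \<forall>j\<in>{1..N}.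
    (\<Sum>k=1..N. m i k * g k j) = (if i = j then 1 else 0) \<and>
    (\<Sum>k=1..N. g i k * m k j) = (if i = j then 1 else 0)"
proof -
  define G where "G = mat N N (\<lambda>(i, j). g (Suc i) (Suc j))"
  have G: "G \<in> carrier_mat N N" by (simp add: G_def)
  have shift: "(\<Sum>k=1..N. h k) = (\<Sum>k<N. h (Suc k))" for h :: "nat \<Rightarrow> real"
    by (simp add: sum.atLeast1_atMost_eq)
  have "v = 0\<^sub>v N" if v: "v \<in> carrier_vec N" "G *\<^sub>v v = 0\<^sub>v N" for v
  proof -
    have "(\<Sum>j=1..N. g i j * v $ (j - 1)) = 0" if "i \<in> {1..N}" for i
    proof -
      have "(\<Sum>j=1..N. g i j * v $ (j - 1)) = (G *\<^sub>v v) $ (i - 1)"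
        unfolding shift using that v(1) by (auto simp: G_def scalar_prod_def lessThan_atLeast0 intro!: sum.cong)
      then show ?thesis using v that by auto
    qed
    from inj[of "\<lambda>j. v $ (j - 1)", OF this] have "v $ (i - 1) = 0" if "i \<in> {1..N}" for i
      using that by blast
    then have "v $ i = 0" if "i < N" for i using that by (metis Suc_le_eq atLeastAtMost_iff diff_Suc_1 le_add1 plus_1_eq_Suc)
    then show ?thesis using v by (intro eq_vecI) auto
  qed
  then have "det G \<noteq> 0" using det_0_iff_vec_prod_zero_field[OF G] by blast
  from det_non_zero_imp_unit[OF G this, of "()"]
  obtain H where H: "H \<in> carrier_mat N N" "H * G = 1\<^sub>m N" "G * H = 1\<^sub>m N"
    unfolding Units_def ring_mat_def by auto
  have entry: "(\<Sum>k=1..N. P $$ (i - 1, k - 1) * Q $$ (k - 1, j - 1)) = (P * Q) $$ (i - 1, j - 1)"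
    if "P \<in> carrier_mat N N" "Q \<in> carrier_mat N N" "i \<in> {1..N}" "j \<in> {1..N}" for P Q :: "real mat" and i j
    unfolding shift using that by (auto simp: scalar_prod_def lessThan_atLeast0 intro!: sum.cong)
  have Gg: "G $$ (i - 1, j - 1) = g i j" if "i \<in> {1..N}" "j \<in> {1..N}" for i j
    using that by (auto simp: G_def)
  \<comment> \<open>Truncated subtraction is injective here because the indices start at 1.\<close>
  have eq1: "(i - 1 = j - 1) = (i = j)" if "i \<in> {1..N}" "j \<in> {1..N}" for i j using that by auto
  show ?thesis
  proof (intro exI[of _ "\<lambda>i j. H $$ (i - 1, j - 1)"] ballI conjI)
    fix i j assume ij: "i \<in> {1..N}" "j \<in> {1..N}"
    have one: "1\<^sub>m N $$ (i - 1, j - 1) = (if i = j then 1 else 0 :: real)"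
      using ij eq1[OF ij] by auto
    have "(\<Sum>k=1..N. H $$ (i - 1, k - 1) * g k j) = (\<Sum>k=1..N. H $$ (i - 1, k - 1) * G $$ (k - 1, j - 1))"
      using Gg[OF _ ij(2)] by (intro sum.cong refl) presburger
    then show "(\<Sum>k=1..N. H $$ (i - 1, k - 1) * g k j) = (if i = j then 1 else 0)"
      using entry[OF H(1) G ij] H(2) one by presburger
    have "(\<Sum>k=1..N. g i k * H $$ (k - 1, j - 1)) = (\<Sum>k=1..N. G $$ (i - 1, k - 1) * H $$ (k - 1, j - 1))"
      using Gg[OF ij(1)] by (intro sum.cong refl) presburger
    then show "(\<Sum>k=1..N. g i k * H $$ (k - 1, j - 1)) = (if i = j then 1 else 0)"
      using entry[OF G H(1) ij] H(3) one by presburger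
  qed
qed

text \<open>Bounds the operator norm by the Frobenius norm, through Cauchy-Schwarz in each
  row.\<close>

lemma sum_sq_matrix_le:
  fixes m :: "'i \<Rightarrow> 'j \<Rightarrow> real"
  shows "(\<Sum>i\<in>I. (\<Sum>j\<in>J. m i j * x j)\<^sup>2) \<le> (\<Sum>i\<in>I. \<Sum>j\<in>J. (m i j)\<^sup>2) * (\<Sum>j\<in>J. (x j)\<^sup>2)"
  unfolding sum_distrib_right[of _ I] by (intro sum_mono Cauchy_Schwarz_ineq_sum)

locale weighted_graph =
  fixes N :: nat and a :: "nat \<Rightarrow> nat \<Rightarrow> real"
  assumes conn: "connected_weighted_graph N a"
begin

abbreviation net :: "(nat \<Rightarrow> real) \<Rightarrow> nat \<Rightarrow> real" where
  "net \<equiv> network_diff N a"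

lemma weights: "i \<in> {1..N} \<Longrightarrow> j \<in> {1..N} \<Longrightarrow> a i j = a j i"
  "i \<in> {1..N} \<Longrightarrow> j \<in> {1..N} \<Longrightarrow> 0 \<le> a i j"
  using conn by (auto simp: connected_weighted_graph_def)

text \<open>Connectedness of a digraph includes that its vertex set is nonempty.\<close>

lemma N_pos: "1 \<le> N"
proof -
  have "verts (with_proj (mk_symmetric (with_proj (weight_graph N a)))) \<noteq> {}"
    using conn unfolding connected_weighted_graph_def Digraph_Component.connected_def strongly_connected_def by blast
  then show ?thesis by (auto simp: weight_graph_def)
qed

text \<open>Connectedness is reachability in the symmetric closure, so equality propagates along a
  path whose steps may traverse an edge in either direction.\<close>

lemma constant_if_edge_constant:
  assumes edge: "\<And>i j. i \<in> {1..N} \<Longrightarrow> j \<in> {1..N} \<Longrightarrow> 0 < a i j \<Longrightarrow> x i = x j"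
    and "i \<in> {1..N}" "j \<in> {1..N}"
  shows "x i = x j"
proof -
  let ?G = "with_proj (mk_symmetric (with_proj (weight_graph N a)))"
  have "i \<rightarrow>\<^sup>*\<^bsub>?G\<^esub> j"
    using conn assms(2,3)
    unfolding connected_weighted_graph_def Digraph_Component.connected_def strongly_connected_def
    by (auto simp: weight_graph_def)
  then have "(i, j) \<in> (arcs_ends ?G)\<^sup>*" by (rule reachable_rtranclI)
  then show ?thesis
  proof (induction rule: rtrancl_induct)
    case (step y z)
    then have "y \<in> {1..N} \<and> z \<in> {1..N} \<and> (0 < a y z \<or> 0 < a z y)"
      by (auto simp: weight_graph_def parcs_mk_symmetric)
    then show ?case using edge step.IH by metis
  qed simp
qed

lemma net_diff: "net (\<lambda>j. x j - y j) i = net x i - net y i"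
  by (simp add: network_diff_def sum_subtractf[symmetric] algebra_simps)

lemma net_const: "net (\<lambda>j. c) i = 0"
  by (simp add: network_diff_def)

definition lap :: "nat \<Rightarrow> nat \<Rightarrow> real" where
  "lap i j = (if i = j then \<Sum>k=1..N. a i k else 0) - a i j"

lemma net_matrix:
  assumes "i \<in> {1..N}"
  shows "net x i = (\<Sum>j=1..N. lap i j * x j)"
proof -
  have "(\<Sum>j=1..N. lap i j * x j)
      = (\<Sum>j=1..N. (if i = j then (\<Sum>k=1..N. a i k) * x j else 0)) - (\<Sum>j=1..N. a i j * x j)"
    unfolding sum_subtractf[symmetric] by (intro sum.cong) (auto simp: lap_def algebra_simps)
  also have "\<dots> = net x i"
    using assms by (simp add: network_diff_def right_diff_distrib sum_subtractf sum_distrib_right)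
  finally show ?thesis by simp
qed

text \<open>The polarised Dirichlet form of the graph: exchanging the two indices and using symmetry
  of the weights turns the part with \<open>x j\<close> into minus the part with \<open>x i\<close>.
  Symmetry and positivity of the Laplacian and its vanishing column sums all follow from this
  formula.\<close>

lemma net_quadratic:
  "(\<Sum>i=1..N. x i * net y i) = (\<Sum>i=1..N. \<Sum>j=1..N. a i j * (x i - x j) * (y i - y j)) / 2"
proof -
  define P where "P = (\<Sum>i=1..N. \<Sum>j=1..N. a i j * x i * (y i - y j))"
  define Q where "Q = (\<Sum>i=1..N. \<Sum>j=1..N. a i j * x j * (y i - y j))"
  have "Q = (\<Sum>i=1..N. \<Sum>j=1..N. a j i * x i * (y j - y i))"
    unfolding Q_def by (rule sum.swap)
  also have "\<dots> = (\<Sum>i=1..N. \<Sum>j=1..N. - (a i j * x i * (y i - y j)))"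
    using weights(1) by (intro sum.cong refl) (simp add: algebra_simps)
  finally have "Q = - P" by (simp add: P_def sum_negf)
  moreover have "(\<Sum>i=1..N. \<Sum>j=1..N. a i j * (x i - x j) * (y i - y j)) = P - Q"
    by (simp add: P_def Q_def sum_subtractf[symmetric] algebra_simps)
  moreover have "(\<Sum>i=1..N. x i * net y i) = P"
    by (simp add: P_def network_diff_def sum_distrib_left mult_ac)
  ultimately show ?thesis by simp
qed

lemma net_symmetric: "(\<Sum>i=1..N. x i * net y i) = (\<Sum>i=1..N. y i * net x i)"
  unfolding net_quadratic by (simp add: mult_ac)

lemma edge_nonneg:
  assumes "i \<in> {1..N}" "j \<in> {1..N}"
  shows "0 \<le> a i j * (x i - x j) * (x i - x j)"
  using mult_nonneg_nonneg[OF weights(2)[OF assms] zero_le_square[of "x i - x j"]] by (simp only: mult.assoc)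

lemma net_nonneg: "0 \<le> (\<Sum>i=1..N. x i * net x i)"
  unfolding net_quadratic using edge_nonneg by (intro divide_nonneg_pos sum_nonneg) auto

lemma sum_net: "(\<Sum>i=1..N. net x i) = 0"
  using net_quadratic[of "\<lambda>_. 1" x] by simp

lemma net_bounded:
  obtains l where "1 \<le> l" "\<And>x. (\<Sum>i=1..N. (net x i)\<^sup>2) \<le> l * (\<Sum>i=1..N. (x i)\<^sup>2)"
proof
  let ?l = "\<Sum>i=1..N. \<Sum>j=1..N. (lap i j)\<^sup>2"
  \<comment> \<open>The maximum with 1 makes the constant positive, since the Lyapunov estimate
    divides by it.\<close>
  show "1 \<le> max 1 ?l" by simp
  fix x :: "nat \<Rightarrow> real"
  have "(\<Sum>i=1..N. (net x i)\<^sup>2) = (\<Sum>i=1..N. (\<Sum>j=1..N. lap i j * x j)\<^sup>2)"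
    by (intro sum.cong refl) (simp add: net_matrix)
  also have "\<dots> \<le> ?l * (\<Sum>i=1..N. (x i)\<^sup>2)" by (rule sum_sq_matrix_le)
  also have "\<dots> \<le> max 1 ?l * (\<Sum>i=1..N. (x i)\<^sup>2)" by (intro mult_right_mono sum_nonneg) auto
  finally show "(\<Sum>i=1..N. (net x i)\<^sup>2) \<le> max 1 ?l * (\<Sum>i=1..N. (x i)\<^sup>2)" .
qed

lemma net_plus_sum:
  "i \<in> {1..N} \<Longrightarrow> (\<Sum>j=1..N. (lap i j + 1) * x j) = net x i + (\<Sum>j=1..N. x j)"
  by (simp add: net_matrix distrib_right sum.distrib)

text \<open>Adding all equations annihilates the Laplacian and leaves N times the sum of
  \<open>x\<close>. This separates the shifted system into its mean and its mean-free part.\<close>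

lemma sum_zero_if_net_plus_sum:
  assumes "\<And>i. i \<in> {1..N} \<Longrightarrow> net x i + (\<Sum>j=1..N. x j) = b i" "(\<Sum>i=1..N. b i) = 0"
  shows "(\<Sum>j=1..N. x j) = 0"
proof -
  have "(\<Sum>i=1..N. b i) = (\<Sum>i=1..N. net x i + (\<Sum>j=1..N. x j))"
    using assms(1) by simp
  also have "\<dots> = N * (\<Sum>j=1..N. x j)" unfolding sum.distrib sum_net by simp
  finally show ?thesis using assms(2) N_pos by simp
qed

text \<open>The Dirichlet form vanishes, hence each of its nonnegative terms does; so
  \<open>x\<close> agrees across edges, is constant by connectedness, and has mean zero.\<close>

lemma net_kernel:
  assumes "\<And>i. i \<in> {1..N} \<Longrightarrow> net x i = 0" "(\<Sum>j=1..N. x j) = 0" "i \<in> {1..N}"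
  shows "x i = 0"
proof -
  have "(\<Sum>i=1..N. \<Sum>j=1..N. a i j * (x i - x j) * (x i - x j)) = 0"
    using net_quadratic[of x x] assms(1) by simp
  note zero = this
  have "a i j * (x i - x j) * (x i - x j) = 0" if "i \<in> {1..N}" "j \<in> {1..N}" for i j
  proof -
    have row: "(\<Sum>j=1..N. a i j * (x i - x j) * (x i - x j)) = 0"
      by (rule sum_nonneg_0[OF finite_atLeastAtMost _ zero that(1)]) (intro sum_nonneg edge_nonneg)
    show ?thesis
      by (rule sum_nonneg_0[OF finite_atLeastAtMost _ row that(2)]) (intro edge_nonneg that(1))
  qed
  then have "x j = x i" if "j \<in> {1..N}" for j
    using constant_if_edge_constant[of x j i] assms(3) that by fastforce
  then have "(\<Sum>j=1..N. x j) = N * x i" by simp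
  then show ?thesis using assms(2) N_pos by simp
qed

text \<open>Adding 1 to every entry shifts the kernel of the Laplacian, the constants, to the eigenvalue \<^term>\<open>N\<close>.\<close>

lemma laplacian_inverse:
  "\<exists>m. \<forall>i\<in>{1..N}. \<forall>j\<in>{1..N}.
    (\<Sum>k=1..N. m i k * (lap k j + 1)) = (if i = j then 1 else 0) \<and>
    (\<Sum>k=1..N. (lap i k + 1) * m k j) = (if i = j then 1 else 0)"
proof (rule injective_system_inverse[of N "\<lambda>i j. lap i j + 1"])
  fix x i assume "\<And>i. i \<in> {1..N} \<Longrightarrow> (\<Sum>j=1..N. (lap i j + 1) * x j) = 0" and i: "i \<in> {1..N}"
  then have *: "net x i + (\<Sum>j=1..N. x j) = 0" if "i \<in> {1..N}" for i
    using net_plus_sum that by metis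
  have sum: "(\<Sum>j=1..N. x j) = 0" by (rule sum_zero_if_net_plus_sum[of x "\<lambda>_. 0"]) (simp_all only: * sum.neutral_const)
  have "net x k = 0" if "k \<in> {1..N}" for k using *[OF that] sum by linarith
  then show "x i = 0" using sum i by (rule net_kernel)
qed

text \<open>This stands in for the spectral gap of the Laplacian. On vectors of sum zero the shift
  by 1 is invisible, so the inverse of the shifted matrix recovers \<open>x\<close> from
  \<open>net x\<close>.\<close>

lemma net_coercive:
  obtains c where "1 \<le> c"
    "\<And>x. (\<Sum>i=1..N. x i) = 0 \<Longrightarrow> (\<Sum>i=1..N. (x i)\<^sup>2) \<le> c * (\<Sum>i=1..N. (net x i)\<^sup>2)"
proof -
  obtain m where m: "\<And>i j. i \<in> {1..N} \<Longrightarrow> j \<in> {1..N} \<Longrightarrow>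
      (\<Sum>k=1..N. m i k * (lap k j + 1)) = (if i = j then 1 else 0)"
    using laplacian_inverse by metis
  let ?c = "\<Sum>i=1..N. \<Sum>k=1..N. (m i k)\<^sup>2"
  show thesis
  proof
    show "1 \<le> max 1 ?c" by simp
    fix x :: "nat \<Rightarrow> real" assume x: "(\<Sum>i=1..N. x i) = 0"
    have "x i = (\<Sum>k=1..N. m i k * net x k)" if i: "i \<in> {1..N}" for i
    proof -
      have "(\<Sum>k=1..N. m i k * net x k) = (\<Sum>k=1..N. m i k * (\<Sum>j=1..N. (lap k j + 1) * x j))"
        using x by (intro sum.cong refl) (simp only: net_plus_sum add_0_right)
      also have "\<dots> = (\<Sum>k=1..N. \<Sum>j=1..N. m i k * (lap k j + 1) * x j)"
        by (simp add: sum_distrib_left mult.assoc)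
      also have "\<dots> = (\<Sum>j=1..N. (\<Sum>k=1..N. m i k * (lap k j + 1)) * x j)"
        by (subst sum.swap) (simp add: sum_distrib_right)
      also have "\<dots> = (\<Sum>j=1..N. if i = j then x j else 0)"
        using m[OF i] by (intro sum.cong refl) simp
      finally show ?thesis using i by simp
    qed
    then have "(\<Sum>i=1..N. (x i)\<^sup>2) = (\<Sum>i=1..N. (\<Sum>k=1..N. m i k * net x k)\<^sup>2)"
      by simp
    also have "\<dots> \<le> ?c * (\<Sum>i=1..N. (net x i)\<^sup>2)" by (rule sum_sq_matrix_le)
    also have "\<dots> \<le> max 1 ?c * (\<Sum>i=1..N. (net x i)\<^sup>2)" by (intro mult_right_mono sum_nonneg) auto
    finally show "(\<Sum>i=1..N. (x i)\<^sup>2) \<le> max 1 ?c * (\<Sum>i=1..N. (net x i)\<^sup>2)" .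
  qed
qed

text \<open>Provides the equilibrium of the integrators. A right-hand side of sum zero forces the
  solution of the shifted system to have sum zero, so it solves the unshifted one.\<close>

lemma net_solvable:
  assumes b: "(\<Sum>i=1..N. b i) = 0"
  obtains v where "(\<Sum>i=1..N. v i) = 0" "\<And>i. i \<in> {1..N} \<Longrightarrow> net v i = b i"
proof -
  obtain m where m: "\<And>i j. i \<in> {1..N} \<Longrightarrow> j \<in> {1..N} \<Longrightarrow>
      (\<Sum>k=1..N. (lap i k + 1) * m k j) = (if i = j then 1 else 0)"
    using laplacian_inverse by metis
  define v where "v k = (\<Sum>j=1..N. m k j * b j)" for k
  have v: "net v i + (\<Sum>j=1..N. v j) = b i" if i: "i \<in> {1..N}" for i
  proof -
    have "net v i + (\<Sum>j=1..N. v j) = (\<Sum>k=1..N. (lap i k + 1) * v k)"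
      using net_plus_sum[OF i] by simp
    also have "\<dots> = (\<Sum>k=1..N. \<Sum>j=1..N. (lap i k + 1) * m k j * b j)"
      by (simp only: v_def sum_distrib_left mult.assoc)
    also have "\<dots> = (\<Sum>j=1..N. (\<Sum>k=1..N. (lap i k + 1) * m k j) * b j)"
      by (subst sum.swap) (simp only: sum_distrib_right)
    also have "\<dots> = (\<Sum>j=1..N. if i = j then b j else 0)"
      using m[OF i] by (intro sum.cong refl) simp
    finally show ?thesis using i by simp
  qed
  then have "(\<Sum>j=1..N. v j) = 0" using b by (rule sum_zero_if_net_plus_sum)
  with v show thesis by (intro that) auto
qed

end

subsection \<open>The primal-dual dynamics\<close>

text \<open>The left side is the derivative of one agent's share of the Lyapunov function, with
  \<open>p\<close>, \<open>nl\<close> and \<open>nnl\<close> standing for the Laplacian of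
  \<open>v\<close>, of \<open>l\<close> and of \<open>nl\<close>. The cross terms contribute
  \<open>- b * l\<^sup>2\<close> and \<open>- p\<^sup>2\<close>; the other products are split by
  Young's inequality. The products with weight \<open>\<kappa>\<close> stay untouched, because they
  have a sign or cancel only after summation over the agents.\<close>

lemma lyapunov_summand_bound:
  fixes z l v p g nl nnl :: real
  assumes b: "0 < b" and L: "0 < L"
  shows "\<kappa> * (z * (- g + l) + l * (- nl - p - z) + v * nl)
      - b * ((- g + l) * l + z * (- nl - p - z)) + ((- nl - p - z) * p + l * nnl)
    \<le> - \<kappa> * (z * g) - \<kappa> * (l * nl) + \<kappa> * (v * nl - l * p) + b * g\<^sup>2
      + (b * L + b\<^sup>2 + b + 1) * z\<^sup>2 + (1/2 - 3/4 * b) * l\<^sup>2 + (b / (4 * L) + 1) * nl\<^sup>2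
      + 1/2 * nnl\<^sup>2 - 1/4 * p\<^sup>2"
proof -
  have 1: "b * (g * l) \<le> b * (1/4 * l\<^sup>2 + g\<^sup>2)"
    using zero_le_power2[of "l/2 - g"] b by (intro mult_left_mono) (auto simp: power2_eq_square algebra_simps)
  \<comment> \<open>The weight \<open>L\<close> is chosen such that inserting the bound of the
    summed \<open>nl\<^sup>2\<close> by \<open>L\<close> times that of \<open>l\<^sup>2\<close>
    costs just \<open>b / 4\<close> of the term \<open>- 3/4 * b * l\<^sup>2\<close>.\<close>
  have "z * nl \<le> L * z\<^sup>2 + nl\<^sup>2 / (4 * L)"
    using zero_le_power2[of "2 * L * z - nl"] L
    by (simp add: power2_eq_square field_simps)
  then have "b * (z * nl) \<le> b * (L * z\<^sup>2 + nl\<^sup>2 / (4 * L))" using b by (intro mult_left_mono) auto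
  then have 2: "b * (z * nl) \<le> b * L * z\<^sup>2 + b / (4 * L) * nl\<^sup>2" by (simp add: algebra_simps)
  \<comment> \<open>Three products contain \<open>p\<close>; each spends a quarter of
    \<open>- p\<^sup>2\<close>, and one quarter remains.\<close>
  have 3: "b * (z * p) \<le> b\<^sup>2 * z\<^sup>2 + 1/4 * p\<^sup>2"
    using zero_le_power2[of "b * z - p / 2"] by (simp add: power2_eq_square algebra_simps)
  have 4: "- (nl * p) \<le> nl\<^sup>2 + 1/4 * p\<^sup>2"
    using zero_le_power2[of "nl + p / 2"] by (simp add: power2_eq_square algebra_simps)
  have 5: "- (z * p) \<le> z\<^sup>2 + 1/4 * p\<^sup>2"
    using zero_le_power2[of "z + p / 2"] by (simp add: power2_eq_square algebra_simps)
  have 6: "l * nnl \<le> 1/2 * l\<^sup>2 + 1/2 * nnl\<^sup>2"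
    using zero_le_power2[of "l - nnl"] by (simp add: power2_eq_square algebra_simps)
  have "\<kappa> * (z * (- g + l) + l * (- nl - p - z) + v * nl)
      - b * ((- g + l) * l + z * (- nl - p - z)) + ((- nl - p - z) * p + l * nnl)
    = - \<kappa> * (z * g) - \<kappa> * (l * nl) + \<kappa> * (v * nl - l * p)
      + b * (g * l) - b * l\<^sup>2 + b * (z * nl) + b * (z * p) + b * z\<^sup>2
      - (nl * p) - p\<^sup>2 - (z * p) + l * nnl"
    by (simp add: power2_eq_square algebra_simps)
  also have "\<dots> \<le> - \<kappa> * (z * g) - \<kappa> * (l * nl) + \<kappa> * (v * nl - l * p)
      + b * (1/4 * l\<^sup>2 + g\<^sup>2) - b * l\<^sup>2 + (b * L * z\<^sup>2 + b / (4 * L) * nl\<^sup>2)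
      + (b\<^sup>2 * z\<^sup>2 + 1/4 * p\<^sup>2) + b * z\<^sup>2
      + (nl\<^sup>2 + 1/4 * p\<^sup>2) - p\<^sup>2 + (z\<^sup>2 + 1/4 * p\<^sup>2) + (1/2 * l\<^sup>2 + 1/2 * nnl\<^sup>2)"
    using 1 2 3 4 5 6 by linarith
  also have "\<dots> = - \<kappa> * (z * g) - \<kappa> * (l * nl) + \<kappa> * (v * nl - l * p) + b * g\<^sup>2
      + (b * L + b\<^sup>2 + b + 1) * z\<^sup>2 + (1/2 - 3/4 * b) * l\<^sup>2 + (b / (4 * L) + 1) * nl\<^sup>2
      + 1/2 * nnl\<^sup>2 - 1/4 * p\<^sup>2"
    by (simp add: algebra_simps)
  finally show ?thesis .
qed

lemma lyapunov_summand_derivative: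
  fixes z l v p :: "real \<Rightarrow> real"
  assumes "(z has_real_derivative z') (at t within T)" "(l has_real_derivative l') (at t within T)"
    "(v has_real_derivative v') (at t within T)" "(p has_real_derivative p') (at t within T)"
  shows "((\<lambda>t. \<kappa> * ((z t)\<^sup>2 + (l t)\<^sup>2 + (v t)\<^sup>2) / 2 - b * (z t * l t) + l t * p t) has_real_derivative
    \<kappa> * (z t * z' + l t * l' + v t * v') - b * (z' * l t + z t * l') + (l' * p t + l t * p')) (at t within T)"
  using assms by (auto intro!: derivative_eq_intros simp: field_simps)

lemma has_real_derivative_network_diff:
  assumes "\<And>j. j \<in> {1..N} \<Longrightarrow> ((\<lambda>s. x s j) has_real_derivative x' j) (at t within T)" "i \<in> {1..N}"
  shows "((\<lambda>s. network_diff N a (x s) i) has_real_derivative network_diff N a x' i) (at t within T)"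
  unfolding network_diff_def by (intro DERIV_sum DERIV_cmult DERIV_diff assms)

definition primal_dual_solution ::
    "nat \<Rightarrow> (nat \<Rightarrow> nat \<Rightarrow> real) \<Rightarrow> (nat \<Rightarrow> real \<Rightarrow> real) \<Rightarrow> (nat \<Rightarrow> real) \<Rightarrow>
     (real \<Rightarrow> nat \<Rightarrow> real) \<Rightarrow> (real \<Rightarrow> nat \<Rightarrow> real) \<Rightarrow> (real \<Rightarrow> nat \<Rightarrow> real) \<Rightarrow> bool" where
  "primal_dual_solution N a F d z lam v \<longleftrightarrow> (\<forall>i\<in>{1..N}. \<forall>t\<ge>0.
     ((\<lambda>s. z s i) has_real_derivative - F i (z t i) + lam t i) (at t within {0..}) \<and>
     ((\<lambda>s. lam s i) has_real_derivative
        - network_diff N a (lam t) i - network_diff N a (v t) i + d i - z t i) (at t within {0..}) \<and>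
     ((\<lambda>s. v s i) has_real_derivative network_diff N a (lam t) i) (at t within {0..}))"

text \<open>The multipliers are included in the conclusion because the plant is driven by the
  derivative of \<open>z\<close>, and this is small only if \<open>z\<close> and \<open>lam\<close>
  are both near equilibrium. One rate serves all agents and all initial values.\<close>

lemma (in weighted_graph) primal_dual_decay:
  fixes F :: "nat \<Rightarrow> real \<Rightarrow> real"
  assumes h: "0 < h"
    and mono: "\<And>i s r. i \<in> {1..N} \<Longrightarrow> h * (s - r)\<^sup>2 \<le> (F i s - F i r) * (s - r)"
    and lips: "\<And>i s r. i \<in> {1..N} \<Longrightarrow> \<bar>F i s - F i r\<bar> \<le> H * \<bar>s - r\<bar>"
    and feas: "(\<Sum>i=1..N. ystar i) = (\<Sum>i=1..N. d i)"
    and kkt: "\<And>i. i \<in> {1..N} \<Longrightarrow> F i (ystar i) = lamstar"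
  shows "\<exists>\<mu>>0. \<forall>z0 l0 v0. \<exists>c. \<forall>z lam v. primal_dual_solution N a F d z lam v \<and>
      (\<forall>i\<in>{1..N}. z 0 i = z0 i \<and> lam 0 i = l0 i \<and> v 0 i = v0 i) \<longrightarrow>
      (\<forall>i\<in>{1..N}. \<forall>t\<ge>0. \<bar>z t i - ystar i\<bar> \<le> c * exp (- \<mu> * t) \<and> \<bar>lam t i - lamstar\<bar> \<le> c * exp (- \<mu> * t))"
proof -
  obtain L where L: "1 \<le> L" and Lb: "\<And>x. (\<Sum>i=1..N. (net x i)\<^sup>2) \<le> L * (\<Sum>i=1..N. (x i)\<^sup>2)"
    by (rule net_bounded) blast
  obtain c where c: "1 \<le> c"
    and cb: "\<And>x. (\<Sum>i=1..N. x i) = 0 \<Longrightarrow> (\<Sum>i=1..N. (x i)\<^sup>2) \<le> c * (\<Sum>i=1..N. (net x i)\<^sup>2)"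
    by (rule net_coercive) blast
  \<comment> \<open>At equilibrium the multipliers agree and \<open>z\<close> equals
    \<open>ystar\<close>, so the multiplier equation reads \<open>net v i = d i - ystar i\<close>;
    its right side sums to 0 by feasibility.\<close>
  obtain vb where vb0: "(\<Sum>i=1..N. vb i) = 0" and vb: "\<And>i. i \<in> {1..N} \<Longrightarrow> net vb i = d i - ystar i"
    by (rule net_solvable[of "\<lambda>i. d i - ystar i"]) (use feas in \<open>simp add: sum_subtractf\<close>, blast)
  \<comment> \<open>Solves \<open>1/2 - b/2 + L + L\<^sup>2 / 2 = - 1\<close>, the coefficient of
    the squared multiplier errors in the final estimate.\<close>
  define b where "b = 2 * L + L\<^sup>2 + 3"
  have b: "0 < b" using L by (simp add: b_def add_pos_nonneg)
  \<comment> \<open>The quotient by \<open>h\<close> lets strong monotonicity absorb all squares of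
    \<open>zt\<close> and leave at least one; the remaining summands let the energy dominate the
    cross terms.\<close>
  define \<kappa> where "\<kappa> = (b * H\<^sup>2 + b * L + b\<^sup>2 + b + 2) / h + b + L + 2"
  have \<kappa>h: "b * H\<^sup>2 + b * L + b\<^sup>2 + b + 2 \<le> \<kappa> * h"
  proof -
    have "\<kappa> * h = (b * H\<^sup>2 + b * L + b\<^sup>2 + b + 2) / h * h + (b + L + 2) * h"
      unfolding \<kappa>_def by (simp only: distrib_right add.assoc)
    then show ?thesis using h b L by simp
  qed
  have \<kappa>: "b + L + 2 \<le> \<kappa>"
  proof -
    have "0 \<le> (b * H\<^sup>2 + b * L + b\<^sup>2 + b + 2) / h"
      using h b L by (intro divide_nonneg_pos add_nonneg_nonneg mult_nonneg_nonneg) auto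
    then show ?thesis unfolding \<kappa>_def by linarith
  qed
  \<comment> \<open>Half of \<open>\<kappa>\<close> comes from the energy, \<open>b / 2\<close> and
    \<open>(1 + L) / 2\<close> from the two cross terms.\<close>
  define Kup where "Kup = (\<kappa> + b + L + 1) / 2"
  have Kup: "0 < Kup" using \<kappa> b L by (simp add: Kup_def)
  \<comment> \<open>\<open>W\<close> decays at twice this rate, as it is quadratic. The factor
    \<open>c\<close> pays for replacing \<open>V\<close> by \<open>P\<close>, and the remaining 4
    matches the quarter of \<open>P\<close> left in the derivative.\<close>
  define \<mu> where "\<mu> = 1 / (8 * c * Kup)"
  have \<mu>: "0 < \<mu>" using c Kup by (simp add: \<mu>_def)
  \<comment> \<open>The initial squared error expressed by initial values alone, so that the
    constant is fixed before the solution.\<close>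
  define S0 where "S0 z0 l0 v0 = (\<Sum>i=1..N. (z0 i - ystar i)\<^sup>2) + (\<Sum>i=1..N. (l0 i - lamstar)\<^sup>2)
      + (\<Sum>i=1..N. (v0 i - (\<Sum>j=1..N. v0 j) / N - vb i)\<^sup>2)" for z0 l0 v0 :: "nat \<Rightarrow> real"
  show ?thesis
  proof (rule exI[of _ \<mu>], rule conjI[OF \<mu>], rule allI, rule allI, rule allI)
    fix z0 l0 v0
    \<comment> \<open>From \<open>(Z t + \<Lambda> t) / 2 \<le> W t\<close> and the decay of
      \<open>W\<close>, which starts below \<open>Kup * S0 z0 l0 v0\<close>.\<close>
    let ?c = "sqrt (2 * (Kup * S0 z0 l0 v0))"
    show "\<exists>c. \<forall>z lam v. primal_dual_solution N a F d z lam v \<and>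
      (\<forall>i\<in>{1..N}. z 0 i = z0 i \<and> lam 0 i = l0 i \<and> v 0 i = v0 i) \<longrightarrow>
      (\<forall>i\<in>{1..N}. \<forall>t\<ge>0. \<bar>z t i - ystar i\<bar> \<le> c * exp (- \<mu> * t) \<and> \<bar>lam t i - lamstar\<bar> \<le> c * exp (- \<mu> * t))"
    proof (rule exI[of _ ?c], rule allI, rule allI, rule allI, rule impI)
      fix z lam v
      assume A: "primal_dual_solution N a F d z lam v \<and>
        (\<forall>i\<in>{1..N}. z 0 i = z0 i \<and> lam 0 i = l0 i \<and> v 0 i = v0 i)"
      note sol = A[THEN conjunct1, unfolded primal_dual_solution_def, rule_format]
      note init = A[THEN conjunct2, rule_format]
      define zt where "zt t i = z t i - ystar i" for t i
      define lt where "lt t i = lam t i - lamstar" for t and i :: nat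
      \<comment> \<open>The network conserves the mean of \<^term>\<open>v\<close>, so only its mean-free part converges.\<close>
      define vt where "vt t i = v t i - (\<Sum>j=1..N. v t j) / N - vb i" for t i
      define g where "g t i = F i (z t i) - F i (ystar i)" for t i
      have nl: "net (lt t) i = net (lam t) i" for t i
        unfolding lt_def by (simp add: net_diff net_const)
      have p: "net (vt t) i = net (v t) i - (d i - ystar i)" if "i \<in> {1..N}" for t i
        unfolding vt_def by (simp add: net_diff net_const vb[OF that])
      have vt0: "(\<Sum>i=1..N. vt t i) = 0" for t
        unfolding vt_def sum_subtractf vb0 using N_pos by simp
      have dz: "((\<lambda>s. zt s i) has_real_derivative - g t i + lt t i) (at t within {0..})"
        if "i \<in> {1..N}" "0 \<le> t" for i t
        unfolding zt_def g_def lt_def using sol[OF that] kkt[OF that(1)]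
        by (auto intro!: derivative_eq_intros)
      have dl: "((\<lambda>s. lt s i) has_real_derivative - net (lt t) i - net (vt t) i - zt t i) (at t within {0..})"
        if "i \<in> {1..N}" "0 \<le> t" for i t
      proof -
        have "((\<lambda>s. lt s i) has_real_derivative
            - net (lam t) i - net (v t) i + d i - z t i - 0) (at t within {0..})"
          unfolding lt_def by (intro DERIV_diff DERIV_const) (use sol[OF that] in auto)
        then show ?thesis unfolding nl p[OF that(1)] zt_def by (simp add: algebra_simps)
      qed
      have dv: "((\<lambda>s. vt s i) has_real_derivative net (lt t) i) (at t within {0..})"
        if "i \<in> {1..N}" "0 \<le> t" for i t
      proof -
        have "((\<lambda>s. vt s i) has_real_derivative
            net (lam t) i - (\<Sum>j=1..N. net (lam t) j) / N - 0) (at t within {0..})"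
          unfolding vt_def by (intro DERIV_diff DERIV_const DERIV_cdivide DERIV_sum) (use sol that in auto)
        then show ?thesis unfolding nl sum_net by simp
      qed
      have dp: "((\<lambda>s. net (vt s) i) has_real_derivative net (net (lt t)) i) (at t within {0..})"
        if "i \<in> {1..N}" "0 \<le> t" for i t
        using that dv by (intro has_real_derivative_network_diff) auto
      \<comment> \<open>The energy alone only dissipates \<^term>\<open>zt\<close> and the disagreement of \<^term>\<open>lt\<close>; the two cross terms produce
        all of \<^term>\<open>lt\<close> and \<^term>\<open>net (vt t)\<close> in turn, and the weights \<^term>\<open>b\<close> and \<^term>\<open>\<kappa>\<close> absorb their remainders.\<close>
      define W where "W t = (\<Sum>i=1..N. \<kappa> * ((zt t i)\<^sup>2 + (lt t i)\<^sup>2 + (vt t i)\<^sup>2) / 2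
          - b * (zt t i * lt t i) + lt t i * net (vt t) i)" for t
      define W' where "W' t = (\<Sum>i=1..N.
          \<kappa> * (zt t i * (- g t i + lt t i) + lt t i * (- net (lt t) i - net (vt t) i - zt t i) + vt t i * net (lt t) i)
          - b * ((- g t i + lt t i) * lt t i + zt t i * (- net (lt t) i - net (vt t) i - zt t i))
          + ((- net (lt t) i - net (vt t) i - zt t i) * net (vt t) i + lt t i * net (net (lt t)) i))" for t
      have dW: "(W has_real_derivative W' t) (at t within {0..})" if "0 \<le> t" for t
        unfolding W_def W'_def
      proof (rule DERIV_sum)
        fix i assume i: "i \<in> {1..N}"
        show "((\<lambda>t. \<kappa> * ((zt t i)\<^sup>2 + (lt t i)\<^sup>2 + (vt t i)\<^sup>2) / 2
          - b * (zt t i * lt t i) + lt t i * net (vt t) i) has_real_derivative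
          \<kappa> * (zt t i * (- g t i + lt t i) + lt t i * (- net (lt t) i - net (vt t) i - zt t i) + vt t i * net (lt t) i)
          - b * ((- g t i + lt t i) * lt t i + zt t i * (- net (lt t) i - net (vt t) i - zt t i))
          + ((- net (lt t) i - net (vt t) i - zt t i) * net (vt t) i + lt t i * net (net (lt t)) i)) (at t within {0..})"
          using dz[OF i that] dl[OF i that] dv[OF i that] dp[OF i that] by (rule lyapunov_summand_derivative)
      qed
      define Z \<Lambda> V P where "Z t = (\<Sum>i=1..N. (zt t i)\<^sup>2)" and "\<Lambda> t = (\<Sum>i=1..N. (lt t i)\<^sup>2)"
        and "V t = (\<Sum>i=1..N. (vt t i)\<^sup>2)" and "P t = (\<Sum>i=1..N. (net (vt t) i)\<^sup>2)" for t
      have nonneg: "0 \<le> Z t" "0 \<le> \<Lambda> t" "0 \<le> V t" "0 \<le> P t" for t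
        by (auto simp: Z_def \<Lambda>_def V_def P_def intro!: sum_nonneg)
      have PV: "P t \<le> L * V t" "V t \<le> c * P t" for t
        using Lb[of "vt t"] cb[OF vt0] by (auto simp: P_def V_def)
      have W'_le: "W' t \<le> - Z t - \<Lambda> t - P t / 4" for t
      proof -
        define G M Q where "G = (\<Sum>i=1..N. (g t i)\<^sup>2)" and "M = (\<Sum>i=1..N. (net (lt t) i)\<^sup>2)"
          and "Q = (\<Sum>i=1..N. (net (net (lt t)) i)\<^sup>2)"
        have M: "M \<le> L * \<Lambda> t" unfolding M_def \<Lambda>_def by (rule Lb)
        have "Q \<le> L * M" unfolding M_def Q_def by (rule Lb)
        also have "\<dots> \<le> L * (L * \<Lambda> t)" using M L by (intro mult_left_mono) auto
        finally have Q: "Q \<le> L\<^sup>2 * \<Lambda> t" by (simp add: power2_eq_square mult.assoc)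
        have G: "G \<le> H\<^sup>2 * Z t"
          unfolding G_def Z_def sum_distrib_left g_def zt_def
        proof (rule sum_mono)
          fix i assume "i \<in> {1..N}"
          from lips[OF this, of "z t i" "ystar i"]
          show "(F i (z t i) - F i (ystar i))\<^sup>2 \<le> H\<^sup>2 * (z t i - ystar i)\<^sup>2"
            using power_mono[of "\<bar>F i (z t i) - F i (ystar i)\<bar>" _ 2] by (fastforce simp: power_mult_distrib)
        qed
        have zg: "h * Z t \<le> (\<Sum>i=1..N. zt t i * g t i)"
          unfolding Z_def sum_distrib_left g_def zt_def
          using mono by (intro sum_mono) (simp add: mult.commute)
        have ln: "0 \<le> (\<Sum>i=1..N. lt t i * net (lt t) i)" by (rule net_nonneg)
        \<comment> \<open>The coupling between \<open>lt\<close> and \<open>vt\<close> is skew: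
          symmetry of the Laplacian cancels it in the sum, though not for a single agent.\<close>
        have cross: "(\<Sum>i=1..N. vt t i * net (lt t) i - lt t i * net (vt t) i) = 0"
          unfolding sum_subtractf net_symmetric[of "vt t"] by simp
        have "W' t \<le> (\<Sum>i=1..N. - \<kappa> * (zt t i * g t i) - \<kappa> * (lt t i * net (lt t) i)
          + \<kappa> * (vt t i * net (lt t) i - lt t i * net (vt t) i) + b * (g t i)\<^sup>2
          + (b * L + b\<^sup>2 + b + 1) * (zt t i)\<^sup>2 + (1/2 - 3/4 * b) * (lt t i)\<^sup>2
          + (b / (4 * L) + 1) * (net (lt t) i)\<^sup>2 + 1/2 * (net (net (lt t)) i)\<^sup>2 - 1/4 * (net (vt t) i)\<^sup>2)"
          unfolding W'_def using b L by (intro sum_mono lyapunov_summand_bound) auto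
        also have "\<dots> = - \<kappa> * (\<Sum>i=1..N. zt t i * g t i) - \<kappa> * (\<Sum>i=1..N. lt t i * net (lt t) i)
          + \<kappa> * (\<Sum>i=1..N. vt t i * net (lt t) i - lt t i * net (vt t) i) + b * G
          + (b * L + b\<^sup>2 + b + 1) * Z t + (1/2 - 3/4 * b) * \<Lambda> t
          + (b / (4 * L) + 1) * M + 1/2 * Q - 1/4 * P t"
          unfolding G_def M_def Q_def Z_def \<Lambda>_def P_def
          by (simp only: sum.distrib sum_subtractf sum_distrib_left right_diff_distrib)
        also have "\<dots> \<le> - (\<kappa> * h) * Z t + b * (H\<^sup>2 * Z t)
          + (b * L + b\<^sup>2 + b + 1) * Z t + (1/2 - 3/4 * b) * \<Lambda> t
          + (b / (4 * L) + 1) * (L * \<Lambda> t) + 1/2 * (L\<^sup>2 * \<Lambda> t) - 1/4 * P t"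
        proof -
          have k0: "0 \<le> \<kappa>" using \<kappa> b L by simp
          have "\<kappa> * (h * Z t) \<le> \<kappa> * (\<Sum>i=1..N. zt t i * g t i)" using zg k0 by (rule mult_left_mono)
          moreover have "0 \<le> \<kappa> * (\<Sum>i=1..N. lt t i * net (lt t) i)" using ln k0 by simp
          moreover have "b * G \<le> b * (H\<^sup>2 * Z t)" using G b by (intro mult_left_mono) auto
          moreover have "(b / (4 * L) + 1) * M \<le> (b / (4 * L) + 1) * (L * \<Lambda> t)"
            using M b L by (intro mult_left_mono) auto
          ultimately show ?thesis unfolding cross using Q by (simp add: mult.assoc)
        qed
        also have "\<dots> = - (\<kappa> * h - (b * H\<^sup>2 + b * L + b\<^sup>2 + b + 1)) * Z t
            + (1/2 - b/2 + L + L\<^sup>2 / 2) * \<Lambda> t - P t / 4"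
          using L by (simp add: field_simps)
        also have "\<dots> \<le> - 1 * Z t + - 1 * \<Lambda> t - P t / 4"
        proof -
          have "1/2 - b/2 + L + L\<^sup>2 / 2 \<le> - 1" unfolding b_def by (simp add: field_simps)
          then show ?thesis
            using \<kappa>h nonneg by (intro add_mono diff_right_mono mult_right_mono) auto
        qed
        finally show ?thesis by simp
      qed
      have W_lower: "(Z t + \<Lambda> t) / 2 \<le> W t" and W_upper: "W t \<le> Kup * (Z t + \<Lambda> t + V t)" for t
      proof -
        \<comment> \<open>In the worst case the cross terms take \<open>(b + 1 + L) / 2\<close>
          times \<open>S\<close>, defined below as the total squared error. As
          \<open>\<kappa>\<close> is at least \<open>b + L + 2\<close>, half of \<open>S\<close>
          remains.\<close>
        define X Y where "X = (\<Sum>i=1..N. zt t i * lt t i)" and "Y = (\<Sum>i=1..N. lt t i * net (vt t) i)"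
        have W: "W t = \<kappa> / 2 * (Z t + \<Lambda> t + V t) - b * X + Y"
        proof -
          have "W t = (\<Sum>i=1..N. \<kappa> / 2 * (zt t i)\<^sup>2 + \<kappa> / 2 * (lt t i)\<^sup>2 + \<kappa> / 2 * (vt t i)\<^sup>2
              - b * (zt t i * lt t i) + lt t i * net (vt t) i)"
            unfolding W_def by (intro sum.cong refl) (simp add: field_simps)
          then show ?thesis unfolding X_def Y_def Z_def \<Lambda>_def V_def
            by (simp only: sum.distrib sum_subtractf sum_distrib_left distrib_left)
        qed
        have "\<bar>x * y\<bar> \<le> (x\<^sup>2 + y\<^sup>2) / 2" for x y :: real
          using zero_le_power2[of "x - y"] zero_le_power2[of "x + y"] by (simp add: power2_eq_square abs_if algebra_simps)
        then have young: "\<bar>\<Sum>i=1..N. x i * y i\<bar> \<le> ((\<Sum>i=1..N. (x i)\<^sup>2) + (\<Sum>i=1..N. (y i)\<^sup>2)) / 2" for x y :: "nat \<Rightarrow> real"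
          unfolding sum.distrib[symmetric] sum_divide_distrib by (intro order.trans[OF sum_abs] sum_mono) auto
        have X: "\<bar>X\<bar> \<le> (Z t + \<Lambda> t) / 2" unfolding X_def Z_def \<Lambda>_def by (rule young)
        have Y: "\<bar>Y\<bar> \<le> (\<Lambda> t + L * V t) / 2"
          using young[of "lt t" "net (vt t)"] PV(1)[of t] unfolding Y_def \<Lambda>_def P_def by simp
        have bX: "\<bar>b * X\<bar> \<le> b * (Z t + \<Lambda> t) / 2" using mult_left_mono[OF X, of b] b by (simp add: abs_mult)
        define S where "S = Z t + \<Lambda> t + V t"
        have S: "0 \<le> S" "Z t + \<Lambda> t \<le> S" "V t \<le> S" using nonneg[of t] by (auto simp: S_def)
        have bS: "b * (Z t + \<Lambda> t) \<le> b * S" and LS: "L * V t \<le> L * S"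
          using S b L by (auto intro: mult_left_mono)
        have "(b + L + 2) * S \<le> \<kappa> * S" using \<kappa> S(1) by (rule mult_right_mono)
        then have \<kappa>S: "b * S + L * S + 2 * S \<le> \<kappa> * S" by (simp add: algebra_simps)
        have bX': "b * X \<le> b * S / 2" "- (b * X) \<le> b * S / 2" using bX bS by auto
        have Y': "Y \<le> (S + L * S) / 2" "- Y \<le> (S + L * S) / 2" using Y LS S nonneg[of t] by auto
        have WS: "W t = \<kappa> * S / 2 - b * X + Y" unfolding W S_def by simp
        have arith: "u / 2 \<le> p / 2 - x + y" if "q + r + 2 * s \<le> p" "x \<le> q / 2" "- y \<le> (s + r) / 2" "u \<le> s"
          for p q r s u x y :: real
          using that by (simp add: field_simps)
        show "(Z t + \<Lambda> t) / 2 \<le> W t"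
          unfolding WS using \<kappa>S bX'(1) Y'(2) S(2) by (rule arith)
        have "W t \<le> \<kappa> * S / 2 + b * S / 2 + (S + L * S) / 2" unfolding WS using bX' Y' by linarith
        also have "\<dots> = Kup * S" by (simp add: Kup_def field_simps)
        finally show "W t \<le> Kup * (Z t + \<Lambda> t + V t)" by (simp add: S_def)
      qed
      have decay: "W t \<le> W 0 * exp (- (2 * \<mu>) * t)" if "0 \<le> t" for t
      proof (rule exp_decay_of_differential_inequality[OF dW _ that])
        fix t :: real
        have "2 * \<mu> * W t \<le> 2 * \<mu> * (Kup * (Z t + \<Lambda> t + V t))"
          using W_upper \<mu> by (intro mult_left_mono) auto
        also have "\<dots> = (Z t + \<Lambda> t + V t) / (4 * c)" using Kup c by (simp add: \<mu>_def)
        also have "\<dots> \<le> Z t + \<Lambda> t + P t / 4"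
        proof -
          have "Z t \<le> c * Z t" "\<Lambda> t \<le> c * \<Lambda> t" using c nonneg[of t] by (auto intro: mult_right_mono[of 1 c, simplified])
          then have "Z t + \<Lambda> t + V t \<le> 4 * (c * Z t) + 4 * (c * \<Lambda> t) + c * P t"
            using PV(2)[of t] nonneg[of t] by linarith
          also have "\<dots> = (4 * c) * (Z t + \<Lambda> t + P t / 4)" by (simp add: algebra_simps)
          finally show ?thesis using c by (simp add: divide_le_eq mult.commute)
        qed
        finally show "W' t \<le> - (2 * \<mu>) * W t" using W'_le[of t] by simp
      qed
      have init_sum: "(\<Sum>j=1..N. v 0 j) = (\<Sum>j=1..N. v0 j)" using init by (intro sum.cong) auto
      have "Z 0 + \<Lambda> 0 + V 0 = S0 z0 l0 v0"
        unfolding Z_def \<Lambda>_def V_def S0_def zt_def lt_def vt_def init_sum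
        using init by (intro arg_cong2[of _ _ _ _ "(+)"] sum.cong) auto
      then have W0: "W 0 \<le> Kup * S0 z0 l0 v0" using W_upper[of 0] by simp
      have bound: "Z t + \<Lambda> t \<le> (?c * exp (- \<mu> * t))\<^sup>2" if "0 \<le> t" for t
      proof -
        have "0 \<le> Kup * S0 z0 l0 v0"
          using Kup by (intro mult_nonneg_nonneg) (auto simp: S0_def intro!: add_nonneg_nonneg sum_nonneg)
        then have sq: "(?c * exp (- \<mu> * t))\<^sup>2 = 2 * (Kup * S0 z0 l0 v0) * exp (- (2 * \<mu>) * t)"
          by (simp add: power_mult_distrib flip: exp_double)
        have "Z t + \<Lambda> t \<le> 2 * W t" using W_lower[of t] by simp
        also have "\<dots> \<le> 2 * (W 0 * exp (- (2 * \<mu>) * t))"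
          using decay[OF that] by (rule mult_left_mono) simp
        also have "\<dots> \<le> 2 * (Kup * S0 z0 l0 v0 * exp (- (2 * \<mu>) * t))"
          using W0 by (intro mult_left_mono mult_right_mono) auto
        finally show ?thesis unfolding sq by (simp only: mult.assoc)
      qed
      show "\<forall>i\<in>{1..N}. \<forall>t\<ge>0. \<bar>z t i - ystar i\<bar> \<le> ?c * exp (- \<mu> * t) \<and> \<bar>lam t i - lamstar\<bar> \<le> ?c * exp (- \<mu> * t)"
      proof (intro ballI allI impI)
        fix i and t :: real assume i: "i \<in> {1..N}" and t: "0 \<le> t"
        have S: "0 \<le> S0 z0 l0 v0" by (auto simp: S0_def intro!: add_nonneg_nonneg sum_nonneg)
        then have pos: "0 \<le> ?c * exp (- \<mu> * t)" using Kup by simp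
        have "(zt t i)\<^sup>2 \<le> Z t" "(lt t i)\<^sup>2 \<le> \<Lambda> t"
          unfolding Z_def \<Lambda>_def using i by (auto intro!: member_le_sum)
        then have "(zt t i)\<^sup>2 \<le> (?c * exp (- \<mu> * t))\<^sup>2" "(lt t i)\<^sup>2 \<le> (?c * exp (- \<mu> * t))\<^sup>2"
          using bound[OF t] nonneg[of t] by linarith+
        then show "\<bar>z t i - ystar i\<bar> \<le> ?c * exp (- \<mu> * t) \<and> \<bar>lam t i - lamstar\<bar> \<le> ?c * exp (- \<mu> * t)"
          using pos unfolding zt_def lt_def by (auto intro: abs_le_square_iff[THEN iffD2, THEN order.trans[rotated]] simp: abs_le_square_iff[symmetric])
      qed
    qed
  qed
qed

subsection \<open>Existence of closed-loop solutions\<close>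

text \<open>Hiding the constant behind an existential gives closure rules that compose along the
  syntax of the vector field.\<close>

definition coord_lipschitz :: "'i set \<Rightarrow> (('i \<Rightarrow> real) \<Rightarrow> real) \<Rightarrow> bool" where
  "coord_lipschitz I G \<longleftrightarrow> (\<exists>K\<ge>0. \<forall>X Y. \<bar>G X - G Y\<bar> \<le> K * (\<Sum>j\<in>I. \<bar>X j - Y j\<bar>))"

lemma coord_lipschitz_const: "coord_lipschitz I (\<lambda>X. c)"
  unfolding coord_lipschitz_def by (intro exI[of _ 0]) simp

lemma coord_lipschitz_coord:
  assumes "finite I" "j \<in> I"
  shows "coord_lipschitz I (\<lambda>X. X j)"
  unfolding coord_lipschitz_def
proof (intro exI[of _ 1] conjI allI)
  show "\<bar>X j - Y j\<bar> \<le> 1 * (\<Sum>j\<in>I. \<bar>X j - Y j\<bar>)" for X Y :: "'a \<Rightarrow> real"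
    using member_le_sum[of j I "\<lambda>j. \<bar>X j - Y j\<bar>"] assms by simp
qed simp

lemma coord_lipschitz_lipschitz_comp:
  assumes G: "coord_lipschitz I G" and h: "\<And>s r. \<bar>h s - h r\<bar> \<le> H * \<bar>s - r\<bar>" and H: "0 \<le> H"
  shows "coord_lipschitz I (\<lambda>X. h (G X))"
proof -
  obtain K where K: "0 \<le> K" "\<And>X Y. \<bar>G X - G Y\<bar> \<le> K * (\<Sum>j\<in>I. \<bar>X j - Y j\<bar>)"
    using G unfolding coord_lipschitz_def by blast
  have "\<bar>h (G X) - h (G Y)\<bar> \<le> H * K * (\<Sum>j\<in>I. \<bar>X j - Y j\<bar>)" for X Y
    using order.trans[OF h mult_left_mono[OF K(2) H]] by (simp add: mult.assoc)
  then show ?thesis unfolding coord_lipschitz_def using H K by (intro exI[of _ "H * K"]) auto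
qed

lemma coord_lipschitz_cmult: "coord_lipschitz I G \<Longrightarrow> coord_lipschitz I (\<lambda>X. c * G X)"
  by (rule coord_lipschitz_lipschitz_comp[of I G "\<lambda>s. c * s" "\<bar>c\<bar>"])
    (auto simp: abs_mult simp flip: right_diff_distrib)

lemma coord_lipschitz_uminus: "coord_lipschitz I G \<Longrightarrow> coord_lipschitz I (\<lambda>X. - G X)"
  using coord_lipschitz_cmult[of I G "-1"] by simp

lemma coord_lipschitz_add:
  assumes "coord_lipschitz I G" "coord_lipschitz I G'"
  shows "coord_lipschitz I (\<lambda>X. G X + G' X)"
proof -
  obtain K K' where K: "0 \<le> K" "\<And>X Y. \<bar>G X - G Y\<bar> \<le> K * (\<Sum>j\<in>I. \<bar>X j - Y j\<bar>)"
    and K': "0 \<le> K'" "\<And>X Y. \<bar>G' X - G' Y\<bar> \<le> K' * (\<Sum>j\<in>I. \<bar>X j - Y j\<bar>)"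
    using assms unfolding coord_lipschitz_def by blast
  have "\<bar>(G X + G' X) - (G Y + G' Y)\<bar> \<le> (K + K') * (\<Sum>j\<in>I. \<bar>X j - Y j\<bar>)" for X Y
    unfolding distrib_right using K(2)[of X Y] K'(2)[of X Y] by linarith
  then show ?thesis unfolding coord_lipschitz_def using K K' by (intro exI[of _ "K + K'"]) auto
qed

lemma coord_lipschitz_diff:
  "coord_lipschitz I G \<Longrightarrow> coord_lipschitz I G' \<Longrightarrow> coord_lipschitz I (\<lambda>X. G X - G' X)"
  using coord_lipschitz_add[OF _ coord_lipschitz_uminus, of I G G'] by simp

lemma coord_lipschitz_sum:
  "(\<And>j. j \<in> J \<Longrightarrow> coord_lipschitz I (G j)) \<Longrightarrow> coord_lipschitz I (\<lambda>X. \<Sum>j\<in>J. G j X)"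
  by (induction J rule: infinite_finite_induct)
    (auto intro: coord_lipschitz_const coord_lipschitz_add)

text \<open>The dimension is part of the notion because componentwise rules for sums and matrix
  products hold only for matching dimensions.\<close>

definition vec_lipschitz :: "'i set \<Rightarrow> nat \<Rightarrow> (('i \<Rightarrow> real) \<Rightarrow> real Matrix.vec) \<Rightarrow> bool" where
  "vec_lipschitz I m G \<longleftrightarrow> (\<forall>X. G X \<in> carrier_vec m) \<and> (\<forall>k<m. coord_lipschitz I (\<lambda>X. G X $ k))"

lemma vec_lipschitz_vec:
  "(\<And>k. k < m \<Longrightarrow> coord_lipschitz I (\<lambda>X. G X k)) \<Longrightarrow> vec_lipschitz I m (\<lambda>X. Matrix.vec m (G X))"
  by (simp add: vec_lipschitz_def)

lemma vec_lipschitz_add: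
  assumes "vec_lipschitz I m G" "vec_lipschitz I m G'"
  shows "vec_lipschitz I m (\<lambda>X. G X + G' X)"
proof -
  have "(G X + G' X) $ k = G X $ k + G' X $ k" if "k < m" for X k
    using assms(2) that by (metis carrier_vecD index_add_vec(1) vec_lipschitz_def)
  then show ?thesis using assms unfolding vec_lipschitz_def by (simp add: coord_lipschitz_add)
qed

lemma vec_lipschitz_diff:
  assumes "vec_lipschitz I m G" "vec_lipschitz I m G'"
  shows "vec_lipschitz I m (\<lambda>X. G X - G' X)"
proof -
  have "(G X - G' X) $ k = G X $ k - G' X $ k" if "k < m" for X k
    using assms(2) that by (metis carrier_vecD index_minus_vec(1) vec_lipschitz_def)
  then show ?thesis using assms unfolding vec_lipschitz_def by (simp add: coord_lipschitz_diff)
qed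

lemma mult_mat_vec_index:
  assumes "M \<in> carrier_mat r m" "v \<in> carrier_vec m" "k < r"
  shows "(M *\<^sub>v v) $ k = (\<Sum>j<m. M $$ (k, j) * v $ j)"
  using assms by (auto simp: scalar_prod_def lessThan_atLeast0 intro!: sum.cong)

lemma vec_lipschitz_mult_mat_vec:
  assumes M: "M \<in> carrier_mat r m" and G: "vec_lipschitz I m G"
  shows "vec_lipschitz I r (\<lambda>X. M *\<^sub>v G X)"
proof -
  have "(M *\<^sub>v G X) $ k = (\<Sum>j<m. M $$ (k, j) * G X $ j)" if "k < r" for X k
    using mult_mat_vec_index[OF M _ that] G by (simp add: vec_lipschitz_def)
  moreover have "M *\<^sub>v G X \<in> carrier_vec r" for X
    using M G by (auto simp: vec_lipschitz_def intro: mult_mat_vec_carrier)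
  ultimately show ?thesis using G unfolding vec_lipschitz_def
    by (auto intro!: coord_lipschitz_sum coord_lipschitz_cmult)
qed

lemma global_solution:
  fixes F :: "('i \<Rightarrow> real) \<Rightarrow> 'i \<Rightarrow> real"
  assumes fin: "finite I" and lip: "\<And>i. i \<in> I \<Longrightarrow> coord_lipschitz I (\<lambda>X. F X i)"
  obtains x :: "real \<Rightarrow> 'i \<Rightarrow> real" where
    "\<And>i. i \<in> I \<Longrightarrow> x 0 i = init i"
    "\<And>i t. i \<in> I \<Longrightarrow> 0 \<le> t \<Longrightarrow> ((\<lambda>s. x s i) has_real_derivative F (x t) i) (at t within {0..})"
proof -
  obtain K where K: "\<And>i. i \<in> I \<Longrightarrow> 0 \<le> K i"
    "\<And>i X Y. i \<in> I \<Longrightarrow> \<bar>F X i - F Y i\<bar> \<le> K i * (\<Sum>j\<in>I. \<bar>X j - Y j\<bar>)"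
    using lip unfolding coord_lipschitz_def by metis
  \<comment> \<open>Picard iteration wants one constant for all coordinates; the sum of the finitely
    many individual ones serves.\<close>
  have "\<bar>F X i - F Y i\<bar> \<le> (\<Sum>i\<in>I. K i) * (\<Sum>j\<in>I. \<bar>X j - Y j\<bar>)" if "i \<in> I" for i X Y
  proof -
    have "K i \<le> (\<Sum>i\<in>I. K i)" using that fin K(1) by (intro member_le_sum) auto
    then have "K i * (\<Sum>j\<in>I. \<bar>X j - Y j\<bar>) \<le> (\<Sum>i\<in>I. K i) * (\<Sum>j\<in>I. \<bar>X j - Y j\<bar>)"
      by (intro mult_right_mono sum_nonneg) auto
    then show ?thesis using K(2)[OF that, of X Y] by linarith
  qed
  moreover have "0 \<le> (\<Sum>i\<in>I. K i)" using K(1) by (rule sum_nonneg)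
  ultimately obtain x :: "real \<Rightarrow> 'i \<Rightarrow> real" where "\<And>i. i \<in> I \<Longrightarrow> x 0 i = init i"
    "\<And>i t. i \<in> I \<Longrightarrow> 0 \<le> t \<Longrightarrow> ((\<lambda>s. x s i) has_real_derivative F (x t) i) (at t within {0..})"
    using picard_global_solution[OF fin, of "\<Sum>i\<in>I. K i" F init] by blast
  then show thesis by (rule that)
qed

text \<open>The agents have states of different dimensions, while Picard iteration runs over one
  finite index set. Pairs of an agent and one of these tags flatten the network state into real
  coordinates.\<close>

datatype coord = Plant nat | Disturbance nat | Observer nat | Decision | Multiplier | Integrator

definition coords :: "nat \<Rightarrow> (nat \<Rightarrow> nat) \<Rightarrow> (nat \<Rightarrow> nat) \<Rightarrow> (nat \<times> coord) set" where
  "coords N n q = (SIGMA i:{1..N}. Plant ` {..<n i} \<union> Disturbance ` {..<q i} \<union> Observer ` {..<q i} \<union>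
     {Decision, Multiplier, Integrator})"

definition state_of :: "(nat \<Rightarrow> nat) \<Rightarrow> (nat \<Rightarrow> nat) \<Rightarrow> (nat \<times> coord \<Rightarrow> real) \<Rightarrow> nat \<Rightarrow> agent_state" where
  "state_of n q X i = \<lparr>plant_state = Matrix.vec (n i) (\<lambda>k. X (i, Plant k)),
     disturbance = Matrix.vec (q i) (\<lambda>k. X (i, Disturbance k)),
     observer_state = Matrix.vec (q i) (\<lambda>k. X (i, Observer k)),
     decision = X (i, Decision), multiplier = X (i, Multiplier), integrator = X (i, Integrator)\<rparr>"

definition coords_of :: "(nat \<Rightarrow> agent_state) \<Rightarrow> nat \<times> coord \<Rightarrow> real" where
  "coords_of \<sigma> = (\<lambda>(i, c). case c of
     Plant k \<Rightarrow> plant_state (\<sigma> i) $ k | Disturbance k \<Rightarrow> disturbance (\<sigma> i) $ k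
   | Observer k \<Rightarrow> observer_state (\<sigma> i) $ k | Decision \<Rightarrow> decision (\<sigma> i)
   | Multiplier \<Rightarrow> multiplier (\<sigma> i) | Integrator \<Rightarrow> integrator (\<sigma> i))"

lemma finite_coords: "finite (coords N n q)"
  by (auto simp: coords_def)

lemma state_of_coords_of:
  assumes "\<sigma> \<in> state_space N n q" "i \<in> {1..N}" "\<And>c. (i, c) \<in> coords N n q \<Longrightarrow> X (i, c) = coords_of \<sigma> (i, c)"
  shows "state_of n q X i = \<sigma> i"
proof -
  have "X (i, Plant k) = plant_state (\<sigma> i) $ k" if "k < n i" for k
    using assms(3)[of "Plant k"] assms(2) that by (simp add: coords_def coords_of_def)
  moreover have "X (i, Disturbance k) = disturbance (\<sigma> i) $ k" if "k < q i" for k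
    using assms(3)[of "Disturbance k"] assms(2) that by (simp add: coords_def coords_of_def)
  moreover have "X (i, Observer k) = observer_state (\<sigma> i) $ k" if "k < q i" for k
    using assms(3)[of "Observer k"] assms(2) that by (simp add: coords_def coords_of_def)
  moreover have "X (i, Decision) = decision (\<sigma> i)" "X (i, Multiplier) = multiplier (\<sigma> i)"
      "X (i, Integrator) = integrator (\<sigma> i)"
    using assms(3) assms(2) by (auto simp: coords_def coords_of_def)
  moreover have "plant_state (\<sigma> i) \<in> carrier_vec (n i)" "disturbance (\<sigma> i) \<in> carrier_vec (q i)"
      "observer_state (\<sigma> i) \<in> carrier_vec (q i)"
    using assms(1,2) by (auto simp: state_space_def)
  ultimately show ?thesis
    by (intro agent_state.equality) (auto simp: state_of_def intro!: eq_vecI)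
qed

lemma has_vec_derivative_vec:
  assumes "dim_vec D = m" "\<And>k. k < m \<Longrightarrow> ((\<lambda>s. x s k) has_real_derivative D $ k) (at t within T)"
  shows "has_vec_derivative (\<lambda>s. Matrix.vec m (x s)) D t T"
  using assms by (simp add: has_vec_derivative_def)

text \<open>The gradients are the only nonlinear part of the closed loop. They are Lipschitz by
  assumption, and the rest is built from matrices and the Laplacian, so the flattened vector field
  is globally Lipschitz.\<close>

lemma closed_loop_solution_exists:
  fixes \<sigma> :: "nat \<Rightarrow> agent_state"
  assumes dims: "\<And>i. i \<in> {1..N} \<Longrightarrow> A i \<in> carrier_mat (n i) (n i) \<and> B i \<in> carrier_mat (n i) 1 \<and>
      E i \<in> carrier_mat (n i) (q i) \<and> S i \<in> carrier_mat (q i) (q i) \<and> L i \<in> carrier_mat (q i) (n i) \<and>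
      K1 i \<in> carrier_mat 1 (n i) \<and> K2 i \<in> carrier_mat 1 (q i) \<and> K3 i \<in> carrier_mat 1 1"
    and lips: "\<And>i s r. i \<in> {1..N} \<Longrightarrow> \<bar>deriv (f i) s - deriv (f i) r\<bar> \<le> H i * \<bar>s - r\<bar>"
    and H: "\<And>i. i \<in> {1..N} \<Longrightarrow> 0 \<le> H i"
    and \<sigma>: "\<sigma> \<in> state_space N n q"
  shows "\<exists>\<phi>. closed_loop_solution N A B E S K1 K2 K3 L f d a \<phi> \<and> starts_at N \<sigma> \<phi>"
proof -
  let ?I = "coords N n q"
  let ?s = "state_of n q"
  define u where "u X i = control_input (K1 i) (K2 i) (K3 i) (L i) (?s X i)" for X i
  define fx where "fx X i = A i *\<^sub>v plant_state (?s X i) + B i *\<^sub>v u X i + E i *\<^sub>v disturbance (?s X i)" for X i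
  define fw where "fw X i = S i *\<^sub>v disturbance (?s X i)" for X i
  define fe where "fe X i = (S i - L i * E i) *\<^sub>v observer_state (?s X i)
      + (S i * L i - L i * E i * L i - L i * A i) *\<^sub>v plant_state (?s X i) - (L i * B i) *\<^sub>v u X i" for X i
  define F where "F X = (\<lambda>(i, c). case c of
     Plant k \<Rightarrow> fx X i $ k | Disturbance k \<Rightarrow> fw X i $ k | Observer k \<Rightarrow> fe X i $ k
   | Decision \<Rightarrow> - deriv (f i) (X (i, Decision)) + X (i, Multiplier)
   | Multiplier \<Rightarrow> - network_diff N a (\<lambda>j. X (j, Multiplier)) i
        - network_diff N a (\<lambda>j. X (j, Integrator)) i + d i - X (i, Decision)
   | Integrator \<Rightarrow> network_diff N a (\<lambda>j. X (j, Multiplier)) i)" for X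
  have coord: "coord_lipschitz ?I (\<lambda>X. X c)" if "c \<in> ?I" for c
    using finite_coords that by (rule coord_lipschitz_coord)
  have in_coords: "(i, Decision) \<in> ?I" "(i, Multiplier) \<in> ?I" "(i, Integrator) \<in> ?I" if "i \<in> {1..N}" for i
    using that by (auto simp: coords_def)
  have net: "coord_lipschitz ?I (\<lambda>X. network_diff N a (\<lambda>j. X (j, c)) i)"
    if "c \<in> {Multiplier, Integrator}" "i \<in> {1..N}" for c i
    unfolding network_diff_def
    using that by (intro coord_lipschitz_sum coord_lipschitz_cmult coord_lipschitz_diff coord) (auto simp: coords_def)
  have vec_coords: "k < n i \<Longrightarrow> (i, Plant k) \<in> ?I" "k < q i \<Longrightarrow> (i, Disturbance k) \<in> ?I"
      "k < q i \<Longrightarrow> (i, Observer k) \<in> ?I" if "i \<in> {1..N}" for i k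
    using that by (auto simp: coords_def)
  have lx: "vec_lipschitz ?I (n i) (\<lambda>X. plant_state (?s X i))"
    and lw: "vec_lipschitz ?I (q i) (\<lambda>X. disturbance (?s X i))"
    and le: "vec_lipschitz ?I (q i) (\<lambda>X. observer_state (?s X i))"
    and lz: "vec_lipschitz ?I 1 (\<lambda>X. Matrix.vec 1 (\<lambda>_. decision (?s X i)))" if "i \<in> {1..N}" for i
    unfolding state_of_def agent_state.simps
    by (intro vec_lipschitz_vec coord vec_coords in_coords that; assumption)+
  have dim: "A i \<in> carrier_mat (n i) (n i)" "B i \<in> carrier_mat (n i) 1" "E i \<in> carrier_mat (n i) (q i)"
    "S i \<in> carrier_mat (q i) (q i)" "L i \<in> carrier_mat (q i) (n i)"
    "K1 i \<in> carrier_mat 1 (n i)" "K2 i \<in> carrier_mat 1 (q i)" "K3 i \<in> carrier_mat 1 1" if "i \<in> {1..N}" for i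
    using dims[OF that] by auto
  have lu: "vec_lipschitz ?I 1 (\<lambda>X. u X i)" if "i \<in> {1..N}" for i
    unfolding u_def control_input_def
    by (intro vec_lipschitz_add dim[OF that, THEN vec_lipschitz_mult_mat_vec] lx[OF that] le[OF that] lz[OF that])
  have lfx: "vec_lipschitz ?I (n i) (\<lambda>X. fx X i)" if "i \<in> {1..N}" for i
    unfolding fx_def
    by (intro vec_lipschitz_add dim[OF that, THEN vec_lipschitz_mult_mat_vec] lx[OF that] lu[OF that] lw[OF that])
  have lfw: "vec_lipschitz ?I (q i) (\<lambda>X. fw X i)" if "i \<in> {1..N}" for i
    unfolding fw_def by (intro dim[OF that, THEN vec_lipschitz_mult_mat_vec] lw[OF that])
  have lfe: "vec_lipschitz ?I (q i) (\<lambda>X. fe X i)" if i: "i \<in> {1..N}" for i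
  proof -
    have "S i - L i * E i \<in> carrier_mat (q i) (q i)" "L i * B i \<in> carrier_mat (q i) 1"
        "S i * L i - L i * E i * L i - L i * A i \<in> carrier_mat (q i) (n i)"
      using dims[OF i] by auto
    note mult = this[THEN vec_lipschitz_mult_mat_vec]
    show ?thesis unfolding fe_def
      by (intro vec_lipschitz_add vec_lipschitz_diff mult lx[OF i] le[OF i] lu[OF i])
  qed
  have lip: "coord_lipschitz ?I (\<lambda>X. F X c)" if c: "c \<in> ?I" for c
  proof -
    obtain i c' where ic: "c = (i, c')" "i \<in> {1..N}" using c by (auto simp: coords_def)
    show ?thesis
    proof (cases c')
      case (Plant k)
      then show ?thesis using c ic lfx[OF ic(2)] by (auto simp: F_def coords_def vec_lipschitz_def)
    next
      case (Disturbance k)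
      then show ?thesis using c ic lfw[OF ic(2)] by (auto simp: F_def coords_def vec_lipschitz_def)
    next
      case (Observer k)
      then show ?thesis using c ic lfe[OF ic(2)] by (auto simp: F_def coords_def vec_lipschitz_def)
    next
      case Decision
      have "coord_lipschitz ?I (\<lambda>X. - deriv (f i) (X (i, Decision)) + X (i, Multiplier))"
        by (intro coord_lipschitz_add coord_lipschitz_uminus
            coord_lipschitz_lipschitz_comp[OF _ lips[OF ic(2)] H[OF ic(2)]] coord in_coords ic(2))
      then show ?thesis using ic Decision by (simp add: F_def)
    next
      case Multiplier
      have "coord_lipschitz ?I (\<lambda>X. - network_diff N a (\<lambda>j. X (j, Multiplier)) i
        - network_diff N a (\<lambda>j. X (j, Integrator)) i + d i - X (i, Decision))"
        using ic by (intro coord_lipschitz_add coord_lipschitz_diff coord_lipschitz_uminus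
            coord_lipschitz_const coord in_coords net) auto
      then show ?thesis using ic Multiplier by (simp add: F_def)
    next
      case Integrator
      then show ?thesis using ic net[of "coord.Multiplier" i] by (simp add: F_def)
    qed
  qed
  obtain x where x0: "\<And>c. c \<in> ?I \<Longrightarrow> x 0 c = coords_of \<sigma> c"
    and x: "\<And>c t. c \<in> ?I \<Longrightarrow> 0 \<le> t \<Longrightarrow> ((\<lambda>s. x s c) has_real_derivative F (x t) c) (at t within {0..})"
    using global_solution[OF finite_coords, where F = F and init = "coords_of \<sigma>"] lip by blast
  define \<phi> where "\<phi> t = ?s (x t)" for t
  have "starts_at N \<sigma> \<phi>"
    unfolding starts_at_def \<phi>_def using state_of_coords_of[OF \<sigma>] x0 by blast
  moreover have "closed_loop_solution N A B E S K1 K2 K3 L f d a \<phi>"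
    unfolding closed_loop_solution_def Let_def
  proof (intro ballI allI impI conjI)
    fix i t assume i: "i \<in> {1..N}" and t: "(0::real) \<le> t"
    have fx: "fx (x t) i \<in> carrier_vec (n i)" and fw: "fw (x t) i \<in> carrier_vec (q i)"
      and fe: "fe (x t) i \<in> carrier_vec (q i)"
      using lfx[OF i] lfw[OF i] lfe[OF i] by (auto simp: vec_lipschitz_def)
    have "has_vec_derivative (\<lambda>s. Matrix.vec (n i) (\<lambda>k. x s (i, Plant k))) (fx (x t) i) t {0..}"
      using x[OF vec_coords(1)[OF i] t] fx by (intro has_vec_derivative_vec) (auto simp: F_def)
    then show "has_vec_derivative (\<lambda>s. plant_state (\<phi> s i)) (A i *\<^sub>v plant_state (\<phi> t i)
        + B i *\<^sub>v control_input (K1 i) (K2 i) (K3 i) (L i) (\<phi> t i) + E i *\<^sub>v disturbance (\<phi> t i)) t {0..}"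
      by (simp add: \<phi>_def fx_def u_def state_of_def)
    have "has_vec_derivative (\<lambda>s. Matrix.vec (q i) (\<lambda>k. x s (i, Disturbance k))) (fw (x t) i) t {0..}"
      using x[OF vec_coords(2)[OF i] t] fw by (intro has_vec_derivative_vec) (auto simp: F_def)
    then show "has_vec_derivative (\<lambda>s. disturbance (\<phi> s i)) (S i *\<^sub>v disturbance (\<phi> t i)) t {0..}"
      by (simp add: \<phi>_def fw_def state_of_def)
    have "has_vec_derivative (\<lambda>s. Matrix.vec (q i) (\<lambda>k. x s (i, Observer k))) (fe (x t) i) t {0..}"
      using x[OF vec_coords(3)[OF i] t] fe by (intro has_vec_derivative_vec) (auto simp: F_def)
    then show "has_vec_derivative (\<lambda>s. observer_state (\<phi> s i)) ((S i - L i * E i) *\<^sub>v observer_state (\<phi> t i)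
        + (S i * L i - L i * E i * L i - L i * A i) *\<^sub>v plant_state (\<phi> t i)
        - (L i * B i) *\<^sub>v control_input (K1 i) (K2 i) (K3 i) (L i) (\<phi> t i)) t {0..}"
      by (simp add: \<phi>_def fe_def u_def state_of_def)
    show "((\<lambda>s. decision (\<phi> s i)) has_real_derivative
        - deriv (f i) (decision (\<phi> t i)) + multiplier (\<phi> t i)) (at t within {0..})"
      using x[OF in_coords(1)[OF i] t] by (simp add: \<phi>_def state_of_def F_def)
    show "((\<lambda>s. multiplier (\<phi> s i)) has_real_derivative
        - network_diff N a (\<lambda>j. multiplier (\<phi> t j)) i - network_diff N a (\<lambda>j. integrator (\<phi> t j)) i
        + d i - decision (\<phi> t i)) (at t within {0..})"
      using x[OF in_coords(2)[OF i] t] by (simp add: \<phi>_def state_of_def F_def)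
    show "((\<lambda>s. integrator (\<phi> s i)) has_real_derivative
        network_diff N a (\<lambda>j. multiplier (\<phi> t j)) i) (at t within {0..})"
      using x[OF in_coords(3)[OF i] t] by (simp add: \<phi>_def state_of_def F_def)
  qed
  ultimately show ?thesis by blast
qed

subsection \<open>Output regulation of one agent\<close>

lemma has_vec_derivative_carrier:
  assumes "has_vec_derivative x D t T" "D \<in> carrier_vec m" "s \<in> T"
  shows "x s \<in> carrier_vec m"
  using assms by (metis has_vec_derivative_def carrier_vecD carrier_vecI)

text \<open>The dimension of \<open>x s\<close> is known only for \<open>s\<close> in
  \<open>T\<close>, so formulas for the components of sums and products hold only there. The
  derivative is therefore computed for \<open>X k\<close> and transferred within
  \<open>T\<close>.\<close>

lemma has_vec_derivative_transform:
  assumes "\<And>s. s \<in> T \<Longrightarrow> x s \<in> carrier_vec m" "D \<in> carrier_vec m" "t \<in> T"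
    and "\<And>k. k < m \<Longrightarrow> (X k has_real_derivative D $ k) (at t within T)"
    and "\<And>s k. s \<in> T \<Longrightarrow> k < m \<Longrightarrow> X k s = x s $ k"
  shows "has_vec_derivative x D t T"
  unfolding has_vec_derivative_def
proof (intro conjI ballI allI impI)
  show "dim_vec (x s) = dim_vec D" if "s \<in> T" for s using assms(1)[OF that] assms(2) by simp
  fix k assume "k < dim_vec D"
  then have k: "k < m" using assms(2) by simp
  show "((\<lambda>s. x s $ k) has_real_derivative D $ k) (at t within T)"
    by (rule has_field_derivative_transform_within[OF assms(4)[OF k], where d = 1])
      (use assms(3,5) k in auto)
qed

lemma has_vec_derivative_component:
  assumes "has_vec_derivative x D t T" "D \<in> carrier_vec m" "k < m"
  shows "((\<lambda>s. x s $ k) has_real_derivative D $ k) (at t within T)"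
  using assms by (auto simp: has_vec_derivative_def)

lemma has_vec_derivative_add:
  assumes x: "has_vec_derivative x D t T" "D \<in> carrier_vec m"
    and y: "has_vec_derivative y D' t T" "D' \<in> carrier_vec m" and t: "t \<in> T"
  shows "has_vec_derivative (\<lambda>s. x s + y s) (D + D') t T"
proof (rule has_vec_derivative_transform[OF _ _ t, where X = "\<lambda>k s. x s $ k + y s $ k"])
  show "x s + y s \<in> carrier_vec m" if "s \<in> T" for s
    using has_vec_derivative_carrier[OF x that] has_vec_derivative_carrier[OF y that] by simp
  show "D + D' \<in> carrier_vec m" using x y by simp
  show "((\<lambda>s. x s $ k + y s $ k) has_real_derivative (D + D') $ k) (at t within T)" if "k < m" for k
    using DERIV_add[OF has_vec_derivative_component[OF x that] has_vec_derivative_component[OF y that]] x y that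
    by simp
  show "x s $ k + y s $ k = (x s + y s) $ k" if "s \<in> T" "k < m" for s k
    using has_vec_derivative_carrier[OF x that(1)] has_vec_derivative_carrier[OF y that(1)] that by simp
qed

lemma has_vec_derivative_diff:
  assumes x: "has_vec_derivative x D t T" "D \<in> carrier_vec m"
    and y: "has_vec_derivative y D' t T" "D' \<in> carrier_vec m" and t: "t \<in> T"
  shows "has_vec_derivative (\<lambda>s. x s - y s) (D - D') t T"
proof (rule has_vec_derivative_transform[OF _ _ t, where X = "\<lambda>k s. x s $ k - y s $ k"])
  show "x s - y s \<in> carrier_vec m" if "s \<in> T" for s
    using has_vec_derivative_carrier[OF x that] has_vec_derivative_carrier[OF y that] by simp
  show "D - D' \<in> carrier_vec m" using x y by simp
  show "((\<lambda>s. x s $ k - y s $ k) has_real_derivative (D - D') $ k) (at t within T)" if "k < m" for k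
    using DERIV_diff[OF has_vec_derivative_component[OF x that] has_vec_derivative_component[OF y that]] x y that
    by simp
  show "x s $ k - y s $ k = (x s - y s) $ k" if "s \<in> T" "k < m" for s k
    using has_vec_derivative_carrier[OF x that(1)] has_vec_derivative_carrier[OF y that(1)] that by simp
qed

lemma has_vec_derivative_mult_mat_vec:
  assumes M: "M \<in> carrier_mat r m" and x: "has_vec_derivative x D t T" "D \<in> carrier_vec m" and t: "t \<in> T"
  shows "has_vec_derivative (\<lambda>s. M *\<^sub>v x s) (M *\<^sub>v D) t T"
proof (rule has_vec_derivative_transform[OF _ _ t, where X = "\<lambda>k s. \<Sum>j<m. M $$ (k, j) * x s $ j"])
  show "M *\<^sub>v x s \<in> carrier_vec r" if "s \<in> T" for s
    using has_vec_derivative_carrier[OF x that] M by simp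
  show "M *\<^sub>v D \<in> carrier_vec r" using M x by simp
  show "((\<lambda>s. \<Sum>j<m. M $$ (k, j) * x s $ j) has_real_derivative (M *\<^sub>v D) $ k) (at t within T)" if "k < r" for k
    unfolding mult_mat_vec_index[OF M x(2) that]
    by (intro DERIV_sum DERIV_cmult has_vec_derivative_component[OF x]) auto
  show "(\<Sum>j<m. M $$ (k, j) * x s $ j) = (M *\<^sub>v x s) $ k" if "s \<in> T" "k < r" for s k
    using mult_mat_vec_index[OF M has_vec_derivative_carrier[OF x that(1)] that(2)] by simp
qed

lemma mult_mat_vec_bound:
  assumes M: "M \<in> carrier_mat r m" and v: "v \<in> carrier_vec m" and k: "k < r"
    and b: "\<And>j. j < m \<Longrightarrow> \<bar>v $ j\<bar> \<le> (b :: real)" and b0: "0 \<le> b"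
  shows "\<bar>(M *\<^sub>v v) $ k\<bar> \<le> (\<Sum>k<r. \<Sum>j<m. \<bar>M $$ (k, j)\<bar>) * b"
proof -
  have "\<bar>(M *\<^sub>v v) $ k\<bar> \<le> (\<Sum>j<m. \<bar>M $$ (k, j)\<bar> * b)"
    unfolding mult_mat_vec_index[OF M v k]
    using b by (intro order.trans[OF sum_abs] sum_mono) (auto simp: abs_mult intro!: mult_left_mono)
  also have "\<dots> = (\<Sum>j<m. \<bar>M $$ (k, j)\<bar>) * b" by (simp add: sum_distrib_right)
  also have "\<dots> \<le> (\<Sum>k<r. \<Sum>j<m. \<bar>M $$ (k, j)\<bar>) * b"
    using k b0 by (intro mult_right_mono member_le_sum[of k "{..<r}" "\<lambda>k. \<Sum>j<m. \<bar>M $$ (k, j)\<bar>"])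
      (auto intro: sum_nonneg)
  finally show ?thesis .
qed

section \<open>Error systems of a single agent\<close>

locale regulated_agent =
  fixes n q :: nat and A B C E S X1 X2 U1 U2 K1 K2 K3 L :: "real mat"
  assumes dims: "A \<in> carrier_mat n n" "B \<in> carrier_mat n 1" "C \<in> carrier_mat 1 n"
      "E \<in> carrier_mat n q" "S \<in> carrier_mat q q" "X1 \<in> carrier_mat n q" "X2 \<in> carrier_mat n 1"
      "U1 \<in> carrier_mat 1 q" "U2 \<in> carrier_mat 1 1" "K1 \<in> carrier_mat 1 n" "L \<in> carrier_mat q n"
    and reg1: "X1 * S = A * X1 + B * U1 + E" "0\<^sub>m 1 q = C * X1"
    and reg2: "0\<^sub>m n 1 = A * X2 + B * U2" "1\<^sub>m 1 = C * X2"
    and gains: "K2 = U1 - K1 * X1" "K3 = U2 - K1 * X2"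
    and hurwitz_plant: "hurwitz (A + B * K1)" and hurwitz_observer: "hurwitz (S - L * E)"
begin

lemma gain_dims: "K2 \<in> carrier_mat 1 q" "K3 \<in> carrier_mat 1 1"
  using dims by (auto simp: gains)

text \<open>The controller reconstructs the disturbance as \<open>e + L *\<^sub>v x\<close>, the
  quantity called eta in the problem.\<close>

definition est_err :: "real Matrix.vec \<Rightarrow> real Matrix.vec \<Rightarrow> real Matrix.vec \<Rightarrow> real Matrix.vec" where
  "est_err x w e = e + L *\<^sub>v x - w"

text \<open>The regulator equations make \<^term>\<open>X1 *\<^sub>v w\<close> plus \<^term>\<open>X2\<close> applied to a constant decision an
  invariant manifold of the plant; \<open>track_err\<close> is the distance of the state to it.\<close>

definition track_err :: "real Matrix.vec \<Rightarrow> real Matrix.vec \<Rightarrow> real \<Rightarrow> real Matrix.vec" where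
  "track_err x w z = x - X1 *\<^sub>v w - X2 *\<^sub>v Matrix.vec 1 (\<lambda>_. z)"

text \<open>\<open>control_input\<close> freed from the state record, so that the matrix identities
  can be stated for plain vectors.\<close>

definition input :: "real Matrix.vec \<Rightarrow> real Matrix.vec \<Rightarrow> real \<Rightarrow> real Matrix.vec" where
  "input x e z = K1 *\<^sub>v x + K2 *\<^sub>v (e + L *\<^sub>v x) + K3 *\<^sub>v Matrix.vec 1 (\<lambda>_. z)"

text \<open>The observer is designed so that its terms in \<open>A\<close> and \<open>B\<close>
  cancel those of L x'. What remains applies \<open>S - L * E\<close> to \<open>e\<close>, to
  \<open>L *\<^sub>v x\<close> and, with a minus sign, to \<open>w\<close>. The error is thus
  autonomous for any input \<open>u\<close>.\<close>

lemma est_err_dynamics: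
  assumes x: "x \<in> carrier_vec n" and w: "w \<in> carrier_vec q" and e: "e \<in> carrier_vec q" and u: "u \<in> carrier_vec 1"
  shows "(S - L * E) *\<^sub>v e + (S * L - L * E * L - L * A) *\<^sub>v x - (L * B) *\<^sub>v u
      + L *\<^sub>v (A *\<^sub>v x + B *\<^sub>v u + E *\<^sub>v w) - S *\<^sub>v w = (S - L * E) *\<^sub>v est_err x w e"
proof -
  note d = dims
  have 1: "(S - L * E) *\<^sub>v y = S *\<^sub>v y - L *\<^sub>v (E *\<^sub>v y)" if "y \<in> carrier_vec q" for y
    using d that by (simp add: minus_mult_distrib_mat_vec[of _ q q] assoc_mult_mat_vec[of _ q n _ q])
  have 2: "(S * L - L * E * L - L * A) *\<^sub>v x
      = S *\<^sub>v (L *\<^sub>v x) - L *\<^sub>v (E *\<^sub>v (L *\<^sub>v x)) - L *\<^sub>v (A *\<^sub>v x)"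
  proof -
    have "(S * L - L * E * L - L * A) *\<^sub>v x = (S * L) *\<^sub>v x - (L * E * L) *\<^sub>v x - (L * A) *\<^sub>v x"
    proof -
      have "(S * L - L * E * L - L * A) *\<^sub>v x = (S * L - L * E * L) *\<^sub>v x - (L * A) *\<^sub>v x"
        by (rule minus_mult_distrib_mat_vec[of _ q n]) (use d x in auto)
      also have "(S * L - L * E * L) *\<^sub>v x = (S * L) *\<^sub>v x - (L * E * L) *\<^sub>v x"
        by (rule minus_mult_distrib_mat_vec[of _ q n]) (use d x in auto)
      finally show ?thesis .
    qed
    also have "(S * L) *\<^sub>v x = S *\<^sub>v (L *\<^sub>v x)" by (rule assoc_mult_mat_vec) (use d x in auto)
    also have "(L * E * L) *\<^sub>v x = (L * E) *\<^sub>v (L *\<^sub>v x)" by (rule assoc_mult_mat_vec[of _ q q _ n]) (use d x in auto)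
    also have "\<dots> = L *\<^sub>v (E *\<^sub>v (L *\<^sub>v x))" by (rule assoc_mult_mat_vec[of _ q n _ q]) (use d x in auto)
    also have "(L * A) *\<^sub>v x = L *\<^sub>v (A *\<^sub>v x)" by (rule assoc_mult_mat_vec[of _ q n _ n]) (use d x in auto)
    finally show ?thesis .
  qed
  have 3: "(L * B) *\<^sub>v u = L *\<^sub>v (B *\<^sub>v u)" by (rule assoc_mult_mat_vec) (use d u in auto)
  have 4: "L *\<^sub>v (A *\<^sub>v x + B *\<^sub>v u + E *\<^sub>v w) = L *\<^sub>v (A *\<^sub>v x) + L *\<^sub>v (B *\<^sub>v u) + L *\<^sub>v (E *\<^sub>v w)"
    using d x u w by (simp add: mult_add_distrib_mat_vec[of _ q n])
  have 5: "S *\<^sub>v est_err x w e = S *\<^sub>v e + S *\<^sub>v (L *\<^sub>v x) - S *\<^sub>v w"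
    using d x w e by (simp add: est_err_def mult_minus_distrib_mat_vec[of _ q q] mult_add_distrib_mat_vec[of _ q q])
  have 6: "L *\<^sub>v (E *\<^sub>v est_err x w e) = L *\<^sub>v (E *\<^sub>v e) + L *\<^sub>v (E *\<^sub>v (L *\<^sub>v x)) - L *\<^sub>v (E *\<^sub>v w)"
    using d x w e by (simp add: est_err_def mult_minus_distrib_mat_vec[of _ n q] mult_add_distrib_mat_vec[of _ n q]
        mult_minus_distrib_mat_vec[of _ q n] mult_add_distrib_mat_vec[of _ q n])
  have c: "est_err x w e \<in> carrier_vec q" using d x w e by (simp add: est_err_def)
  show ?thesis
    unfolding 1[OF e] 1[OF c] 2 3 4 5 6
  proof (rule eq_vecI)
    fix k assume "k < dim_vec (S *\<^sub>v e + S *\<^sub>v (L *\<^sub>v x) - S *\<^sub>v w - (L *\<^sub>v (E *\<^sub>v e)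
        + L *\<^sub>v (E *\<^sub>v (L *\<^sub>v x)) - L *\<^sub>v (E *\<^sub>v w)))"
    then have "k < q" using d by simp
    then show "(S *\<^sub>v e - L *\<^sub>v (E *\<^sub>v e) + (S *\<^sub>v (L *\<^sub>v x) - L *\<^sub>v (E *\<^sub>v (L *\<^sub>v x)) - L *\<^sub>v (A *\<^sub>v x))
        - L *\<^sub>v (B *\<^sub>v u) + (L *\<^sub>v (A *\<^sub>v x) + L *\<^sub>v (B *\<^sub>v u) + L *\<^sub>v (E *\<^sub>v w)) - S *\<^sub>v w) $ k
      = (S *\<^sub>v e + S *\<^sub>v (L *\<^sub>v x) - S *\<^sub>v w - (L *\<^sub>v (E *\<^sub>v e)
        + L *\<^sub>v (E *\<^sub>v (L *\<^sub>v x)) - L *\<^sub>v (E *\<^sub>v w))) $ k"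
      \<comment> \<open>Only additive cancellation is left. The deletion keeps the products as atoms
        instead of unfolding them into scalar products.\<close>
      using d by (simp del: index_mult_mat_vec)
  qed (use d in simp)
qed

text \<open>By the choice of \<open>K2\<close> and \<open>K3\<close> the input equals K1 xi + U1 w +
  U2 z + K2 epsilon, with xi the tracking and epsilon the estimation error. The regulator equations
  then absorb the parts in \<open>w\<close> and \<open>z\<close>, leaving the estimation error and
  the motion of \<open>z\<close> as forcing.\<close>

lemma track_err_dynamics:
  assumes x: "x \<in> carrier_vec n" and w: "w \<in> carrier_vec q" and e: "e \<in> carrier_vec q"
  shows "A *\<^sub>v x + B *\<^sub>v input x e z + E *\<^sub>v w - X1 *\<^sub>v (S *\<^sub>v w) - X2 *\<^sub>v Matrix.vec 1 (\<lambda>_. z')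
    = (A + B * K1) *\<^sub>v track_err x w z + (B *\<^sub>v (K2 *\<^sub>v est_err x w e) - X2 *\<^sub>v Matrix.vec 1 (\<lambda>_. z'))"
proof -
  note d = dims gain_dims
  define zv where "zv = Matrix.vec 1 (\<lambda>_. z)"
  define zd where "zd = Matrix.vec 1 (\<lambda>_. z')"
  define \<epsilon> where "\<epsilon> = est_err x w e"
  define \<eta> where "\<eta> = e + L *\<^sub>v x"
  have zv: "zv \<in> carrier_vec 1" and zd: "zd \<in> carrier_vec 1" by (auto simp: zv_def zd_def)
  have \<epsilon>: "\<epsilon> \<in> carrier_vec q" and \<eta>: "\<eta> \<in> carrier_vec q" using d x w e by (auto simp: \<epsilon>_def \<eta>_def est_err_def)
  have \<epsilon>\<eta>: "\<epsilon> = \<eta> - w" by (simp add: \<epsilon>_def \<eta>_def est_err_def)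
  have K2\<epsilon>: "K2 *\<^sub>v \<epsilon> = K2 *\<^sub>v \<eta> - K2 *\<^sub>v w" unfolding \<epsilon>\<eta> by (rule mult_minus_distrib_mat_vec) (use d \<eta> w in auto)
  have K2w: "K2 *\<^sub>v w = U1 *\<^sub>v w - K1 *\<^sub>v (X1 *\<^sub>v w)"
    using d w by (simp add: gains minus_mult_distrib_mat_vec[of _ 1 q] assoc_mult_mat_vec[of _ 1 n _ q])
  have K3z: "K3 *\<^sub>v zv = U2 *\<^sub>v zv - K1 *\<^sub>v (X2 *\<^sub>v zv)"
    using d zv by (simp add: gains minus_mult_distrib_mat_vec[of _ 1 1] assoc_mult_mat_vec[of _ 1 n _ 1])
  have c1: "K1 *\<^sub>v x \<in> carrier_vec 1" "K2 *\<^sub>v \<eta> \<in> carrier_vec 1" "K3 *\<^sub>v zv \<in> carrier_vec 1"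
    "K2 *\<^sub>v w \<in> carrier_vec 1" "U1 *\<^sub>v w \<in> carrier_vec 1" "K1 *\<^sub>v (X1 *\<^sub>v w) \<in> carrier_vec 1"
    "U2 *\<^sub>v zv \<in> carrier_vec 1" "K1 *\<^sub>v (X2 *\<^sub>v zv) \<in> carrier_vec 1"
    "X1 *\<^sub>v w \<in> carrier_vec n" "X2 *\<^sub>v zv \<in> carrier_vec n"
    using d x w \<eta> zv by auto
  have Bu: "B *\<^sub>v input x e z = B *\<^sub>v (K1 *\<^sub>v x) + B *\<^sub>v (K2 *\<^sub>v \<eta>)
      + (B *\<^sub>v (U2 *\<^sub>v zv) - B *\<^sub>v (K1 *\<^sub>v (X2 *\<^sub>v zv)))"
  proof -
    have "B *\<^sub>v input x e z = B *\<^sub>v (K1 *\<^sub>v x + K2 *\<^sub>v \<eta>) + B *\<^sub>v (U2 *\<^sub>v zv - K1 *\<^sub>v (X2 *\<^sub>v zv))"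
      unfolding input_def zv_def[symmetric] \<eta>_def[symmetric] K3z
      by (rule mult_add_distrib_mat_vec[OF d(2)]) (use c1 in auto)
    also have "B *\<^sub>v (K1 *\<^sub>v x + K2 *\<^sub>v \<eta>) = B *\<^sub>v (K1 *\<^sub>v x) + B *\<^sub>v (K2 *\<^sub>v \<eta>)"
      by (rule mult_add_distrib_mat_vec[OF d(2)]) (use c1 in auto)
    also have "B *\<^sub>v (U2 *\<^sub>v zv - K1 *\<^sub>v (X2 *\<^sub>v zv)) = B *\<^sub>v (U2 *\<^sub>v zv) - B *\<^sub>v (K1 *\<^sub>v (X2 *\<^sub>v zv))"
      by (rule mult_minus_distrib_mat_vec[OF d(2)]) (use c1 in auto)
    finally show ?thesis .
  qed
  have BK2: "B *\<^sub>v (K2 *\<^sub>v \<epsilon>) = B *\<^sub>v (K2 *\<^sub>v \<eta>) - (B *\<^sub>v (U1 *\<^sub>v w) - B *\<^sub>v (K1 *\<^sub>v (X1 *\<^sub>v w)))"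
    unfolding K2\<epsilon> K2w using c1 d(2) by (simp add: mult_minus_distrib_mat_vec[of _ n 1])
  have XS: "X1 *\<^sub>v (S *\<^sub>v w) = A *\<^sub>v (X1 *\<^sub>v w) + B *\<^sub>v (U1 *\<^sub>v w) + E *\<^sub>v w"
  proof -
    have "X1 *\<^sub>v (S *\<^sub>v w) = (X1 * S) *\<^sub>v w" by (rule assoc_mult_mat_vec[symmetric]) (use d w in auto)
    also have "\<dots> = (A * X1) *\<^sub>v w + (B * U1) *\<^sub>v w + E *\<^sub>v w"
      unfolding reg1 using d w by (simp add: add_mult_distrib_mat_vec[of _ n q])
    also have "(A * X1) *\<^sub>v w = A *\<^sub>v (X1 *\<^sub>v w)" by (rule assoc_mult_mat_vec) (use d w in auto)
    also have "(B * U1) *\<^sub>v w = B *\<^sub>v (U1 *\<^sub>v w)" by (rule assoc_mult_mat_vec) (use d w in auto)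
    finally show ?thesis .
  qed
  have reg2z: "A *\<^sub>v (X2 *\<^sub>v zv) + B *\<^sub>v (U2 *\<^sub>v zv) = 0\<^sub>v n"
  proof -
    have "A *\<^sub>v (X2 *\<^sub>v zv) = (A * X2) *\<^sub>v zv" by (rule assoc_mult_mat_vec[symmetric]) (use d zv in auto)
    moreover have "B *\<^sub>v (U2 *\<^sub>v zv) = (B * U2) *\<^sub>v zv" by (rule assoc_mult_mat_vec[symmetric]) (use d zv in auto)
    ultimately have "A *\<^sub>v (X2 *\<^sub>v zv) + B *\<^sub>v (U2 *\<^sub>v zv) = (A * X2 + B * U2) *\<^sub>v zv"
      using d zv by (simp add: add_mult_distrib_mat_vec[of _ n 1])
    also have "\<dots> = 0\<^sub>v n" unfolding reg2(1)[symmetric] using zv by auto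
    finally show ?thesis .
  qed
  have t: "track_err x w z = x - X1 *\<^sub>v w - X2 *\<^sub>v zv" by (simp add: track_err_def zv_def)
  have At: "A *\<^sub>v track_err x w z = A *\<^sub>v x - A *\<^sub>v (X1 *\<^sub>v w) - A *\<^sub>v (X2 *\<^sub>v zv)"
    unfolding t using d(1) x c1 by (simp add: mult_minus_distrib_mat_vec[of _ n n])
  have "K1 *\<^sub>v track_err x w z = K1 *\<^sub>v x - K1 *\<^sub>v (X1 *\<^sub>v w) - K1 *\<^sub>v (X2 *\<^sub>v zv)"
    unfolding t using d(10) x c1 by (simp add: mult_minus_distrib_mat_vec[of _ 1 n])
  then have Kt: "B *\<^sub>v (K1 *\<^sub>v track_err x w z)
      = B *\<^sub>v (K1 *\<^sub>v x) - B *\<^sub>v (K1 *\<^sub>v (X1 *\<^sub>v w)) - B *\<^sub>v (K1 *\<^sub>v (X2 *\<^sub>v zv))"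
    using d(2) c1 by (simp add: mult_minus_distrib_mat_vec[of _ n 1])
  have tc: "track_err x w z \<in> carrier_vec n" unfolding t using x c1 by simp
  have ABK: "(A + B * K1) *\<^sub>v track_err x w z = A *\<^sub>v track_err x w z + B *\<^sub>v (K1 *\<^sub>v track_err x w z)"
    using d tc by (simp add: add_mult_distrib_mat_vec[of _ n n] assoc_mult_mat_vec[of _ n 1 _ n])
  show ?thesis
    unfolding ABK At Kt zd_def[symmetric] \<epsilon>_def[symmetric] Bu BK2 XS
  proof (rule eq_vecI)
    fix k assume "k < dim_vec (A *\<^sub>v x - A *\<^sub>v (X1 *\<^sub>v w) - A *\<^sub>v (X2 *\<^sub>v zv)
      + (B *\<^sub>v (K1 *\<^sub>v x) - B *\<^sub>v (K1 *\<^sub>v (X1 *\<^sub>v w)) - B *\<^sub>v (K1 *\<^sub>v (X2 *\<^sub>v zv)))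
      + (B *\<^sub>v (K2 *\<^sub>v \<eta>) - (B *\<^sub>v (U1 *\<^sub>v w) - B *\<^sub>v (K1 *\<^sub>v (X1 *\<^sub>v w))) - X2 *\<^sub>v zd))"
    then have k: "k < n" using d by simp
    have "(A *\<^sub>v (X2 *\<^sub>v zv) + B *\<^sub>v (U2 *\<^sub>v zv)) $ k = 0" unfolding reg2z using k by simp
    then have "(A *\<^sub>v (X2 *\<^sub>v zv)) $ k = - ((B *\<^sub>v (U2 *\<^sub>v zv)) $ k)" using d k by (simp del: index_mult_mat_vec)
    then show "(A *\<^sub>v x + (B *\<^sub>v (K1 *\<^sub>v x) + B *\<^sub>v (K2 *\<^sub>v \<eta>)
        + (B *\<^sub>v (U2 *\<^sub>v zv) - B *\<^sub>v (K1 *\<^sub>v (X2 *\<^sub>v zv)))) + E *\<^sub>v w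
        - (A *\<^sub>v (X1 *\<^sub>v w) + B *\<^sub>v (U1 *\<^sub>v w) + E *\<^sub>v w) - X2 *\<^sub>v zd) $ k
      = (A *\<^sub>v x - A *\<^sub>v (X1 *\<^sub>v w) - A *\<^sub>v (X2 *\<^sub>v zv)
      + (B *\<^sub>v (K1 *\<^sub>v x) - B *\<^sub>v (K1 *\<^sub>v (X1 *\<^sub>v w)) - B *\<^sub>v (K1 *\<^sub>v (X2 *\<^sub>v zv)))
      + (B *\<^sub>v (K2 *\<^sub>v \<eta>) - (B *\<^sub>v (U1 *\<^sub>v w) - B *\<^sub>v (K1 *\<^sub>v (X1 *\<^sub>v w))) - X2 *\<^sub>v zd)) $ k"
      using d k by (simp del: index_mult_mat_vec)
  qed (use d in simp)
qed

text \<open>The output regulator equations say that \<open>X1\<close> is invisible in the output and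
  that \<open>X2\<close> passes the decision through with gain 1.\<close>

lemma output_eq:
  assumes x: "x \<in> carrier_vec n" and w: "w \<in> carrier_vec q"
  shows "(C *\<^sub>v x) $ 0 = (C *\<^sub>v track_err x w z) $ 0 + z"
proof -
  note d = dims
  define zv where "zv = Matrix.vec 1 (\<lambda>_. z)"
  have zv: "zv \<in> carrier_vec 1" by (auto simp: zv_def)
  have "C *\<^sub>v (X1 *\<^sub>v w) = (C * X1) *\<^sub>v w" by (rule assoc_mult_mat_vec[symmetric]) (use d w in auto)
  then have 1: "(C *\<^sub>v (X1 *\<^sub>v w)) $ 0 = 0" unfolding reg1(2)[symmetric] using w by simp
  have "C *\<^sub>v (X2 *\<^sub>v zv) = (C * X2) *\<^sub>v zv" by (rule assoc_mult_mat_vec[symmetric]) (use d zv in auto)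
  then have 2: "(C *\<^sub>v (X2 *\<^sub>v zv)) $ 0 = z" unfolding reg2(2)[symmetric] using zv by (simp add: zv_def)
  have c: "X1 *\<^sub>v w \<in> carrier_vec n" "X2 *\<^sub>v zv \<in> carrier_vec n" using d w zv by auto
  have "C *\<^sub>v track_err x w z = C *\<^sub>v x - C *\<^sub>v (X1 *\<^sub>v w) - C *\<^sub>v (X2 *\<^sub>v zv)"
    unfolding track_err_def zv_def[symmetric] using d(3) x c by (simp add: mult_minus_distrib_mat_vec[of _ 1 n])
  then have "(C *\<^sub>v track_err x w z) $ 0 = (C *\<^sub>v x) $ 0 - (C *\<^sub>v (X1 *\<^sub>v w)) $ 0 - (C *\<^sub>v (X2 *\<^sub>v zv)) $ 0"
    using d by (simp del: index_mult_mat_vec)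
  then show ?thesis using 1 2 by simp
qed

text \<open>Apply the Hurwitz estimate twice: the decaying estimation error and the decaying z'
  force the tracking error. \<open>cz\<close> bounds the distance of \<open>z\<close> from its limit
  as well as its speed. The amplitude depends on initial data and \<open>cz\<close> only, as the
  theorem fixes it before the trajectory.\<close>

lemma output_decay:
  assumes \<mu>: "0 < \<mu>"
  shows "\<exists>\<mu>2>0. \<forall>x0 w0 e0 z0 cz. \<exists>c. \<forall>x w e z z' zstar.
    (\<forall>t\<ge>0. has_vec_derivative x (A *\<^sub>v x t + B *\<^sub>v input (x t) (e t) (z t) + E *\<^sub>v w t) t {0..} \<and>
       has_vec_derivative w (S *\<^sub>v w t) t {0..} \<and>
       has_vec_derivative e ((S - L * E) *\<^sub>v e t + (S * L - L * E * L - L * A) *\<^sub>v x t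
         - (L * B) *\<^sub>v input (x t) (e t) (z t)) t {0..} \<and>
       (z has_real_derivative z' t) (at t within {0..}) \<and>
       \<bar>z t - zstar\<bar> \<le> cz * exp (- \<mu> * t) \<and> \<bar>z' t\<bar> \<le> cz * exp (- \<mu> * t)) \<and>
    x 0 = x0 \<and> w 0 = w0 \<and> e 0 = e0 \<and> z 0 = z0 \<longrightarrow>
    (\<forall>t\<ge>0. \<bar>(C *\<^sub>v x t) $ 0 - zstar\<bar> \<le> c * exp (- \<mu>2 * t))"
proof -
  have SLE: "S - L * E \<in> carrier_mat q q" and ABK: "A + B * K1 \<in> carrier_mat n n"
    using dims by auto
  obtain \<alpha>1 where \<alpha>1: "0 < \<alpha>1" and dec1: "\<And>\<beta> R. \<beta> < \<alpha>1 \<Longrightarrow> (\<exists>c. \<forall>x g.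
      perturbed_solution q (S - L * E) \<beta> R x g
      \<longrightarrow> (\<forall>t\<ge>0. \<forall>k<q. \<bar>x t $ k\<bar> \<le> c * exp (- \<beta> * t)))"
    using hurwitz_decay[OF SLE hurwitz_observer] by blast
  obtain \<alpha>2 where \<alpha>2: "0 < \<alpha>2" and dec2: "\<And>\<beta> R. \<beta> < \<alpha>2 \<Longrightarrow> (\<exists>c. \<forall>x g.
      perturbed_solution n (A + B * K1) \<beta> R x g
      \<longrightarrow> (\<forall>t\<ge>0. \<forall>k<n. \<bar>x t $ k\<bar> \<le> c * exp (- \<beta> * t)))"
    using hurwitz_decay[OF ABK hurwitz_plant] by blast
  \<comment> \<open>One rate for both stages: halving puts it strictly below the two spectral
    margins, and it does not exceed the rate of the incoming signal.\<close>
  define \<beta> where "\<beta> = min \<mu> (min \<alpha>1 \<alpha>2) / 2"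
  have \<beta>: "0 < \<beta>" "\<beta> < \<alpha>1" "\<beta> < \<alpha>2" "\<beta> \<le> \<mu>" using \<mu> \<alpha>1 \<alpha>2 by (auto simp: \<beta>_def)
  define nM where "nM M = (\<Sum>k<dim_row M. \<Sum>j<dim_col M. \<bar>M $$ (k, j)\<bar>)" for M :: "real mat"
  have nM: "0 \<le> nM M" for M unfolding nM_def by (intro sum_nonneg) auto
  show ?thesis
  proof (rule exI[of _ \<beta>], rule conjI[OF \<beta>(1)], intro allI)
    fix x0 w0 e0 :: "real Matrix.vec" and z0 cz :: real
    define R1 where "R1 = (\<Sum>k<q. \<bar>est_err x0 w0 e0 $ k\<bar>)"
    have R1: "\<bar>est_err x0 w0 e0 $ k\<bar> \<le> R1" if "k < q" for k
      unfolding R1_def using that by (intro member_le_sum[of k "{..<q}" "\<lambda>k. \<bar>est_err x0 w0 e0 $ k\<bar>"]) auto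
    have R1_0: "0 \<le> R1" unfolding R1_def by (intro sum_nonneg) auto
    obtain c1 where c1: "\<And>x g.
      perturbed_solution q (S - L * E) \<beta> R1 x g
      \<Longrightarrow> (\<forall>t\<ge>0. \<forall>k<q. \<bar>x t $ k\<bar> \<le> c1 * exp (- \<beta> * t))"
      using dec1[OF \<beta>(2), of R1] by blast
    \<comment> \<open>The summands bound the forcing by the estimation error, the forcing by z', and
      the initial tracking error.\<close>
    define R2 where "R2 = nM B * (nM K2 * \<bar>c1\<bar>) + nM X2 * \<bar>cz\<bar> + (\<Sum>k<n. \<bar>track_err x0 w0 z0 $ k\<bar>)"
    have sum0: "0 \<le> (\<Sum>k<n. \<bar>track_err x0 w0 z0 $ k\<bar>)" by (intro sum_nonneg) auto
    have R2: "\<bar>track_err x0 w0 z0 $ k\<bar> \<le> R2" if "k < n" for k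
    proof -
      have "\<bar>track_err x0 w0 z0 $ k\<bar> \<le> (\<Sum>k<n. \<bar>track_err x0 w0 z0 $ k\<bar>)"
        using that by (intro member_le_sum[of k "{..<n}" "\<lambda>k. \<bar>track_err x0 w0 z0 $ k\<bar>"]) auto
      moreover have "0 \<le> nM B * (nM K2 * \<bar>c1\<bar>) + nM X2 * \<bar>cz\<bar>"
        using nM by (intro add_nonneg_nonneg mult_nonneg_nonneg) auto
      ultimately show ?thesis unfolding R2_def by linarith
    qed
    obtain c2 where c2: "\<And>x g.
      perturbed_solution n (A + B * K1) \<beta> R2 x g
      \<Longrightarrow> (\<forall>t\<ge>0. \<forall>k<n. \<bar>x t $ k\<bar> \<le> c2 * exp (- \<beta> * t))"
      using dec2[OF \<beta>(3), of R2] by blast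
    let ?c = "nM C * \<bar>c2\<bar> + \<bar>cz\<bar>"
    show "\<exists>c. \<forall>x w e z z' zstar.
      (\<forall>t\<ge>0. has_vec_derivative x (A *\<^sub>v x t + B *\<^sub>v input (x t) (e t) (z t) + E *\<^sub>v w t) t {0..} \<and>
         has_vec_derivative w (S *\<^sub>v w t) t {0..} \<and>
         has_vec_derivative e ((S - L * E) *\<^sub>v e t + (S * L - L * E * L - L * A) *\<^sub>v x t
           - (L * B) *\<^sub>v input (x t) (e t) (z t)) t {0..} \<and>
         (z has_real_derivative z' t) (at t within {0..}) \<and>
         \<bar>z t - zstar\<bar> \<le> cz * exp (- \<mu> * t) \<and> \<bar>z' t\<bar> \<le> cz * exp (- \<mu> * t)) \<and>
      x 0 = x0 \<and> w 0 = w0 \<and> e 0 = e0 \<and> z 0 = z0 \<longrightarrow>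
      (\<forall>t\<ge>0. \<bar>(C *\<^sub>v x t) $ 0 - zstar\<bar> \<le> c * exp (- \<beta> * t))"
    proof (rule exI[of _ ?c], rule allI, rule allI, rule allI, rule allI, rule allI, rule allI, rule impI, rule allI, rule impI)
      fix x w e z z' zstar and \<tau> :: real
      assume H: "(\<forall>t\<ge>0. has_vec_derivative x (A *\<^sub>v x t + B *\<^sub>v input (x t) (e t) (z t) + E *\<^sub>v w t) t {0..} \<and>
         has_vec_derivative w (S *\<^sub>v w t) t {0..} \<and>
         has_vec_derivative e ((S - L * E) *\<^sub>v e t + (S * L - L * E * L - L * A) *\<^sub>v x t
           - (L * B) *\<^sub>v input (x t) (e t) (z t)) t {0..} \<and>
         (z has_real_derivative z' t) (at t within {0..}) \<and>
         \<bar>z t - zstar\<bar> \<le> cz * exp (- \<mu> * t) \<and> \<bar>z' t\<bar> \<le> cz * exp (- \<mu> * t)) \<and>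
         x 0 = x0 \<and> w 0 = w0 \<and> e 0 = e0 \<and> z 0 = z0" and \<tau>: "0 \<le> \<tau>"
      note sol = H[THEN conjunct1, rule_format] and init = H[THEN conjunct2]
      define u where "u t = input (x t) (e t) (z t)" for t
      have xd: "has_vec_derivative x (A *\<^sub>v x t + B *\<^sub>v u t + E *\<^sub>v w t) t {0..}"
        and wd: "has_vec_derivative w (S *\<^sub>v w t) t {0..}"
        and ed: "has_vec_derivative e ((S - L * E) *\<^sub>v e t + (S * L - L * E * L - L * A) *\<^sub>v x t
           - (L * B) *\<^sub>v u t) t {0..}"
        and zd: "(z has_real_derivative z' t) (at t within {0..})"
        and zb: "\<bar>z t - zstar\<bar> \<le> cz * exp (- \<mu> * t)" "\<bar>z' t\<bar> \<le> cz * exp (- \<mu> * t)" if "0 \<le> t" for t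
        using sol[OF that] by (auto simp: u_def)
      \<comment> \<open>A matrix-vector product has the row dimension of the matrix whatever the
        vector, so the differential equation by itself fixes the dimension of the state.\<close>
      have wc: "w t \<in> carrier_vec q" if "0 \<le> t" for t
        using has_vec_derivative_carrier[OF wd[OF that], of q t] dims that
        by (metis atLeast_iff carrier_matD(1) carrier_vec_dim_vec dim_mult_mat_vec)
      have xD: "A *\<^sub>v x t + B *\<^sub>v u t + E *\<^sub>v w t \<in> carrier_vec n" for t
        using dims by (intro carrier_vecI) simp
      have eD: "(S - L * E) *\<^sub>v e t + (S * L - L * E * L - L * A) *\<^sub>v x t - (L * B) *\<^sub>v u t \<in> carrier_vec q" for t
        using dims by (intro carrier_vecI) simp
      have wD: "S *\<^sub>v w t \<in> carrier_vec q" for t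
        using dims by (intro carrier_vecI) simp
      have xc: "x t \<in> carrier_vec n" and ec: "e t \<in> carrier_vec q" if "0 \<le> t" for t
        using has_vec_derivative_carrier[OF xd[OF that] xD] has_vec_derivative_carrier[OF ed[OF that] eD] that by auto
      have uc: "u t \<in> carrier_vec 1" for t
        using dims gain_dims by (intro carrier_vecI) (simp add: u_def input_def)
      define \<epsilon> where "\<epsilon> t = est_err (x t) (w t) (e t)" for t
      define \<xi> where "\<xi> t = track_err (x t) (w t) (z t)" for t
      have \<epsilon>c: "\<epsilon> t \<in> carrier_vec q" and \<xi>c: "\<xi> t \<in> carrier_vec n" if "0 \<le> t" for t
        using dims xc[OF that] wc[OF that] ec[OF that] by (auto simp: \<epsilon>_def \<xi>_def est_err_def track_err_def)
      have \<epsilon>d: "has_vec_derivative \<epsilon> ((S - L * E) *\<^sub>v \<epsilon> t + 0\<^sub>v q) t {0..}" if t: "0 \<le> t" for t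
      proof -
        have mem: "t \<in> {0..}" using t by simp
        have LD: "L *\<^sub>v (A *\<^sub>v x t + B *\<^sub>v u t + E *\<^sub>v w t) \<in> carrier_vec q"
          using dims(11) xD by (rule mult_mat_vec_carrier)
        have "has_vec_derivative \<epsilon> ((S - L * E) *\<^sub>v e t + (S * L - L * E * L - L * A) *\<^sub>v x t
            - (L * B) *\<^sub>v u t + L *\<^sub>v (A *\<^sub>v x t + B *\<^sub>v u t + E *\<^sub>v w t) - S *\<^sub>v w t) t {0..}"
          unfolding \<epsilon>_def est_err_def
          by (intro has_vec_derivative_diff[OF _ _ wd[OF t] wD mem]
              has_vec_derivative_add[OF ed[OF t] eD _ LD mem]
              has_vec_derivative_mult_mat_vec[OF dims(11) xd[OF t] xD mem] add_carrier_vec[OF eD LD])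
        then show ?thesis
          unfolding est_err_dynamics[OF xc[OF t] wc[OF t] ec[OF t] uc]
          using SLE \<epsilon>c[OF t] by (simp add: \<epsilon>_def)
      qed
      have \<epsilon>b: "\<bar>\<epsilon> t $ k\<bar> \<le> \<bar>c1\<bar> * exp (- \<beta> * t)" if "0 \<le> t" "k < q" for t k
      proof -
        have "\<bar>\<epsilon> t $ k\<bar> \<le> c1 * exp (- \<beta> * t)"
        proof (rule c1[of \<epsilon> "\<lambda>_. 0\<^sub>v q", rule_format, OF _ that], unfold perturbed_solution_def, intro conjI allI impI)
          show "\<bar>\<epsilon> 0 $ k\<bar> \<le> R1" if "k < q" for k using R1[OF that] init by (simp add: \<epsilon>_def)
        qed (use \<epsilon>d R1_0 in auto)
        also have "\<dots> \<le> \<bar>c1\<bar> * exp (- \<beta> * t)" by (intro mult_right_mono) auto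
        finally show ?thesis .
      qed
      define g where "g t = B *\<^sub>v (K2 *\<^sub>v \<epsilon> t) - X2 *\<^sub>v Matrix.vec 1 (\<lambda>_. z' t)" for t
      have gc: "g t \<in> carrier_vec n" for t
        using dims by (intro carrier_vecI) (simp add: g_def)
      have \<xi>d: "has_vec_derivative \<xi> ((A + B * K1) *\<^sub>v \<xi> t + g t) t {0..}" if t: "0 \<le> t" for t
      proof -
        have mem: "t \<in> {0..}" using t by simp
        have zvd: "has_vec_derivative (\<lambda>s. Matrix.vec 1 (\<lambda>_. z s)) (Matrix.vec 1 (\<lambda>_. z' t)) t {0..}"
          using zd[OF t] by (simp add: has_vec_derivative_def)
        have zvD: "Matrix.vec 1 (\<lambda>_. z' t) \<in> carrier_vec 1" by simp
        have XwD: "X1 *\<^sub>v (S *\<^sub>v w t) \<in> carrier_vec n" using dims(6) wD by (rule mult_mat_vec_carrier)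
        have XzD: "X2 *\<^sub>v Matrix.vec 1 (\<lambda>_. z' t) \<in> carrier_vec n" using dims(7) zvD by (rule mult_mat_vec_carrier)
        have "has_vec_derivative \<xi> (A *\<^sub>v x t + B *\<^sub>v u t + E *\<^sub>v w t - X1 *\<^sub>v (S *\<^sub>v w t)
            - X2 *\<^sub>v Matrix.vec 1 (\<lambda>_. z' t)) t {0..}"
          unfolding \<xi>_def track_err_def
          by (intro has_vec_derivative_diff[OF has_vec_derivative_diff[OF xd[OF t] xD
                  has_vec_derivative_mult_mat_vec[OF dims(6) wd[OF t] wD mem] XwD mem] _
                has_vec_derivative_mult_mat_vec[OF dims(7) zvd zvD mem] XzD mem] minus_carrier_vec[OF xD XwD])
        then show ?thesis
          unfolding u_def track_err_dynamics[OF xc[OF t] wc[OF t] ec[OF t]] by (simp add: \<xi>_def g_def \<epsilon>_def)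
      qed
      have exp_le: "exp (- \<mu> * t) \<le> exp (- \<beta> * t)" if "0 \<le> t" for t
        using \<beta>(4) that by (simp add: mult_right_mono)
      have cz_le: "cz * exp (- \<mu> * t) \<le> \<bar>cz\<bar> * exp (- \<beta> * t)" if "0 \<le> t" for t
        by (rule mult_mono) (use exp_le[OF that] in auto)
      have gb: "\<bar>g t $ k\<bar> \<le> R2 * exp (- \<beta> * t)" if t: "0 \<le> t" and k: "k < n" for t k
      proof -
        have 1: "\<bar>(K2 *\<^sub>v \<epsilon> t) $ j\<bar> \<le> nM K2 * (\<bar>c1\<bar> * exp (- \<beta> * t))" if "j < 1" for j
          using mult_mat_vec_bound[OF gain_dims(1) \<epsilon>c[OF t] that, of "\<bar>c1\<bar> * exp (- \<beta> * t)"] \<epsilon>b[OF t] gain_dims(1)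
          unfolding nM_def by auto
        have K2c: "K2 *\<^sub>v \<epsilon> t \<in> carrier_vec 1" using gain_dims(1) \<epsilon>c[OF t] by (rule mult_mat_vec_carrier)
        have nn: "0 \<le> nM K2 * (\<bar>c1\<bar> * exp (- \<beta> * t))" using nM by (intro mult_nonneg_nonneg) auto
        have 2: "\<bar>(B *\<^sub>v (K2 *\<^sub>v \<epsilon> t)) $ k\<bar> \<le> nM B * (nM K2 * (\<bar>c1\<bar> * exp (- \<beta> * t)))"
          using mult_mat_vec_bound[OF dims(2) K2c k 1 nn] dims(2) unfolding nM_def[of B] by auto
        have zb': "\<bar>Matrix.vec 1 (\<lambda>_. z' t) $ j\<bar> \<le> \<bar>cz\<bar> * exp (- \<beta> * t)" if "j < 1" for j
          using zb(2)[OF t] cz_le[OF t] that by simp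
        have 3: "\<bar>(X2 *\<^sub>v Matrix.vec 1 (\<lambda>_. z' t)) $ k\<bar> \<le> nM X2 * (\<bar>cz\<bar> * exp (- \<beta> * t))"
          using mult_mat_vec_bound[OF dims(7) _ k zb'] dims(7) unfolding nM_def by auto
        have "g t $ k = (B *\<^sub>v (K2 *\<^sub>v \<epsilon> t)) $ k - (X2 *\<^sub>v Matrix.vec 1 (\<lambda>_. z' t)) $ k"
          unfolding g_def by (rule index_minus_vec) (use dims k in simp)
        then have "\<bar>g t $ k\<bar> \<le> nM B * (nM K2 * (\<bar>c1\<bar> * exp (- \<beta> * t))) + nM X2 * (\<bar>cz\<bar> * exp (- \<beta> * t))"
          using 2 3 by linarith
        also have "\<dots> = (nM B * (nM K2 * \<bar>c1\<bar>) + nM X2 * \<bar>cz\<bar>) * exp (- \<beta> * t)" by (simp add: algebra_simps)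
        also have "\<dots> \<le> R2 * exp (- \<beta> * t)" using sum0 by (intro mult_right_mono) (auto simp: R2_def)
        finally show ?thesis .
      qed
      have \<xi>b: "\<bar>\<xi> \<tau> $ k\<bar> \<le> \<bar>c2\<bar> * exp (- \<beta> * \<tau>)" if "k < n" for k
      proof -
        have "\<bar>\<xi> \<tau> $ k\<bar> \<le> c2 * exp (- \<beta> * \<tau>)"
        proof (rule c2[of \<xi> g, rule_format, OF _ \<tau> that], unfold perturbed_solution_def, intro conjI allI impI)
          show "\<bar>\<xi> 0 $ k\<bar> \<le> R2" if "k < n" for k using R2[OF that] init by (simp add: \<xi>_def)
        qed (use \<xi>d gc gb in auto)
        also have "\<dots> \<le> \<bar>c2\<bar> * exp (- \<beta> * \<tau>)" by (intro mult_right_mono) auto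
        finally show ?thesis .
      qed
      have "\<bar>(C *\<^sub>v \<xi> \<tau>) $ 0\<bar> \<le> nM C * (\<bar>c2\<bar> * exp (- \<beta> * \<tau>))"
        using mult_mat_vec_bound[OF dims(3) \<xi>c[OF \<tau>], of 0 "\<bar>c2\<bar> * exp (- \<beta> * \<tau>)"] \<xi>b dims(3)
        unfolding nM_def by auto
      moreover have "(C *\<^sub>v x \<tau>) $ 0 = (C *\<^sub>v \<xi> \<tau>) $ 0 + z \<tau>"
        unfolding \<xi>_def by (rule output_eq[OF xc[OF \<tau>] wc[OF \<tau>]])
      ultimately have "\<bar>(C *\<^sub>v x \<tau>) $ 0 - zstar\<bar> \<le> nM C * (\<bar>c2\<bar> * exp (- \<beta> * \<tau>)) + \<bar>cz\<bar> * exp (- \<beta> * \<tau>)"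
        using zb(1)[OF \<tau>] cz_le[OF \<tau>] by linarith
      then show "\<bar>(C *\<^sub>v x \<tau>) $ 0 - zstar\<bar> \<le> ?c * exp (- \<beta> * \<tau>)" by (simp add: algebra_simps)
    qed
  qed
qed

end

section \<open>Assembly of the network result\<close>

theorem theorem1:
  fixes N :: nat and n q :: "nat \<Rightarrow> nat"
    and A B C E S X1 X2 U1 U2 K1 K2 K3 L :: "nat \<Rightarrow> real mat"
    and d h_low h_up :: "nat \<Rightarrow> real"
    and f :: "nat \<Rightarrow> real \<Rightarrow> real"
    and a :: "nat \<Rightarrow> nat \<Rightarrow> real"
  assumes plant_dims: "\<forall>i\<in>{1..N}. A i \<in> carrier_mat (n i) (n i) \<and> B i \<in> carrier_mat (n i) 1 \<and>
      C i \<in> carrier_mat 1 (n i) \<and> E i \<in> carrier_mat (n i) (q i) \<and> S i \<in> carrier_mat (q i) (q i)"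
    and minimal: "\<forall>i\<in>{1..N}. minimal_realization (C i) (A i) (B i)"
    and observ: "\<forall>i\<in>{1..N}. observable (E i) (S i)"
    and C2: "\<forall>i\<in>{1..N}. twice_cont_differentiable (f i)"
    and hess: "\<forall>i\<in>{1..N}. 0 < h_low i \<and> h_low i \<le> h_up i \<and>
      (\<forall>s. h_low i \<le> deriv (deriv (f i)) s \<and> deriv (deriv (f i)) s \<le> h_up i)"
    and graph: "connected_weighted_graph N a"
    and reg_dims: "\<forall>i\<in>{1..N}. X1 i \<in> carrier_mat (n i) (q i) \<and> X2 i \<in> carrier_mat (n i) 1 \<and>
      U1 i \<in> carrier_mat 1 (q i) \<and> U2 i \<in> carrier_mat 1 1"
    and reg1: "\<forall>i\<in>{1..N}. X1 i * S i = A i * X1 i + B i * U1 i + E i \<and> 0\<^sub>m 1 (q i) = C i * X1 i"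
    and reg2: "\<forall>i\<in>{1..N}. 0\<^sub>m (n i) 1 = A i * X2 i + B i * U2 i \<and> 1\<^sub>m 1 = C i * X2 i"
    and K1: "\<forall>i\<in>{1..N}. K1 i \<in> carrier_mat 1 (n i) \<and> hurwitz (A i + B i * K1 i)"
    and K2: "\<forall>i\<in>{1..N}. K2 i = U1 i - K1 i * X1 i"
    and K3: "\<forall>i\<in>{1..N}. K3 i = U2 i - K1 i * X2 i"
    and L: "\<forall>i\<in>{1..N}. L i \<in> carrier_mat (q i) (n i) \<and> hurwitz (S i - L i * E i)"
  shows "\<exists>ystar. (\<forall>y. optimal_solution N f d y \<longleftrightarrow> y = ystar) \<and>
    (\<forall>\<sigma>\<in>state_space N n q.
       \<exists>\<phi>. closed_loop_solution N A B E S K1 K2 K3 L f d a \<phi> \<and> starts_at N \<sigma> \<phi>) \<and>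
    (\<forall>i\<in>{1..N}. \<exists>\<mu>2>0. \<forall>\<sigma>\<in>state_space N n q. \<exists>\<mu>1>0.
       \<forall>\<phi>. closed_loop_solution N A B E S K1 K2 K3 L f d a \<phi> \<and> starts_at N \<sigma> \<phi> \<longrightarrow>
         (\<forall>t\<ge>0. \<bar>agent_output (C i) (\<phi> t i) - ystar i\<bar> \<le> \<mu>1 * exp (- \<mu>2 * t)))"
proof -
  have reg: "regular_convex (f i) (h_low i) (h_up i)" if "i \<in> {1..N}" for i
    using C2 hess that by (simp add: regular_convex_def)
  interpret weighted_graph N a by unfold_locales (rule graph)
  have agent: "regulated_agent (n i) (q i) (A i) (B i) (C i) (E i) (S i) (X1 i) (X2 i) (U1 i) (U2 i)
      (K1 i) (K2 i) (K3 i) (L i)" if i: "i \<in> {1..N}" for i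
    unfolding regulated_agent_def
    using plant_dims[rule_format, OF i] reg_dims[rule_format, OF i] reg1[rule_format, OF i] reg2[rule_format, OF i]
      K1[rule_format, OF i] K2[rule_format, OF i] K3[rule_format, OF i] L[rule_format, OF i]
    by blast
  obtain ystar lamstar where ystar: "ystar \<in> extensional {1..N}" "(\<Sum>i=1..N. ystar i) = (\<Sum>i=1..N. d i)"
    "\<And>i. i \<in> {1..N} \<Longrightarrow> deriv (f i) (ystar i) = lamstar"
    using kkt_point_exists[OF N_pos, of f h_low h_up "\<Sum>i=1..N. d i"] reg by blast
  \<comment> \<open>Convexity and Lipschitz constants common to all agents, for the network
    estimate.\<close>
  define h where "h = Min (h_low ` {1..N})"
  define H where "H = Max (h_up ` {1..N})"
  have ne: "h_low ` {1..N} \<noteq> {}" "h_up ` {1..N} \<noteq> {}" using N_pos by auto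
  have h: "0 < h" unfolding h_def using ne hess by (subst Min_gr_iff) auto
  have h_le: "h \<le> h_low i" and H_ge: "h_up i \<le> H" if "i \<in> {1..N}" for i
    using that unfolding h_def H_def by (auto intro: Min_le Max_ge)
  have mono: "h * (s - r)\<^sup>2 \<le> (deriv (f i) s - deriv (f i) r) * (s - r)" if "i \<in> {1..N}" for i s r
    using regular_convex.grad_strongly_monotone[OF reg[OF that], of s r]
      mult_right_mono[OF h_le[OF that], of "(s - r)\<^sup>2"] by simp
  have lips_i: "\<bar>deriv (f i) s - deriv (f i) r\<bar> \<le> h_up i * \<bar>s - r\<bar>" if "i \<in> {1..N}" for i s r
    by (rule regular_convex.grad_lipschitz[OF reg[OF that]])
  have lips: "\<bar>deriv (f i) s - deriv (f i) r\<bar> \<le> H * \<bar>s - r\<bar>" if "i \<in> {1..N}" for i s r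
    using lips_i[OF that, of s r] mult_right_mono[OF H_ge[OF that], of "\<bar>s - r\<bar>"] by simp
  have H0: "0 \<le> H"
    using hess[rule_format, of 1] H_ge[of 1] N_pos by auto
  have h_up0: "0 \<le> h_up i" if "i \<in> {1..N}" for i
    using hess[rule_format, OF that] by linarith
  have exists: "\<exists>\<phi>. closed_loop_solution N A B E S K1 K2 K3 L f d a \<phi> \<and> starts_at N \<sigma> \<phi>"
    if "\<sigma> \<in> state_space N n q" for \<sigma>
  proof (rule closed_loop_solution_exists[OF _ lips_i h_up0 that])
    fix i assume i: "i \<in> {1..N}"
    show "A i \<in> carrier_mat (n i) (n i) \<and> B i \<in> carrier_mat (n i) 1 \<and>
      E i \<in> carrier_mat (n i) (q i) \<and> S i \<in> carrier_mat (q i) (q i) \<and> L i \<in> carrier_mat (q i) (n i) \<and>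
      K1 i \<in> carrier_mat 1 (n i) \<and> K2 i \<in> carrier_mat 1 (q i) \<and> K3 i \<in> carrier_mat 1 1"
      using regulated_agent.dims[OF agent[OF i]] regulated_agent.gain_dims[OF agent[OF i]] by blast
  qed
  obtain \<mu> where \<mu>: "0 < \<mu>" and pd: "\<forall>z0 l0 v0. \<exists>c. \<forall>z lam v.
      primal_dual_solution N a (\<lambda>i. deriv (f i)) d z lam v \<and>
      (\<forall>i\<in>{1..N}. z 0 i = z0 i \<and> lam 0 i = l0 i \<and> v 0 i = v0 i) \<longrightarrow>
      (\<forall>i\<in>{1..N}. \<forall>t\<ge>0. \<bar>z t i - ystar i\<bar> \<le> c * exp (- \<mu> * t) \<and> \<bar>lam t i - lamstar\<bar> \<le> c * exp (- \<mu> * t))"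
    using primal_dual_decay[of h "\<lambda>i. deriv (f i)" H ystar d lamstar, OF h mono lips ystar(2,3)] by auto
  have decay: "\<exists>\<mu>2>0. \<forall>\<sigma>\<in>state_space N n q. \<exists>\<mu>1>0.
       \<forall>\<phi>. closed_loop_solution N A B E S K1 K2 K3 L f d a \<phi> \<and> starts_at N \<sigma> \<phi> \<longrightarrow>
         (\<forall>t\<ge>0. \<bar>agent_output (C i) (\<phi> t i) - ystar i\<bar> \<le> \<mu>1 * exp (- \<mu>2 * t))" if i: "i \<in> {1..N}" for i
  proof -
    interpret regulated_agent "n i" "q i" "A i" "B i" "C i" "E i" "S i" "X1 i" "X2 i" "U1 i" "U2 i"
      "K1 i" "K2 i" "K3 i" "L i" by (rule agent[OF i])
    from output_decay[OF \<mu>] obtain \<mu>2 where \<mu>2: "0 < \<mu>2" and out: "\<forall>x0 w0 e0 z0 cz. \<exists>c. \<forall>x w e z z' zstar.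
      (\<forall>t\<ge>0. has_vec_derivative x (A i *\<^sub>v x t + B i *\<^sub>v input (x t) (e t) (z t) + E i *\<^sub>v w t) t {0..} \<and>
         has_vec_derivative w (S i *\<^sub>v w t) t {0..} \<and>
         has_vec_derivative e ((S i - L i * E i) *\<^sub>v e t + (S i * L i - L i * E i * L i - L i * A i) *\<^sub>v x t
           - (L i * B i) *\<^sub>v input (x t) (e t) (z t)) t {0..} \<and>
         (z has_real_derivative z' t) (at t within {0..}) \<and>
         \<bar>z t - zstar\<bar> \<le> cz * exp (- \<mu> * t) \<and> \<bar>z' t\<bar> \<le> cz * exp (- \<mu> * t)) \<and>
      x 0 = x0 \<and> w 0 = w0 \<and> e 0 = e0 \<and> z 0 = z0 \<longrightarrow>
      (\<forall>t\<ge>0. \<bar>(C i *\<^sub>v x t) $ 0 - zstar\<bar> \<le> c * exp (- \<mu>2 * t))"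
      by (elim exE conjE)
    show ?thesis
    proof (rule exI[of _ \<mu>2], rule conjI[OF \<mu>2], rule ballI)
      fix \<sigma> assume "\<sigma> \<in> state_space N n q"
      obtain c where c: "\<forall>z lam v. primal_dual_solution N a (\<lambda>i. deriv (f i)) d z lam v \<and>
        (\<forall>i\<in>{1..N}. z 0 i = decision (\<sigma> i) \<and> lam 0 i = multiplier (\<sigma> i) \<and> v 0 i = integrator (\<sigma> i)) \<longrightarrow>
        (\<forall>i\<in>{1..N}. \<forall>t\<ge>0. \<bar>z t i - ystar i\<bar> \<le> c * exp (- \<mu> * t) \<and> \<bar>lam t i - lamstar\<bar> \<le> c * exp (- \<mu> * t))"
        using pd[THEN spec[of _ "\<lambda>i. decision (\<sigma> i)"], THEN spec[of _ "\<lambda>i. multiplier (\<sigma> i)"],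
            THEN spec[of _ "\<lambda>i. integrator (\<sigma> i)"]] by (elim exE)
      \<comment> \<open>As \<open>lamstar\<close> is the gradient at \<open>ystar i\<close>, the
        speed of \<open>z\<close> is at most \<open>H\<close> times the decision error plus the
        multiplier error.\<close>
      define cz where "cz = (H + 1) * \<bar>c\<bar>"
      have cz: "\<bar>c\<bar> \<le> cz" "H * \<bar>c\<bar> + \<bar>c\<bar> = cz" using H0 by (auto simp: cz_def algebra_simps)
      obtain c' where c': "\<forall>x w e z z' zstar.
        (\<forall>t\<ge>0. has_vec_derivative x (A i *\<^sub>v x t + B i *\<^sub>v input (x t) (e t) (z t) + E i *\<^sub>v w t) t {0..} \<and>
           has_vec_derivative w (S i *\<^sub>v w t) t {0..} \<and>
           has_vec_derivative e ((S i - L i * E i) *\<^sub>v e t + (S i * L i - L i * E i * L i - L i * A i) *\<^sub>v x t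
             - (L i * B i) *\<^sub>v input (x t) (e t) (z t)) t {0..} \<and>
           (z has_real_derivative z' t) (at t within {0..}) \<and>
           \<bar>z t - zstar\<bar> \<le> cz * exp (- \<mu> * t) \<and> \<bar>z' t\<bar> \<le> cz * exp (- \<mu> * t)) \<and>
        x 0 = plant_state (\<sigma> i) \<and> w 0 = disturbance (\<sigma> i) \<and> e 0 = observer_state (\<sigma> i) \<and> z 0 = decision (\<sigma> i) \<longrightarrow>
        (\<forall>t\<ge>0. \<bar>(C i *\<^sub>v x t) $ 0 - zstar\<bar> \<le> c' * exp (- \<mu>2 * t))"
        using out[THEN spec[of _ "plant_state (\<sigma> i)"], THEN spec[of _ "disturbance (\<sigma> i)"],
            THEN spec[of _ "observer_state (\<sigma> i)"], THEN spec[of _ "decision (\<sigma> i)"], THEN spec[of _ cz]]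
        by (elim exE)
      show "\<exists>\<mu>1>0. \<forall>\<phi>. closed_loop_solution N A B E S K1 K2 K3 L f d a \<phi> \<and> starts_at N \<sigma> \<phi> \<longrightarrow>
         (\<forall>t\<ge>0. \<bar>agent_output (C i) (\<phi> t i) - ystar i\<bar> \<le> \<mu>1 * exp (- \<mu>2 * t))"
      \<comment> \<open>The amplitude must be positive, while nothing is known about the sign of
        \<open>c'\<close>.\<close>
      proof (rule exI[of _ "\<bar>c'\<bar> + 1"], rule conjI, simp, rule allI, rule impI, rule allI, rule impI)
        fix \<phi> and t :: real
        assume \<phi>: "closed_loop_solution N A B E S K1 K2 K3 L f d a \<phi> \<and> starts_at N \<sigma> \<phi>" and t: "0 \<le> t"
        note sol = \<phi>[THEN conjunct1, unfolded closed_loop_solution_def Let_def, rule_format]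
        have start: "\<phi> 0 j = \<sigma> j" if "j \<in> {1..N}" for j
          using \<phi> that by (simp add: starts_at_def)
        define z where "z t i = decision (\<phi> t i)" for t i
        define lam where "lam t i = multiplier (\<phi> t i)" for t i
        define v where "v t i = integrator (\<phi> t i)" for t i
        have "primal_dual_solution N a (\<lambda>i. deriv (f i)) d z lam v"
          unfolding primal_dual_solution_def z_def lam_def v_def using sol by blast
        moreover have "\<forall>i\<in>{1..N}. z 0 i = decision (\<sigma> i) \<and> lam 0 i = multiplier (\<sigma> i) \<and> v 0 i = integrator (\<sigma> i)"
          using start by (simp add: z_def lam_def v_def)
        ultimately have zl: "\<bar>z s i - ystar i\<bar> \<le> c * exp (- \<mu> * s)" "\<bar>lam s i - lamstar\<bar> \<le> c * exp (- \<mu> * s)"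
          if "0 \<le> s" for s
          using c i that by blast+
        have c_le: "c * exp (- \<mu> * s) \<le> \<bar>c\<bar> * exp (- \<mu> * s)" for s by (intro mult_right_mono) auto
        have zc: "\<bar>z s i - ystar i\<bar> \<le> \<bar>c\<bar> * exp (- \<mu> * s)" if "0 \<le> s" for s
          using zl(1)[OF that] c_le[of s] by linarith
        have z_bound: "\<bar>z s i - ystar i\<bar> \<le> cz * exp (- \<mu> * s)" if "0 \<le> s" for s
          by (rule order.trans[OF zc[OF that] mult_right_mono[OF cz(1)]]) simp
        have z'_bound: "\<bar>- deriv (f i) (z s i) + lam s i\<bar> \<le> cz * exp (- \<mu> * s)" if "0 \<le> s" for s
        proof -
          have "\<bar>- deriv (f i) (z s i) + lam s i\<bar>
              \<le> \<bar>deriv (f i) (z s i) - deriv (f i) (ystar i)\<bar> + \<bar>lam s i - lamstar\<bar>"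
            using ystar(3)[OF i] by linarith
          also have "\<dots> \<le> H * (\<bar>c\<bar> * exp (- \<mu> * s)) + \<bar>c\<bar> * exp (- \<mu> * s)"
            using lips[OF i, of "z s i" "ystar i"] zl(2)[OF that] c_le[of s]
              mult_left_mono[OF zc[OF that] H0] by linarith
          also have "\<dots> = cz * exp (- \<mu> * s)" unfolding cz(2)[symmetric] by (simp add: algebra_simps)
          finally show ?thesis .
        qed
        have u: "control_input (K1 i) (K2 i) (K3 i) (L i) (\<phi> s i)
            = input (plant_state (\<phi> s i)) (observer_state (\<phi> s i)) (decision (\<phi> s i))" for s
          by (simp add: control_input_def input_def)
        have "\<bar>(C i *\<^sub>v plant_state (\<phi> t i)) $ 0 - ystar i\<bar> \<le> c' * exp (- \<mu>2 * t)"
        proof (rule c'[rule_format, where x = "\<lambda>s. plant_state (\<phi> s i)" and w = "\<lambda>s. disturbance (\<phi> s i)"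
              and e = "\<lambda>s. observer_state (\<phi> s i)" and z = "\<lambda>s. decision (\<phi> s i)"
              and z' = "\<lambda>s. - deriv (f i) (z s i) + lam s i", OF _ t], intro conjI allI impI)
          fix s :: real assume s: "0 \<le> s"
          note agent_sol = sol[OF i s, unfolded u]
          show "\<bar>decision (\<phi> s i) - ystar i\<bar> \<le> cz * exp (- \<mu> * s)" using z_bound[OF s] by (simp add: z_def)
          show "\<bar>- deriv (f i) (z s i) + lam s i\<bar> \<le> cz * exp (- \<mu> * s)" by (rule z'_bound[OF s])
          show "((\<lambda>s. decision (\<phi> s i)) has_real_derivative - deriv (f i) (z s i) + lam s i) (at s within {0..})"
            using agent_sol unfolding z_def lam_def by blast
        qed (use sol[OF i, unfolded u] start[OF i] in simp_all)
        then have "\<bar>agent_output (C i) (\<phi> t i) - ystar i\<bar> \<le> c' * exp (- \<mu>2 * t)" by (simp add: agent_output_def)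
        also have "\<dots> \<le> (\<bar>c'\<bar> + 1) * exp (- \<mu>2 * t)" by (intro mult_right_mono) auto
        finally show "\<bar>agent_output (C i) (\<phi> t i) - ystar i\<bar> \<le> (\<bar>c'\<bar> + 1) * exp (- \<mu>2 * t)" .
      qed
    qed
  qed
  have opt: "optimal_solution N f d y \<longleftrightarrow> y = ystar" for y
    by (rule optimal_solution_iff_kkt[OF reg ystar])
  show ?thesis
    by (rule exI[of _ ystar]) (intro conjI allI ballI opt exists decay)
qed

end
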